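(* Let $T>0$ and $\frac{2}{3}<H<1$, and let $B=\{B_t\}_{t\ge 0}$ be a one-dimensional fractional Brownian motion with Hurst parameter $H$. For $\varepsilon>0$ let $$\alpha_\varepsilon=\int_0^T\int_0^t p_\varepsilon'(B_t-B_s)\,ds\,dt,\qquad p_\varepsilon(x)=(2\pi\varepsilon)^{-1/2}e^{-x^2/(2\varepsilon)}.$$ Then, as $\varepsilon\to 0$, the random variables $\varepsilon^{\frac{3}{2}-\frac{1}{H}}\alpha_\varepsilon$ converge in law to $\mathcal{N}(0,\sigma^2)$, where $$\sigma^2=\frac{T^{2H}(2H-1)}{4H\pi}\,B\!\left(\frac{1}{H},\frac{3H-2}{2H}\right)^2 B(2,2H-1)$$ and $B(\cdot,\cdot)$ (with two arguments) denotes the Euler Beta function.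
   Context: A one-dimensional fractional Brownian motion with Hurst parameter $H\in(0,1)$ is a centered Gaussian process $\{B_t\}_{t\ge0}$ on a probability space $(\Omega,\mathcal F,\mathbb P)$ with covariance $\mathbb E[B_tB_s]=\frac12(t^{2H}+s^{2H}-|t-s|^{2H})$. $p_\varepsilon'$ is the derivative of $p_\varepsilon$ with respect to $x$. $\mathcal N(0,\gamma)$ denotes the centered Gaussian distribution with variance $\gamma$. *)

theory Defs
  imports "HOL-Probability.Probability"
begin

text \<open>
  The centered Gaussian distribution \<open>\<N>(0,\<gamma>)\<close>, parametrized by its variance. The degenerate case
  \<open>\<gamma> = 0\<close> is needed because linear combinations of the values of a Gaussian process may vanish.
\<close>
definition centered_normal :: "real \<Rightarrow> real measure" where
  "centered_normal \<gamma> =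
     (if \<gamma> = 0 then return borel 0 else density lborel (normal_density 0 (sqrt \<gamma>)))"

text \<open>
  A centered Gaussian process indexed by \<open>[0,\<infinity>)\<close>; the values of \<open>B\<close> at negative times are irrelevant.
\<close>
definition centered_gaussian_process :: "'a measure \<Rightarrow> (real \<Rightarrow> 'a \<Rightarrow> real) \<Rightarrow> bool" where
  "centered_gaussian_process M B \<longleftrightarrow>
     prob_space M \<and>
     (\<forall>t\<ge>0. B t \<in> borel_measurable M) \<and>
     (\<forall>(A :: real set) a. finite A \<longrightarrow> A \<subseteq> {0..} \<longrightarrow>
        (\<exists>\<gamma>\<ge>0. distr M borel (\<lambda>\<omega>. \<Sum>t\<in>A. a t * B t \<omega>) = centered_normal \<gamma>))"

definition fractional_brownian_motion ::
    "real \<Rightarrow> 'a measure \<Rightarrow> (real \<Rightarrow> 'a \<Rightarrow> real) \<Rightarrow> bool" where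
  "fractional_brownian_motion H M B \<longleftrightarrow>
     0 < H \<and> H < 1 \<and>
     centered_gaussian_process M B \<and>
     (\<forall>t\<ge>0. \<forall>s\<ge>0. (\<integral>\<omega>. B t \<omega> * B s \<omega> \<partial>M) =
        (t powr (2 * H) + s powr (2 * H) - \<bar>t - s\<bar> powr (2 * H)) / 2)"

text \<open>
  Joint measurability in time and chance. It is what makes the pathwise time integrals below
  well-defined random variables; it holds for every process with continuous paths
  (lemma \<open>continuous_paths_measurable_process\<close>).
\<close>
definition measurable_process :: "'a measure \<Rightarrow> (real \<Rightarrow> 'a \<Rightarrow> real) \<Rightarrow> bool" where
  "measurable_process M B \<longleftrightarrow>
     (\<lambda>(t, \<omega>). B t \<omega>) \<in> borel_measurable (restrict_space borel {0..} \<Otimes>\<^sub>M M)"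

definition heat_kernel :: "real \<Rightarrow> real \<Rightarrow> real" where
  "heat_kernel \<epsilon> x = (2 * pi * \<epsilon>) powr (- 1 / 2) * exp (- x\<^sup>2 / (2 * \<epsilon>))"

definition dslt_approx :: "(real \<Rightarrow> 'a \<Rightarrow> real) \<Rightarrow> real \<Rightarrow> real \<Rightarrow> 'a \<Rightarrow> real" where
  "dslt_approx B T \<epsilon> \<omega> =
     (LBINT t:{0..T}. (LBINT s:{0..t}. deriv (heat_kernel \<epsilon>) (B t \<omega> - B s \<omega>)))"

text \<open>
  Convergence in law of a family of real random variables along an arbitrary filter. The library's
  \<^const>\<open>weak_conv_m\<close> covers sequences only; the second conjunct is its definition with
  \<^const>\<open>sequentially\<close> replaced by \<open>F\<close>.
\<close>
definition converges_in_law ::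
    "'a measure \<Rightarrow> ('i \<Rightarrow> 'a \<Rightarrow> real) \<Rightarrow> real measure \<Rightarrow> 'i filter \<Rightarrow> bool" where
  "converges_in_law M X \<nu> F \<longleftrightarrow>
     (\<forall>\<^sub>F i in F. X i \<in> borel_measurable M) \<and>
     (\<forall>x. isCont (cdf \<nu>) x \<longrightarrow> ((\<lambda>i. cdf (distr M borel (X i)) x) \<longlongrightarrow> cdf \<nu> x) F)"

lemma converges_in_law_sequentially:
  assumes "\<And>n. X n \<in> borel_measurable M"
  shows "converges_in_law M X \<nu> sequentially \<longleftrightarrow> weak_conv_m (\<lambda>n. distr M borel (X n)) \<nu>"
  using assms by (simp add: converges_in_law_def weak_conv_m_def weak_conv_def)

lemma continuous_paths_measurable_process:
  assumes meas: "\<And>t. t \<ge> 0 \<Longrightarrow> B t \<in> borel_measurable M"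
    and cont: "\<And>\<omega>. \<omega> \<in> space M \<Longrightarrow> continuous_on {0..} (\<lambda>t. B t \<omega>)"
  shows "measurable_process M B"
proof -
  let ?N = "restrict_space borel {0::real..} \<Otimes>\<^sub>M M"
  define d where "d n t = real (nat \<lfloor>real (Suc n) * t\<rfloor>) / real (Suc n)" for n and t :: real
  have d_lim: "(\<lambda>n. d n t) \<longlonglongrightarrow> t" if "t \<ge> 0" for t
  proof (rule tendsto_sandwich)
    have "t - 1 / real (Suc n) \<le> d n t \<and> d n t \<le> t" for n
    proof -
      define c where "c = real (Suc n)"
      have "c > 0" by (simp add: c_def)
      moreover have "t - 1 / c = (c * t - 1) / c" and "t = (c * t) / c"
        using \<open>c > 0\<close> by (simp_all add: field_simps)
      moreover have "d n t = of_int \<lfloor>c * t\<rfloor> / c"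
        using that \<open>c > 0\<close> by (simp add: d_def c_def del: of_nat_Suc)
      moreover have "c * t - 1 \<le> of_int \<lfloor>c * t\<rfloor>" and "of_int \<lfloor>c * t\<rfloor> \<le> c * t"
        by linarith+
      ultimately show ?thesis
        unfolding c_def [symmetric] by (metis divide_right_mono less_imp_le)
    qed
    then show "\<forall>\<^sub>F n in sequentially. t - 1 / real (Suc n) \<le> d n t"
      and "\<forall>\<^sub>F n in sequentially. d n t \<le> t" by simp_all
    show "(\<lambda>n. t - 1 / real (Suc n)) \<longlonglongrightarrow> t"
      using tendsto_diff[OF tendsto_const LIMSEQ_inverse_real_of_nat, of t]
      by (simp add: inverse_eq_divide)
  qed simp
  have "(\<lambda>x. B (d n (fst x)) (snd x)) \<in> borel_measurable ?N" for n
  proof -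
    have "(\<lambda>x. B (real k / real (Suc n)) (snd x)) \<in> borel_measurable ?N" for k :: nat
      by (intro measurable_compose[OF measurable_snd] meas) simp
    moreover have "(\<lambda>x. nat \<lfloor>real (Suc n) * fst x\<rfloor>) \<in> measurable ?N (count_space UNIV)"
    proof -
      have "fst \<in> measurable ?N (borel :: real measure)"
        using measurable_compose[OF measurable_fst measurable_restrict_space1[OF measurable_ident]]
        by (simp add: id_def)
      then show ?thesis by measurable
    qed
    ultimately show ?thesis
      unfolding d_def by (rule measurable_compose_countable)
  qed
  moreover have "(\<lambda>n. B (d n (fst x)) (snd x)) \<longlonglongrightarrow> B (fst x) (snd x)" if "x \<in> space ?N" for x
  proof -
    have x: "fst x \<ge> 0" "snd x \<in> space M"
      using that by (auto simp: space_pair_measure space_restrict_space)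
    show ?thesis
      by (rule continuous_on_tendsto_compose[OF cont[OF x(2)] d_lim[OF x(1)]])
         (use x in \<open>auto simp: d_def\<close>)
  qed
  ultimately show ?thesis
    unfolding measurable_process_def case_prod_beta by (rule borel_measurable_LIMSEQ_real[rotated])
qed

end

theory Submission
  imports Defs "HOL-Real_Asymp.Real_Asymp"
begin

text \<open>
  Write \<open>c = (2\<pi>)\<^sup>-\<^sup>1\<^sup>/\<^sup>2 \<integral> x (1 + x\<^sup>2\<^sup>H)\<^sup>-\<^sup>3\<^sup>/\<^sup>2 dx\<close>, the integral being over the positive half-line; since \<open>B(2, 2H - 1) = 1 / (2H (2H - 1))\<close>,
  the variance \<open>\<sigma>\<^sup>2\<close> equals \<open>c\<^sup>2 T\<^sup>2\<^sup>H\<close>. For \<open>H > 2/3\<close> the first Wiener chaos dominates, and \<open>\<epsilon>\<^sup>3\<^sup>/\<^sup>2\<^sup>-\<^sup>1\<^sup>/\<^sup>H \<alpha>\<^sub>\<epsilon>\<close> in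
  fact converges in \<open>L\<^sup>2\<close> to the Gaussian variable \<open>- c (B\<^sub>T - B\<^sub>0)\<close>. This is checked on second moments, which are explicit
  Gaussian integrals. The cross moment with \<open>B\<^sub>T - B\<^sub>0\<close> has the required limit because the mass of
  \<open>u (\<epsilon> + u\<^sup>2\<^sup>H)\<^sup>-\<^sup>3\<^sup>/\<^sup>2\<close> concentrates at small \<open>u = t - s\<close>. The second moment of \<open>\<alpha>\<^sub>\<epsilon>\<close> is an integral of
  \<open>\<mu> (V\<^sub>1 V\<^sub>2 - \<mu>\<^sup>2)\<^sup>-\<^sup>3\<^sup>/\<^sup>2\<close> over pairs of intervals, where \<open>\<mu>\<close> is the covariance of the increments over the two intervals and
  \<open>V\<^sub>i\<close> is \<open>\<epsilon>\<close> plus their variances. Disjoint pairs give at most the required limit, because \<open>\<mu>\<close> is bounded by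
  \<open>H (2H - 1)\<close> times the product of the lengths times the gap to the power \<open>2H - 2\<close>. Overlapping pairs are negligible, because
  the determinant of the covariance matrix is bounded below by a multiple of \<open>(m \<rho>)\<^sup>2\<^sup>H\<close>, where \<open>m\<close> is the smaller length and
  \<open>\<rho>\<close> the larger distance between corresponding endpoints.
\<close>



section \<open>Covariances of fractional Brownian increments\<close>

text \<open>The squared \<open>L2\<close> distance between the rescaled approximation and - c (B_T -
  B_0) expands into a second moment, a cross moment and c^2 T^(2H). It is nonnegative, so an upper
  bound for the second moment and a one-sided bound for the cross moment suffice, provided both
  carry the sharp constant: the three limits are 1, -2 and 1 times c^2 T^(2H). No chaos expansion is
  computed. The value of c arises because a short increment of length u near time t has covariance
  about H u (t^(2H-1) + (T-t)^(2H-1)) with B_T - B_0, and this weight integrates to u T^(2H) over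
  [0, T]. The condition 2/3 < H makes u^(1-3H) integrable at infinity, hence c finite. The obstacle
  is the power -3/2 of the determinant. For overlapping intervals it is far from that of V_1 V_2.
  For disjoint ones the next term of its expansion, of order 3 in \<mu>, is too singular at small
  gaps when H is near 2/3; an exponent between 1 and 3 replaces it.\<close>

lemma powr_subadditive_gap:
  fixes x y H :: real
  assumes "0 \<le> x" "x \<le> y" "0 < H" "H < 1"
  shows "(2 - 2 powr H) * x powr H \<le> x powr H + y powr H - (x + y) powr H"
proof (cases "x = 0")
  case True then show ?thesis using assms by simp
next
  case False
  then have x: "x > 0" using assms by simp
  \<comment> \<open>For fixed \<open>x\<close> the right-hand side is \<open>x powr H + g y\<close>;
    the constant \<open>2 - 2 powr H\<close> comes from its value at \<open>y = x\<close>, where it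
    is smallest.\<close>
  define g where "g z = z powr H - (x + z) powr H" for z
  have "g x \<le> g y"
  proof (rule DERIV_nonneg_imp_nondecreasing[OF assms(2)])
    fix z assume z: "x \<le> z" "z \<le> y"
    have "(g has_real_derivative (H * z powr (H - 1) - H * (x + z) powr (H - 1))) (at z)"
      unfolding g_def using x z by (auto intro!: derivative_eq_intros)
    moreover have "(x + z) powr (H - 1) \<le> z powr (H - 1)"
      using x z assms by (intro powr_mono2') auto
    ultimately show "\<exists>y. (g has_real_derivative y) (at z) \<and> 0 \<le> y"
      using assms by (intro exI[of _ "H * z powr (H - 1) - H * (x + z) powr (H - 1)"]) auto
  qed
  moreover have "(x + x) powr H = 2 powr H * x powr H"
    using x by (simp add: powr_mult[symmetric])
  ultimately show ?thesis by (simp add: g_def algebra_simps)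
qed

lemma powr_subadditive_gap_min:
  fixes x y H :: real
  assumes "0 \<le> x" "0 \<le> y" "0 < H" "H < 1"
  shows "(2 - 2 powr H) * min x y powr H \<le> x powr H + y powr H - (x + y) powr H"
proof (cases "x \<le> y")
  case True
  with powr_subadditive_gap[of x y H] assms show ?thesis by (simp add: min_def)
next
  case False
  with powr_subadditive_gap[of y x H] assms show ?thesis by (simp add: min_def add.commute)
qed

lemma two_powr_less_2: "0 < H \<Longrightarrow> H < 1 \<Longrightarrow> (2::real) powr H < 2"
  using powr_less_mono[of H 1 2] by simp

lemma powr_subadditive:
  fixes x y H :: real
  assumes "0 \<le> x" "0 \<le> y" "0 < H" "H < 1"
  shows "(x + y) powr H \<le> x powr H + y powr H"
proof -
  have "0 \<le> (2 - 2 powr H) * min x y powr H"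
    using two_powr_less_2[OF assms(3,4)] by simp
  then show ?thesis using powr_subadditive_gap_min[OF assms] by linarith
qed

lemma powr_diff_concave:
  fixes x y b \<theta> :: real
  assumes "0 < x" "x \<le> y" "0 \<le> b" "0 < \<theta>" "\<theta> < 1"
  shows "(y + b) powr \<theta> - y powr \<theta> \<le> (x + b) powr \<theta> - x powr \<theta>"
proof -
  define g where "g z = z powr \<theta> - (z + b) powr \<theta>" for z
  have "g x \<le> g y"
  proof (rule DERIV_nonneg_imp_nondecreasing[OF assms(2)])
    fix z assume z: "x \<le> z" "z \<le> y"
    have "(g has_real_derivative (\<theta> * z powr (\<theta> - 1) - \<theta> * (z + b) powr (\<theta> - 1))) (at z)"
      unfolding g_def using assms z by (auto intro!: derivative_eq_intros)
    moreover have "(z + b) powr (\<theta> - 1) \<le> z powr (\<theta> - 1)"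
      using z assms by (intro powr_mono2') auto
    ultimately show "\<exists>y. (g has_real_derivative y) (at z) \<and> 0 \<le> y"
      using assms by (intro exI[of _ "\<theta> * z powr (\<theta> - 1) - \<theta> * (z + b) powr (\<theta> - 1)"]) auto
  qed
  then show ?thesis by (simp add: g_def)
qed

lemma powr_diff_le:
  fixes x y h :: real
  assumes "0 \<le> y" "y \<le> x" "1 \<le> h"
  shows "h * (x - y) * y powr (h - 1) \<le> x powr h - y powr h"
    and "x powr h - y powr h \<le> h * (x - y) * x powr (h - 1)"
proof -
  have *: "h * (x - y) * y powr (h - 1) \<le> x powr h - y powr h \<and>
        x powr h - y powr h \<le> h * (x - y) * x powr (h - 1)" if "y \<noteq> x"
  proof -
    have "y < x" using assms that by simp
    then have "\<exists>l z. y < z \<and> z < x \<and> ((\<lambda>z. z powr h) has_real_derivative l) (at z) \<and>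
        x powr h - y powr h = (x - y) * l"
    proof (rule MVT)
      show "continuous_on {y..x} (\<lambda>z. z powr h)"
        using assms by (intro continuous_on_powr' continuous_on_id continuous_on_const) auto
      fix z assume "y < z" "z < x"
      then show "(\<lambda>z. z powr h) differentiable (at z)"
        using has_real_derivative_powr[of z h] assms by (auto simp: real_differentiable_def)
    qed
    then obtain l z where z: "y < z" "z < x" "((\<lambda>z. z powr h) has_real_derivative l) (at z)"
      and eq: "x powr h - y powr h = (x - y) * l" by blast
    have l: "l = h * z powr (h - 1)"
      using DERIV_unique[OF z(3) has_real_derivative_powr] z assms by simp
    have "z powr (h - 1) \<le> x powr (h - 1)" "y powr (h - 1) \<le> z powr (h - 1)"
      using z assms by (auto intro!: powr_mono2)
    then have "(x - y) * (h * z powr (h - 1)) \<le> (x - y) * (h * x powr (h - 1))"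
       "(x - y) * (h * y powr (h - 1)) \<le> (x - y) * (h * z powr (h - 1))"
      using z assms by (intro mult_left_mono; simp)+
    then show ?thesis unfolding eq l by (simp add: algebra_simps)
  qed
  show "h * (x - y) * y powr (h - 1) \<le> x powr h - y powr h" using * by (cases "y = x") auto
  show "x powr h - y powr h \<le> h * (x - y) * x powr (h - 1)" using * by (cases "y = x") auto
qed

lemma powr_superadditive:
  fixes x y h :: real
  assumes "0 \<le> x" "0 \<le> y" "1 \<le> h"
  shows "x powr h + y powr h \<le> (x + y) powr h"
proof -
  have "x powr h + y powr h \<le> x * (x+y) powr (h-1) + y * (x+y) powr (h-1)"
  proof (rule add_mono)
    have *: "z powr h = z * z powr (h - 1)" if "z \<ge> 0" for z
      using that by (cases "z = 0") (auto simp: powr_diff)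
    show "x powr h \<le> x * (x+y) powr (h-1)" unfolding *[OF assms(1)]
      using assms by (intro mult_left_mono powr_mono2) auto
    show "y powr h \<le> y * (x+y) powr (h-1)" unfolding *[OF assms(2)]
      using assms by (intro mult_left_mono powr_mono2) auto
  qed
  also have "\<dots> = (x + y) * (x + y) powr (h - 1)" by (simp add: algebra_simps)
  also have "\<dots> = (x + y) powr h"
    using assms by (cases "x + y = 0") (auto simp: powr_diff)
  finally show ?thesis .
qed

text \<open>With \<open>h = 2*H\<close> both sides are twice the covariance of increments of lengths
  \<open>a\<close> and \<open>c\<close> across a gap, which decays as the gap widens: the derivative
  in the gap is \<open>h\<close> times a second difference of the power \<open>h - 1\<close>, which
  is concave because \<open>h - 1 < 1\<close>.\<close>

lemma second_difference_antimono:
  fixes a b b' c h :: real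
  assumes "0 \<le> a" "0 \<le> b" "b \<le> b'" "0 \<le> c" "1 < h" "h < 2"
  shows "(a + b' + c) powr h + b' powr h - (a + b') powr h - (b' + c) powr h
       \<le> (a + b + c) powr h + b powr h - (a + b) powr h - (b + c) powr h"
proof -
  define g where "g z = (a + z) powr h + (z + c) powr h - (a + z + c) powr h - z powr h" for z
  have "g b \<le> g b'"
  \<comment> \<open>Only interior derivatives are taken, since the lemma is later applied at
    \<open>b = 0\<close>, where the differentiation rule for \<open>powr\<close> does not
    apply.\<close>
  proof (rule DERIV_nonneg_imp_increasing_open[OF assms(3)])
    fix z assume z: "b < z" "z < b'"
    let ?d = "h * (a + z) powr (h - 1) + h * (z + c) powr (h - 1)
        - h * (a + z + c) powr (h - 1) - h * z powr (h - 1)"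
    have "(g has_real_derivative ?d) (at z)"
      unfolding g_def using assms z by (auto intro!: derivative_eq_intros)
    moreover have "(a + z + c) powr (h-1) - (a + z) powr (h-1) \<le> (z + c) powr (h-1) - z powr (h-1)"
      using powr_diff_concave[of z "a + z" c "h - 1"] z assms by simp
    then have "h * ((a + z + c) powr (h-1) - (a + z) powr (h-1)) \<le> h * ((z + c) powr (h-1) - z powr (h-1))"
      using assms by (intro mult_left_mono) auto
    then have "0 \<le> ?d" by (simp add: algebra_simps)
    ultimately show "\<exists>y. (g has_real_derivative y) (at z) \<and> 0 \<le> y" by blast
  qed (use assms in \<open>auto simp: g_def intro!: continuous_intros continuous_on_powr'\<close>)
  then show ?thesis by (simp add: g_def)
qed

lemma powr_double: "0 \<le> x \<Longrightarrow> x powr (2 * H) = (x powr H)\<^sup>2" for x H :: real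
  by (cases "x = 0") (auto simp: power2_eq_square powr_add[symmetric])

text \<open>For consecutive lengths \<open>a\<close>, \<open>b\<close>, \<open>c\<close>: twice the difference between the product of the standard deviations
  and the covariance of the increments over the crossing intervals of lengths \<open>a + b\<close> and \<open>b + c\<close>.\<close>

definition crossing_gap :: "real \<Rightarrow> real \<Rightarrow> real \<Rightarrow> real \<Rightarrow> real" where
  "crossing_gap H a b c = a powr (2*H) + c powr (2*H) - (a + b + c) powr (2*H) - b powr (2*H)
     + 2 * (a + b) powr H * (b + c) powr H"

text \<open>The derivative in the first length is nonnegative because the power \<open>2*H-1\<close>
  is subadditive: this splits the negative term into \<open>z powr (2*H-1)\<close>, which cancels,
  and \<open>(b + c) powr (H-1) * (b + c) powr H\<close>, which the product term dominates as
  \<open>z + b <= b + c\<close>. This is where \<open>a <= c\<close> enters.\<close>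

lemma crossing_gap_mono_a:
  fixes a b c H :: real
  assumes "0 \<le> a" "a \<le> c" "0 < b" "1 / 2 < H" "H < 1"
  shows "crossing_gap H 0 b c \<le> crossing_gap H a b c"
proof (rule DERIV_nonneg_imp_increasing_open[OF assms(1)])
  fix z assume z: "0 < z" "z < a"
  let ?d = "(2*H) * z powr (2*H - 1) - (2*H) * (z + b + c) powr (2*H - 1)
     + 2 * (H * (z + b) powr (H - 1)) * (b + c) powr H"
  have "((\<lambda>z. crossing_gap H z b c) has_real_derivative ?d) (at z)"
    unfolding crossing_gap_def using assms z by (auto intro!: derivative_eq_intros)
  moreover have "0 \<le> ?d"
  proof -
    have "(z + (b + c)) powr (2*H-1) \<le> z powr (2*H-1) + (b + c) powr (2*H-1)"
      using assms z by (intro powr_subadditive) auto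
    also have "(b + c) powr (2*H-1) = (b + c) powr (H-1) * (b + c) powr H"
      by (simp add: powr_add[symmetric])
    also have "\<dots> \<le> (z + b) powr (H-1) * (b + c) powr H"
      using assms z by (intro mult_right_mono powr_mono2') auto
    finally have "(2*H) * (z + (b + c)) powr (2*H-1) \<le>
      (2*H) * (z powr (2*H-1) + (z + b) powr (H-1) * (b + c) powr H)"
      using assms by (intro mult_left_mono) auto
    then show ?thesis by (simp add: algebra_simps)
  qed
  ultimately show "\<exists>y. ((\<lambda>z. crossing_gap H z b c) has_real_derivative y) (at z) \<and> 0 \<le> y" by blast
next
  show "continuous_on {0..a} (\<lambda>z. crossing_gap H z b c)"
    unfolding crossing_gap_def using assms
    by (auto intro!: continuous_intros continuous_on_powr')
qed

text \<open>Completing the square in the product term writes \<open>crossing_gap H a b c\<close> as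
  \<open>a powr (2*H) + c powr (2*H)\<close> minus a second difference, minus the square of
  \<open>(b + c) powr H - (a + b) powr H\<close>. Both subtracted terms are largest at
  \<open>b = 0\<close>: the first by \<open>second_difference_antimono\<close>, the second because
  the power \<open>H\<close> is concave.\<close>

lemma crossing_gap_mono_b:
  fixes a b c H :: real
  assumes "0 \<le> a" "a \<le> c" "0 \<le> b" "1 / 2 < H" "H < 1"
  shows "crossing_gap H a 0 c \<le> crossing_gap H a b c"
proof -
  have "0 \<le> ((c powr H - a powr H) - ((b + c) powr H - (b + a) powr H)) *
      ((c powr H - a powr H) + ((b + c) powr H - (b + a) powr H))"
  proof (cases "a = 0")
    case False
    then have "(c + b) powr H - c powr H \<le> (a + b) powr H - a powr H"
      using assms by (intro powr_diff_concave) auto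
    moreover have "a powr H \<le> c powr H" "(b + a) powr H \<le> (b + c) powr H"
      using assms by (auto intro!: powr_mono2)
    ultimately show ?thesis by (intro mult_nonneg_nonneg) (auto simp: add.commute)
  next
    case True
    moreover have "(b + c) powr H \<le> b powr H + c powr H"
      using assms by (intro powr_subadditive) auto
    moreover have "b powr H \<le> (b + c) powr H"
      using assms by (auto intro!: powr_mono2)
    ultimately show ?thesis by (intro mult_nonneg_nonneg) auto
  qed
  also have "\<dots> = (c powr H - a powr H)\<^sup>2 - ((b + c) powr H - (b + a) powr H)\<^sup>2"
    by (simp add: power2_eq_square algebra_simps)
  finally have sq: "0 \<le> (c powr H - a powr H)\<^sup>2 - ((b + c) powr H - (b + a) powr H)\<^sup>2" .
  have "(a + b + c) powr (2*H) + b powr (2*H) - (a + b) powr (2*H) - (b + c) powr (2*H)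
     \<le> (a + 0 + c) powr (2*H) + 0 powr (2*H) - (a + 0) powr (2*H) - (0 + c) powr (2*H)"
    using assms by (intro second_difference_antimono) auto
  moreover have "(x powr H - y powr H)\<^sup>2 = x powr (2*H) + y powr (2*H) - 2 * x powr H * y powr H"
    if "0 \<le> x" "0 \<le> y" for x y using that by (simp add: powr_double power2_diff)
  then have "(c powr H - a powr H)\<^sup>2 = c powr (2*H) + a powr (2*H) - 2 * c powr H * a powr H"
    "((b + c) powr H - (b + a) powr H)\<^sup>2 =
        (b + c) powr (2*H) + (b + a) powr (2*H) - 2 * (b + c) powr H * (b + a) powr H"
    using assms by auto
  ultimately show ?thesis using sq
    unfolding crossing_gap_def by (simp add: ac_simps)
qed

text \<open>On the two boundary faces the gap is a difference of squares. At \<open>b = 0\<close> it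
  is the square of \<open>a powr H + c powr H\<close> minus that of \<open>(a + c) powr H\<close>;
  at \<open>a = 0\<close> it is the square of \<open>c powr H\<close> minus that of
  \<open>(b + c) powr H - b powr H\<close>. Each factorization contains one subadditivity gap, and
  monotonicity in \<open>b\<close> and \<open>a\<close> carries the two estimates into the
  interior.\<close>

lemma crossing_gap_lower:
  fixes a b c H :: real
  assumes "0 \<le> a" "a \<le> c" "0 \<le> b" "1 / 2 < H" "H < 1"
  shows "(2 - 2 powr H) * (max a (min b c) * c) powr H \<le> crossing_gap H a b c"
proof -
  have 1: "(2 - 2 powr H) * (a * c) powr H \<le> crossing_gap H a b c"
  proof -
    have "(2 - 2 powr H) * (a * c) powr H = ((2 - 2 powr H) * a powr H) * c powr H"
      using assms by (simp add: powr_mult)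
    also have "\<dots> \<le> (a powr H + c powr H - (a + c) powr H) * (a powr H + c powr H + (a + c) powr H)"
      using powr_subadditive_gap[of a c H] two_powr_less_2[of H] powr_subadditive[of a c H] assms
      by (intro mult_mono) auto
    also have "\<dots> = crossing_gap H a 0 c"
      using assms powr_double[of a H] powr_double[of c H] powr_double[of "a + c" H]
      by (simp add: crossing_gap_def power2_eq_square algebra_simps)
    also have "\<dots> \<le> crossing_gap H a b c" using assms by (intro crossing_gap_mono_b)
    finally show ?thesis .
  qed
  have 2: "(2 - 2 powr H) * (min b c * c) powr H \<le> crossing_gap H a b c"
  proof (cases "b = 0")
    case True
    have "0 \<le> (2 - 2 powr H) * (a * c) powr H" using two_powr_less_2[of H] assms by simp
    with 1 True assms show ?thesis by (simp add: min_def)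
  next
    case False
    have "(2 - 2 powr H) * (min b c * c) powr H = ((2 - 2 powr H) * min b c powr H) * c powr H"
      using assms by (simp add: powr_mult)
    also have "\<dots> \<le> (b powr H + c powr H - (b + c) powr H) * (c powr H + ((b + c) powr H - b powr H))"
      using powr_subadditive_gap_min[of b c H] two_powr_less_2[of H] assms
        powr_mono2[of H b "b + c"] powr_subadditive[of b c H]
      by (intro mult_mono) auto
    also have "\<dots> = crossing_gap H 0 b c"
      using assms powr_double[of b H] powr_double[of c H] powr_double[of "b + c" H]
      by (simp add: crossing_gap_def power2_eq_square algebra_simps)
    also have "\<dots> \<le> crossing_gap H a b c" using assms False by (intro crossing_gap_mono_a) auto
    finally show ?thesis .
  qed
  show ?thesis using 1 2 by (cases "a \<le> min b c") (auto simp: max_def)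
qed

text \<open>The function \<open>x -> (x + b) powr h - x powr h\<close> is concave for
  \<open>1 < h < 2\<close>, so moving \<open>a\<close> and \<open>c\<close> towards their mean
  increases the sum of its values. For \<open>h = 2*H\<close> the left-hand side is twice the
  covariance over an interval of length \<open>b\<close> and one that exceeds it by \<open>a\<close>
  and \<open>c\<close>.\<close>

lemma nested_covariance_le:
  fixes a b c h :: real
  assumes "0 \<le> a" "0 \<le> c" "0 \<le> b" "1 < h" "h < 2"
  shows "(a + b) powr h - a powr h + (b + c) powr h - c powr h
     \<le> 2 * (((a + c) / 2 + b) powr h - ((a + c) / 2) powr h)"
proof -
  have *: "(a + b) powr h - a powr h + (b + c) powr h - c powr h
     \<le> 2 * (((a + c) / 2 + b) powr h - ((a + c) / 2) powr h)" if "0 \<le> a" "a \<le> c" for a c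
  proof -
    define g where "g t = (a + t + b) powr h - (a + t) powr h + (c - t + b) powr h - (c - t) powr h" for t
    have "0 \<le> (c - a) / 2" using that by simp
    then have "g 0 \<le> g ((c - a) / 2)"
    proof (rule DERIV_nonneg_imp_increasing_open)
      fix t assume t: "0 < t" "t < (c - a) / 2"
      let ?d = "h * (a + t + b) powr (h-1) - h * (a + t) powr (h-1)
        - h * (c - t + b) powr (h-1) + h * (c - t) powr (h-1)"
      have "(g has_real_derivative ?d) (at t)"
        unfolding g_def using assms t that by (auto intro!: derivative_eq_intros)
      moreover have "(c - t + b) powr (h-1) - (c - t) powr (h-1)
          \<le> (a + t + b) powr (h-1) - (a + t) powr (h-1)"
        using t that assms by (intro powr_diff_concave) auto
      then have "h * ((c - t + b) powr (h-1) - (c - t) powr (h-1))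
          \<le> h * ((a + t + b) powr (h-1) - (a + t) powr (h-1))"
        using assms by (intro mult_left_mono) auto
      then have "0 \<le> ?d" by (simp add: algebra_simps)
      ultimately show "\<exists>y. (g has_real_derivative y) (at t) \<and> 0 \<le> y" by blast
    next
      show "continuous_on {0..(c - a) / 2} g"
        unfolding g_def using assms that by (auto intro!: continuous_intros continuous_on_powr')
    qed
    moreover have "a + (c - a) / 2 = (a + c) / 2" "c - (c - a) / 2 = (a + c) / 2"
      by (simp_all add: field_simps)
    ultimately show ?thesis by (simp add: g_def add.commute)
  qed
  show ?thesis
  proof (cases "a \<le> c")
    case True then show ?thesis using * assms by simp
  next
    case False then show ?thesis using *[of c a] assms by (simp add: add.commute algebra_simps)
  qed
qed

text \<open>For \<open>a = c = n\<close> the covariance is \<open>P powr H - Q powr H\<close> with \<open>P = (n + b)\<^sup>2\<close> and \<open>Q = n\<^sup>2\<close>, while the product of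
  the standard deviations is \<open>(P - Q) powr H\<close>; concavity of the increments reduces the general case to this one.\<close>

lemma nested_gap_lower:
  fixes a b c H :: real
  assumes "0 \<le> a" "0 \<le> c" "0 \<le> b" "1 / 2 < H" "H < 1"
  shows "2 * ((2 - 2 powr H) * min (b * (a + b + c)) (((a + c) / 2)\<^sup>2) powr H) \<le>
     2 * (b * (a + b + c)) powr H
       - ((a + b) powr (2*H) - a powr (2*H) + (b + c) powr (2*H) - c powr (2*H))"
proof -
  define n where "n = (a + c) / 2"
  \<comment> \<open>The product of the two lengths is \<open>P - Q\<close> in the notation above, so
    the subadditivity gap applies to \<open>P - Q\<close> and \<open>Q\<close>.\<close>
  have eq: "b * (a + b + c) + n\<^sup>2 = (n + b)\<^sup>2"
    by (simp add: n_def power2_eq_square field_simps)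
  have "(2 - 2 powr H) * min (b * (a + b + c)) (n\<^sup>2) powr H \<le>
      (b * (a + b + c)) powr H + (n\<^sup>2) powr H - ((n + b)\<^sup>2) powr H"
    unfolding eq[symmetric] using assms by (intro powr_subadditive_gap_min) auto
  also have "((n + b)\<^sup>2) powr H = (n + b) powr (2*H)"
    using assms by (simp add: powr_powr[symmetric] n_def)
  also have "(n\<^sup>2) powr H = n powr (2*H)"
    using assms by (simp add: powr_powr[symmetric] n_def)
  finally have "2 * ((2 - 2 powr H) * min (b * (a + b + c)) (n\<^sup>2) powr H) \<le>
      2 * ((b * (a + b + c)) powr H + n powr (2*H) - (n + b) powr (2*H))" by simp
  also have "\<dots> = 2 * (b * (a + b + c)) powr H - 2 * ((n + b) powr (2*H) - n powr (2*H))"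
    by simp
  also have "\<dots> \<le> 2 * (b * (a + b + c)) powr H
       - ((a + b) powr (2*H) - a powr (2*H) + (b + c) powr (2*H) - c powr (2*H))"
    using nested_covariance_le[of a c b "2*H"] assms by (intro diff_left_mono) (auto simp: n_def)
  finally show ?thesis by (simp only: n_def)
qed

text \<open>The covariance of the increments over \<open>[s1, t1]\<close> and \<open>[s2, t2]\<close>.\<close>

definition incr_cov :: "real \<Rightarrow> real \<Rightarrow> real \<Rightarrow> real \<Rightarrow> real \<Rightarrow> real" where
  "incr_cov H s1 t1 s2 t2 = (\<bar>t1 - s2\<bar> powr (2*H) + \<bar>s1 - t2\<bar> powr (2*H)
     - \<bar>t1 - t2\<bar> powr (2*H) - \<bar>s1 - s2\<bar> powr (2*H)) / 2"

lemma incr_cov_commute: "incr_cov H s1 t1 s2 t2 = incr_cov H s2 t2 s1 t1"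
  by (simp add: incr_cov_def abs_minus_commute)

section \<open>Covariance and determinant bounds by relative position of the intervals\<close>

lemma det_lower_of_gap:
  fixes w \<mu> z :: real
  assumes "0 \<le> \<mu>" "0 \<le> w" "0 \<le> z" "z \<le> 2 * (w - \<mu>)"
  shows "w * z / 2 \<le> w\<^sup>2 - \<mu>\<^sup>2"
proof -
  \<comment> \<open>With \<open>w\<close> the product of the standard deviations, the determinant
    factors, and \<open>w + \<mu>\<close> is at least \<open>w\<close>; only the gap
    \<open>w - \<mu>\<close> remains to be estimated.\<close>
  have "w * (z / 2) \<le> (w + \<mu>) * (w - \<mu>)"
    using assms by (intro mult_mono) auto
  then show ?thesis by (simp add: power2_eq_square algebra_simps)
qed

lemma half_powr_ge: "(1/2::real) \<le> (1/2) powr H" "(1/4::real) \<le> (1/4) powr H" if "H \<le> 1" "0 \<le> H"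
  using powr_mono'[of H 1 "1/2::real"] powr_mono'[of H 1 "1/4::real"] that by auto

text \<open>As \<open>a <= c\<close>, the shorter interval has length \<open>a + b\<close> and the
  larger distance between corresponding endpoints is \<open>c\<close>. The denominator 4 is the 2 of
  \<open>det_lower_of_gap\<close> times a further 2: comparing \<open>(a + b) * c\<close> with the
  available product costs a factor inside the power, and \<open>(1/2) powr H\<close> is at least
  \<open>1/2\<close>.\<close>

lemma crossing_bounds:
  fixes a b c H :: real
  assumes "0 \<le> a" "0 \<le> b" "a \<le> c" "1 / 2 < H" "H < 1"
  defines "\<mu> \<equiv> ((a + b + c) powr (2*H) + b powr (2*H) - a powr (2*H) - c powr (2*H)) / 2"
  shows "0 \<le> \<mu>" "\<mu> \<le> 2 * (a + b) * ((a + b) powr (2*H-1) + c powr (2*H-1))"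
    "(2 - 2 powr H) / 4 * ((a + b) powr (2*H) * c powr (2*H)) \<le> (a + b) powr (2*H) * (b + c) powr (2*H) - \<mu>\<^sup>2"
proof -
  have "a powr (2*H) + c powr (2*H) \<le> (a + c) powr (2*H)"
    using assms by (intro powr_superadditive) auto
  also have "\<dots> \<le> (a + b + c) powr (2*H)"
    using assms by (intro powr_mono2) auto
  finally have "a powr (2*H) + c powr (2*H) \<le> (a + b + c) powr (2*H) + b powr (2*H)"
    by (rule add_increasing2[rotated]) simp
  then show nonneg: "0 \<le> \<mu>" by (simp add: \<mu>_def)
  have 1: "(a + b + c) powr (2*H) - c powr (2*H) \<le> 2*H * (a + b) * (a + b + c) powr (2*H-1)"
    using powr_diff_le(2)[of c "a + b + c" "2*H"] assms by simp
  have 2: "b powr (2*H) - a powr (2*H) \<le> 2*H * (a + b) * (a + b + c) powr (2*H-1)"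
  proof (cases "a \<le> b")
    case True
    then have "b powr (2*H) - a powr (2*H) \<le> 2*H * (b - a) * b powr (2*H-1)"
      using assms by (intro powr_diff_le(2)) auto
    also have "\<dots> \<le> 2*H * (a + b) * (a + b + c) powr (2*H-1)"
      using assms True by (intro mult_mono powr_mono2) auto
    finally show ?thesis .
  next
    case False
    then have "b \<le> a" by simp
    then have "b powr (2*H) \<le> a powr (2*H)" using assms(1,2,4,5) by (intro powr_mono2) auto
    moreover have "0 \<le> 2*H * (a + b) * (a + b + c) powr (2*H-1)" using assms by simp
    ultimately show ?thesis by linarith
  qed
  have "\<mu> \<le> 2*H * (a + b) * (a + b + c) powr (2*H-1)"
    using 1 2 by (simp add: \<mu>_def)
  also have "\<dots> \<le> 2 * (a + b) * ((a + b) powr (2*H-1) + c powr (2*H-1))"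
    using powr_subadditive[of "a + b" c "2*H-1"] assms by (intro mult_mono) auto
  finally show "\<mu> \<le> 2 * (a + b) * ((a + b) powr (2*H-1) + c powr (2*H-1))" .
  define \<kappa> where "\<kappa> = (2::real) - 2 powr H"
  have \<kappa>: "0 \<le> \<kappa>" using two_powr_less_2[of H] assms by (simp add: \<kappa>_def)
  define w where "w = ((a + b) * (b + c)) powr H"
  have w2: "w\<^sup>2 = (a + b) powr (2*H) * (b + c) powr (2*H)"
    using assms by (simp add: w_def powr_mult power_mult_distrib powr_double)
  have "\<kappa> * (max a (min b c) * c) powr H \<le> crossing_gap H a b c"
    unfolding \<kappa>_def using assms by (intro crossing_gap_lower)
  also have "\<dots> = 2 * (w - \<mu>)"
  proof -
    have "2 * \<mu> = (a + b + c) powr (2*H) + b powr (2*H) - a powr (2*H) - c powr (2*H)"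
      by (simp add: \<mu>_def)
    moreover have "w = (a + b) powr H * (b + c) powr H" using assms(1-3) by (simp add: w_def powr_mult)
    ultimately show ?thesis by (simp add: crossing_gap_def right_diff_distrib)
  qed
  finally have gap: "w * (\<kappa> * (max a (min b c) * c) powr H) / 2 \<le> w\<^sup>2 - \<mu>\<^sup>2"
    using nonneg \<kappa> assms by (intro det_lower_of_gap) (auto simp: w_def)
  have "\<kappa> / 4 * ((a + b) powr (2*H) * c powr (2*H)) = \<kappa> / 2 * (1/2 * (((a + b) * c)\<^sup>2) powr H)"
    using assms by (simp add: powr_powr[symmetric] powr_mult power_mult_distrib)
  also have "\<dots> \<le> \<kappa> / 2 * ((1/2) powr H * (((a + b) * c)\<^sup>2) powr H)"
    using half_powr_ge[of H] \<kappa> assms by (intro mult_left_mono mult_right_mono) auto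
  also have "\<dots> = \<kappa> / 2 * ((1/2) * ((a + b) * c)\<^sup>2) powr H"
    by (simp only: powr_mult)
  also have "\<dots> \<le> \<kappa> / 2 * (((a + b) * (b + c)) * (max a (min b c) * c)) powr H"
  proof (intro mult_left_mono powr_mono2)
    \<comment> \<open>The maximum is \<open>max a b\<close>, at least half of \<open>a + b\<close>,
      when \<open>b <= c\<close>, and it is \<open>c\<close> when \<open>c < b\<close>.\<close>
    have "(a + b) * c \<le> 2 * ((b + c) * max a (min b c))"
    proof (cases "b \<le> c")
      case True
      have "(a + b) * c \<le> (2 * max a b) * (b + c)" using assms True by (intro mult_mono) auto
      then show ?thesis using True by (simp add: mult_ac min_def)
    next
      case False
      have "(a + b) * c \<le> (b + c) * c" using assms by (intro mult_right_mono) auto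
      also have "\<dots> \<le> 2 * ((b + c) * c)" using assms by simp
      also have "\<dots> \<le> 2 * ((b + c) * max a (min b c))" using False assms by (intro mult_left_mono) auto
      finally show ?thesis .
    qed
    then have "((a + b) * c) * ((a + b) * c) \<le> ((a + b) * c) * (2 * ((b + c) * max a (min b c)))"
      using assms by (intro mult_left_mono) auto
    then show "1/2 * ((a + b) * c)\<^sup>2 \<le> ((a + b) * (b + c)) * (max a (min b c) * c)"
      by (simp add: power2_eq_square mult_ac)
  qed (use \<kappa> assms in auto)
  also have "\<dots> = w * (\<kappa> * (max a (min b c) * c) powr H) / 2"
    using assms by (simp add: w_def powr_mult)
  finally show "(2 - 2 powr H) / 4 * ((a + b) powr (2*H) * c powr (2*H)) \<le>
      (a + b) powr (2*H) * (b + c) powr (2*H) - \<mu>\<^sup>2"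
    using gap unfolding w2 \<kappa>_def by (rule order_trans)
qed

text \<open>The inner interval has length \<open>b\<close>, and the larger endpoint distance is
  \<open>max a c\<close>. The covariance is half the sum of two increments of the power
  \<open>2*H\<close> with step \<open>b\<close>, hence its upper bound. The 4 in the determinant
  bound comes from squaring \<open>(a + c) / 2 >= max a c / 2\<close>.\<close>

lemma nested_bounds:
  fixes a b c H :: real
  assumes "0 \<le> a" "0 \<le> b" "0 \<le> c" "1 / 2 < H" "H < 1"
  defines "\<mu> \<equiv> ((a + b) powr (2*H) - a powr (2*H) + (b + c) powr (2*H) - c powr (2*H)) / 2"
  shows "0 \<le> \<mu>" "\<mu> \<le> 2 * b * (b powr (2*H-1) + max a c powr (2*H-1))"
    "(2 - 2 powr H) / 4 * (b powr (2*H) * max a c powr (2*H)) \<le> (a + b + c) powr (2*H) * b powr (2*H) - \<mu>\<^sup>2"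
proof -
  have "a powr (2*H) \<le> (a + b) powr (2*H)" "c powr (2*H) \<le> (b + c) powr (2*H)"
    using assms by (auto intro!: powr_mono2)
  then show nonneg: "0 \<le> \<mu>" by (simp add: \<mu>_def)
  have *: "(b + x) powr (2*H) - x powr (2*H) \<le> 2 * b * (b powr (2*H-1) + max a c powr (2*H-1))"
    if "0 \<le> x" "x \<le> max a c" for x
  proof -
    have "(b + x) powr (2*H) - x powr (2*H) \<le> 2*H * (b + x - x) * (b + x) powr (2*H-1)"
      using assms that by (intro powr_diff_le) auto
    also have "\<dots> \<le> 2 * b * (b powr (2*H-1) + x powr (2*H-1))"
      using powr_subadditive[of b x "2*H-1"] assms that by (intro mult_mono) auto
    also have "\<dots> \<le> 2 * b * (b powr (2*H-1) + max a c powr (2*H-1))"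
      using assms that by (intro mult_left_mono add_left_mono powr_mono2) auto
    finally show ?thesis .
  qed
  show "\<mu> \<le> 2 * b * (b powr (2*H-1) + max a c powr (2*H-1))"
    using *[of a] *[of c] assms by (simp add: \<mu>_def add.commute)
  define \<kappa> where "\<kappa> = (2::real) - 2 powr H"
  have \<kappa>: "0 \<le> \<kappa>" using two_powr_less_2[of H] assms by (simp add: \<kappa>_def)
  define w where "w = (b * (a + b + c)) powr H"
  have w2: "w\<^sup>2 = (a + b + c) powr (2*H) * b powr (2*H)"
    using assms by (simp add: w_def powr_mult power_mult_distrib powr_double)
  let ?m = "min (b * (a + b + c)) (((a + c) / 2)\<^sup>2)"
  have "2 * (\<kappa> * ?m powr H) \<le> 2 * (w - \<mu>)"
  proof -
    have "2 * (w - \<mu>) = 2 * w - 2 * \<mu>" by simp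
    also have "2 * \<mu> = (a + b) powr (2*H) - a powr (2*H) + (b + c) powr (2*H) - c powr (2*H)"
      by (simp add: \<mu>_def)
    finally show ?thesis
      using nested_gap_lower[of a c b H] assms(1-5) by (simp only: w_def \<kappa>_def)
  qed
  then have gap: "w * (2 * (\<kappa> * ?m powr H)) / 2 \<le> w\<^sup>2 - \<mu>\<^sup>2"
    using nonneg \<kappa> assms by (intro det_lower_of_gap) (auto simp: w_def)
  have "\<kappa> / 4 * (b powr (2*H) * max a c powr (2*H)) = \<kappa> * (1/4 * ((b * max a c)\<^sup>2) powr H)"
    using assms by (simp add: powr_powr[symmetric] powr_mult power_mult_distrib)
  also have "\<dots> \<le> \<kappa> * ((1/4) powr H * ((b * max a c)\<^sup>2) powr H)"
    using half_powr_ge[of H] \<kappa> assms by (intro mult_left_mono mult_right_mono) auto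
  also have "\<dots> = \<kappa> * (1/4 * (b * max a c)\<^sup>2) powr H"
    by (simp only: powr_mult)
  also have "\<dots> \<le> \<kappa> * ((b * (a + b + c)) * ?m) powr H"
  proof (intro mult_left_mono powr_mono2)
    have "(b * max a c)\<^sup>2 \<le> (b * (a + b + c))\<^sup>2"
      using assms by (intro power_mono mult_left_mono) auto
    moreover have "0 \<le> (b * max a c)\<^sup>2" by simp
    ultimately have 1: "1/4 * (b * max a c)\<^sup>2 \<le> (b * (a + b + c)) * (b * (a + b + c))"
      unfolding power2_eq_square by linarith
    have "b * b * (max a c)\<^sup>2 \<le> b * (a + b + c) * (a + c)\<^sup>2"
      using assms by (intro mult_mono power_mono) auto
    then have 2: "1/4 * (b * max a c)\<^sup>2 \<le> (b * (a + b + c)) * ((a + c) / 2)\<^sup>2"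
      by (simp add: power2_eq_square mult_ac)
    show "1/4 * (b * max a c)\<^sup>2 \<le> (b * (a + b + c)) * ?m"
      using 1 2 by (simp only: min_def split: if_split) blast
  qed (use \<kappa> assms in auto)
  also have "\<dots> = w * (2 * (\<kappa> * ?m powr H)) / 2"
    using assms by (simp add: w_def powr_mult)
  finally show "(2 - 2 powr H) / 4 * (b powr (2*H) * max a c powr (2*H)) \<le>
      (a + b + c) powr (2*H) * b powr (2*H) - \<mu>\<^sup>2"
    using gap unfolding w2 \<kappa>_def by (rule order_trans)
qed

text \<open>Both ways of degenerating are visible: the determinant is small only if one interval is
  short (\<open>m\<close> small) or the two nearly coincide (\<open>\<rho>\<close> small). Symmetry
  in the two intervals reduces the claim to \<open>s1 <= s2\<close>, where the position is crossing
  or nested.\<close>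

lemma overlap_bounds:
  fixes s1 t1 s2 t2 H :: real
  assumes "s1 \<le> t1" "s2 \<le> t2" "s2 \<le> t1" "s1 \<le> t2" "1 / 2 < H" "H < 1"
  defines "\<mu> \<equiv> incr_cov H s1 t1 s2 t2"
    and "m \<equiv> min (t1 - s1) (t2 - s2)" and "\<rho> \<equiv> max \<bar>s1 - s2\<bar> \<bar>t1 - t2\<bar>"
  shows "0 \<le> \<mu> \<and> \<mu> \<le> 2 * m * (m powr (2*H-1) + \<rho> powr (2*H-1)) \<and>
    (2 - 2 powr H) / 4 * (m powr (2*H) * \<rho> powr (2*H))
      \<le> (t1 - s1) powr (2*H) * (t2 - s2) powr (2*H) - \<mu>\<^sup>2"
proof -
  define P where "P s1 t1 s2 t2 \<longleftrightarrow> (let \<mu> = incr_cov H s1 t1 s2 t2; m = min (t1 - s1) (t2 - s2);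
      \<rho> = max \<bar>s1 - s2\<bar> \<bar>t1 - t2\<bar> in
    0 \<le> \<mu> \<and> \<mu> \<le> 2 * m * (m powr (2*H-1) + \<rho> powr (2*H-1)) \<and>
    (2 - 2 powr H) / 4 * (m powr (2*H) * \<rho> powr (2*H))
      \<le> (t1 - s1) powr (2*H) * (t2 - s2) powr (2*H) - \<mu>\<^sup>2)" for s1 t1 s2 t2
  have comm: "P s1 t1 s2 t2 = P s2 t2 s1 t1" for s1 t1 s2 t2
    unfolding P_def Let_def incr_cov_commute[of H s1 t1 s2 t2]
    by (simp add: abs_minus_commute mult.commute min.commute)
  have *: "P s1 t1 s2 t2" if "s1 \<le> s2" "s1 \<le> t1" "s2 \<le> t2" "s2 \<le> t1" for s1 t1 s2 t2
  proof (cases "t1 \<le> t2")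
    case True
    let ?a = "s2 - s1" and ?b = "t1 - s2" and ?c = "t2 - t1"
    have mu: "incr_cov H s1 t1 s2 t2 = ((?a + ?b + ?c) powr (2*H) + ?b powr (2*H) - ?a powr (2*H) - ?c powr (2*H)) / 2"
      using that True by (simp add: incr_cov_def abs_minus_commute)
    show ?thesis
    proof (cases "?a \<le> ?c")
      case True
      then have eqs: "min (t1 - s1) (t2 - s2) = ?a + ?b" "max \<bar>s1 - s2\<bar> \<bar>t1 - t2\<bar> = ?c"
        using that \<open>t1 \<le> t2\<close> by auto
      show ?thesis
        using crossing_bounds[of ?a ?b ?c H] that \<open>t1 \<le> t2\<close> True assms(5,6)
        unfolding P_def Let_def eqs mu by simp
    next
      case False
      then have eqs: "min (t1 - s1) (t2 - s2) = ?c + ?b" "max \<bar>s1 - s2\<bar> \<bar>t1 - t2\<bar> = ?a"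
        using that \<open>t1 \<le> t2\<close> by auto
      \<comment> \<open>Time reversal exchanges \<open>a\<close> and \<open>c\<close>, so the larger
        of the two overhangs can always play the role of \<open>c\<close>.\<close>
      have mu': "incr_cov H s1 t1 s2 t2 = ((?c + ?b + ?a) powr (2*H) + ?b powr (2*H) - ?c powr (2*H) - ?a powr (2*H)) / 2"
        unfolding mu by (simp add: algebra_simps)
      show ?thesis
        using crossing_bounds[of ?c ?b ?a H] that \<open>t1 \<le> t2\<close> False assms(5,6)
        unfolding P_def Let_def eqs mu' by (simp add: mult.commute)
    qed
  next
    case False
    let ?a = "s2 - s1" and ?b = "t2 - s2" and ?c = "t1 - t2"
    have mu: "incr_cov H s1 t1 s2 t2 = ((?a + ?b) powr (2*H) - ?a powr (2*H) + (?b + ?c) powr (2*H) - ?c powr (2*H)) / 2"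
      using that False by (simp add: incr_cov_def abs_minus_commute)
    have eqs: "min (t1 - s1) (t2 - s2) = ?b" "max \<bar>s1 - s2\<bar> \<bar>t1 - t2\<bar> = max ?a ?c"
      using that False by auto
    show ?thesis
      using nested_bounds[of ?a ?b ?c H] that False assms(5,6)
      unfolding P_def Let_def eqs mu by simp
  qed
  have "P s1 t1 s2 t2"
    using *[of s1 s2 t1 t2] *[of s2 s1 t2 t1] assms comm by (cases "s1 \<le> s2") auto
  then show ?thesis by (simp add: P_def Let_def \<mu>_def m_def \<rho>_def)
qed

text \<open>The covariance is half a mixed second difference of the power \<open>2*H\<close>; two
  mean value steps, in the lengths \<open>a\<close> and \<open>c\<close>, give
  \<open>2*H * (2*H-1)\<close> times the power \<open>2*H-2\<close>, which decreases and is
  therefore bounded by its value at the gap. For the determinant the covariance is compared with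
  that of touching intervals, which are crossing intervals with overlap 0.\<close>

lemma disjoint_bounds:
  fixes s1 t1 s2 t2 H :: real
  assumes "s1 \<le> t1" "t1 < s2" "s2 \<le> t2" "1 / 2 < H" "H < 1"
  defines "\<mu> \<equiv> incr_cov H s1 t1 s2 t2"
  shows "0 \<le> \<mu>" "\<mu> \<le> H * (2*H - 1) * (t1 - s1) * (t2 - s2) * (s2 - t1) powr (2*H-2)"
    "(2 - 2 powr H) / 2 * ((t1 - s1) powr (2*H) * (t2 - s2) powr (2*H))
      \<le> (t1 - s1) powr (2*H) * (t2 - s2) powr (2*H) - \<mu>\<^sup>2"
proof -
  define a b c where "a = t1 - s1" and "b = s2 - t1" and "c = t2 - s2"
  have pos: "0 \<le> a" "0 < b" "0 \<le> c" using assms by (auto simp: a_def b_def c_def)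
  have mu: "\<mu> = ((a + b + c) powr (2*H) + b powr (2*H) - (a + b) powr (2*H) - (b + c) powr (2*H)) / 2"
    using assms by (simp add: \<mu>_def incr_cov_def abs_minus_commute a_def b_def c_def)
  define g where "g z = (z + c) powr (2*H) - z powr (2*H)" for z
  have mug: "2 * \<mu> = g (a + b) - g b" by (simp add: g_def mu)
  have der: "(g has_real_derivative (2*H) * ((z + c) powr (2*H-1) - z powr (2*H-1))) (at z)"
    if "0 < z" for z unfolding g_def using that pos
    by (auto intro!: derivative_eq_intros simp: algebra_simps)
  have "\<exists>z. 0 < z \<and> b \<le> z \<and> g (a + b) - g b = a * ((2*H) * ((z + c) powr (2*H-1) - z powr (2*H-1)))"
  proof (cases "a = 0")
    case False
    then have "b < a + b" using pos by simp
    then have "\<exists>z>b. z < a + b \<and> g (a + b) - g b = (a + b - b) * ((2*H) * ((z + c) powr (2*H-1) - z powr (2*H-1)))"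
      by (rule MVT2) (use der pos in auto)
    then show ?thesis using pos by (metis add_diff_cancel_right' less_imp_le less_trans)
  qed (use pos in auto)
  then obtain z where z: "0 < z" "b \<le> z"
    "g (a + b) - g b = a * ((2*H) * ((z + c) powr (2*H-1) - z powr (2*H-1)))" by blast
  have "z powr (2*H-1) \<le> (z + c) powr (2*H-1)" using z pos assms by (intro powr_mono2) auto
  then have "0 \<le> 2 * \<mu>" unfolding mug z(3) using pos assms by simp
  then show nonneg: "0 \<le> \<mu>" by simp
  have "(z + c) powr (2*H-1) - z powr (2*H-1) \<le> (b + c) powr (2*H-1) - b powr (2*H-1)"
    using powr_diff_concave[of b z c "2*H-1"] z pos assms by simp
  also have "\<dots> \<le> c * ((2*H-1) * b powr (2*H-2))"
  proof (cases "c = 0")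
    case False
    then have "b < b + c" using pos by simp
    then have "\<exists>y>b. y < b + c \<and> (b + c) powr (2*H-1) - b powr (2*H-1) = (b + c - b) * ((2*H-1) * y powr (2*H-1-1))"
      by (rule MVT2) (use pos in \<open>auto intro!: derivative_eq_intros simp: diff_diff_eq\<close>)
    then obtain y where y: "b < y" "(b + c) powr (2*H-1) - b powr (2*H-1) = c * ((2*H-1) * y powr (2*H-2))"
      by (auto simp: diff_diff_eq)
    show ?thesis unfolding y(2) using y pos assms by (intro mult_left_mono powr_mono2') auto
  qed simp
  finally have "2 * \<mu> \<le> a * ((2*H) * (c * ((2*H-1) * b powr (2*H-2))))"
    unfolding mug z(3) using pos assms by (intro mult_left_mono) auto
  then show "\<mu> \<le> H * (2*H - 1) * (t1 - s1) * (t2 - s2) * (s2 - t1) powr (2*H-2)"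
    unfolding a_def[symmetric] b_def[symmetric] c_def[symmetric] by (simp add: mult_ac)
  define \<kappa> where "\<kappa> = (2::real) - 2 powr H"
  have \<kappa>: "0 \<le> \<kappa>" using two_powr_less_2[of H] assms by (simp add: \<kappa>_def)
  define w where "w = (a * c) powr H"
  have w2: "w\<^sup>2 = a powr (2*H) * c powr (2*H)"
    using pos by (simp add: w_def powr_mult power_mult_distrib powr_double)
  have "\<kappa> * w \<le> crossing_gap H (min a c) 0 (max a c)"
  proof -
    have "w = (max (min a c) (min 0 (max a c)) * max a c) powr H"
      using pos by (simp add: w_def max_def min_def mult.commute)
    then show ?thesis using crossing_gap_lower[of "min a c" "max a c" 0 H] pos assms
      by (simp add: \<kappa>_def)
  qed
  also have "\<dots> = a powr (2*H) + c powr (2*H) - (a + c) powr (2*H) + 2 * w"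
    using pos by (auto simp: crossing_gap_def w_def powr_mult max_def min_def add.commute)
  also have "\<dots> \<le> 2 * (w - \<mu>)"
  proof -
    \<comment> \<open>Closing the gap to 0 can only increase the covariance.\<close>
    have "2 * \<mu> \<le> (a + c) powr (2*H) - a powr (2*H) - c powr (2*H)"
      using second_difference_antimono[of a 0 b c "2*H"] pos assms(4,5) by (simp add: mu)
    then show ?thesis by simp
  qed
  finally have "w * (\<kappa> * w) / 2 \<le> w\<^sup>2 - \<mu>\<^sup>2"
    using nonneg \<kappa> by (intro det_lower_of_gap) (auto simp: w_def)
  then have "\<kappa> / 2 * w\<^sup>2 \<le> w\<^sup>2 - \<mu>\<^sup>2" by (simp add: power2_eq_square mult_ac)
  then show "(2 - 2 powr H) / 2 * ((t1 - s1) powr (2*H) * (t2 - s2) powr (2*H))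
      \<le> (t1 - s1) powr (2*H) * (t2 - s2) powr (2*H) - \<mu>\<^sup>2"
    unfolding w2 by (simp add: \<kappa>_def a_def c_def)
qed


section \<open>Integrals of power kernels\<close>

text \<open>Used with \<open>h = 2*H\<close> and three pairs \<open>(p, q)\<close>:
  \<open>(1, 3/2)\<close> for the leading term, \<open>(3*H/2, 1 + 3*H/4)\<close> for the correction
  on disjoint pairs and \<open>(0, 3/4)\<close> for overlapping ones. As an \<open>ennreal\<close>
  it can be rescaled before finiteness is known.\<close>

definition power_kernel_integral :: "real \<Rightarrow> real \<Rightarrow> real \<Rightarrow> real \<Rightarrow> ennreal" where
  "power_kernel_integral h p q \<epsilon> =
     (\<integral>\<^sup>+u. ennreal (u powr p * (\<epsilon> + u powr h) powr (- q)) * indicator {0<..} u \<partial>lborel)"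

lemma power_kernel_integral_scale:
  assumes "0 < \<epsilon>" "0 < h"
  shows "power_kernel_integral h p q \<epsilon> = ennreal (\<epsilon> powr ((p + 1) / h - q)) * power_kernel_integral h p q 1"
proof -
  \<comment> \<open>Chosen with \<open>c powr h = \<epsilon>\<close>, so that under
    \<open>u = c * x\<close> the \<epsilon> factors out of
    \<open>\<epsilon> + u powr h\<close>.\<close>
  define c where "c = \<epsilon> powr (1 / h)"
  have c: "0 < c" "c powr h = \<epsilon>" using assms by (auto simp: c_def powr_powr)
  have "power_kernel_integral h p q \<epsilon> = ennreal \<bar>c\<bar> *
    (\<integral>\<^sup>+x. ennreal ((0 + c * x) powr p * (\<epsilon> + (0 + c * x) powr h) powr (- q)) * indicator {0<..} (0 + c * x) \<partial>lborel)"
    unfolding power_kernel_integral_def using c by (intro nn_integral_real_affine) auto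
  also have "(\<lambda>x. ennreal ((0 + c * x) powr p * (\<epsilon> + (0 + c * x) powr h) powr (- q)) * indicator {0<..} (0 + c * x)) =
     (\<lambda>x. ennreal (c powr p * \<epsilon> powr (-q)) * (ennreal (x powr p * (1 + x powr h) powr (- q)) * indicator {0<..} x))"
  proof
    fix x
    show "ennreal ((0 + c * x) powr p * (\<epsilon> + (0 + c * x) powr h) powr (- q)) * indicator {0<..} (0 + c * x) =
      ennreal (c powr p * \<epsilon> powr (-q)) * (ennreal (x powr p * (1 + x powr h) powr (- q)) * indicator {0<..} x)"
    proof (cases "0 < x")
      case True
      have "\<epsilon> + (c * x) powr h = \<epsilon> * (1 + x powr h)"
        using c True by (simp add: powr_mult algebra_simps)
      then have "(c * x) powr p * (\<epsilon> + (c * x) powr h) powr (- q) =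
          (c powr p * \<epsilon> powr (-q)) * (x powr p * (1 + x powr h) powr (- q))"
        using c True assms by (simp add: powr_mult)
      then show ?thesis using True c by (simp add: ennreal_mult[symmetric])
    qed (use c in \<open>auto simp: zero_less_mult_iff\<close>)
  qed
  also have "(\<integral>\<^sup>+x. ennreal (c powr p * \<epsilon> powr (-q)) *
      (ennreal (x powr p * (1 + x powr h) powr (- q)) * indicator {0<..} x) \<partial>lborel) =
      ennreal (c powr p * \<epsilon> powr (-q)) * power_kernel_integral h p q 1"
    unfolding power_kernel_integral_def by (intro nn_integral_cmult) measurable
  also have "ennreal \<bar>c\<bar> * (ennreal (c powr p * \<epsilon> powr (-q)) * power_kernel_integral h p q 1) =
     ennreal (c * c powr p * \<epsilon> powr (-q)) * power_kernel_integral h p q 1"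
    using c by (simp add: ennreal_mult mult.assoc)
  also have "c * c powr p * \<epsilon> powr (-q) = \<epsilon> powr ((p + 1) / h - q)"
  proof -
    have "c * c powr p = c powr (p + 1)" using c by (simp add: powr_add)
    then show ?thesis using assms
      by (simp add: c_def powr_powr powr_add[symmetric])
  qed
  finally show ?thesis .
qed

lemma nn_integral_powr_Icc:
  assumes "0 \<le> T" "0 \<le> r" "r < 1"
  shows "(\<integral>\<^sup>+u. ennreal (u powr (- r)) * indicator {0..T} u \<partial>lborel) = ennreal (T powr (1 - r) / (1 - r))"
proof -
  have "((\<lambda>x. x powr (-r)) has_integral (T powr (- r + 1) / (- r + 1))) {0..T}"
    using assms by (intro has_integral_powr_from_0) auto
  then show ?thesis
    by (subst nn_integral_has_integral_lebesgue') auto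
qed

lemma power_kernel_integral_finite:
  assumes "0 \<le> p" "1 < h * q - p" "0 \<le> q" "0 < h"
  shows "power_kernel_integral h p q 1 < \<infinity>"
proof -
  have le: "u powr p * (1 + u powr h) powr (- q) \<le> (if u \<le> 1 then 1 else u powr (p - h * q))"
    if "0 < u" for u
  proof (cases "u \<le> 1")
    case True
    have "u powr p \<le> 1 powr p" using that True assms by (intro powr_mono2) auto
    moreover have "(1 + u powr h) powr (- q) \<le> 1 powr (- q)"
      using that assms by (intro powr_mono2') auto
    ultimately show ?thesis using True
      by (auto intro!: mult_le_one)
  next
    case False
    have "(1 + u powr h) powr (- q) \<le> (u powr h) powr (- q)"
      using that assms by (intro powr_mono2') auto
    then have "u powr p * (1 + u powr h) powr (- q) \<le> u powr p * (u powr h) powr (- q)"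
      by (intro mult_left_mono) auto
    also have "\<dots> = u powr (p - h * q)" by (simp add: powr_powr powr_add[symmetric])
    finally show ?thesis using False by simp
  qed
  have "power_kernel_integral h p q 1 \<le> (\<integral>\<^sup>+u. indicator {0..1} u + ennreal (u powr (p - h * q)) * indicator {1..} u \<partial>lborel)"
    unfolding power_kernel_integral_def
  proof (intro nn_integral_mono)
    fix u :: real
    show "ennreal (u powr p * (1 + u powr h) powr (- q)) * indicator {0<..} u
       \<le> indicator {0..1} u + ennreal (u powr (p - h * q)) * indicator {1..} u"
    proof (cases "0 < u \<and> u \<le> 1")
      case True
      then have "ennreal (u powr p * (1 + u powr h) powr (- q)) \<le> 1" using le[of u] by (simp add: ennreal_le_1)
      then show ?thesis using True by (auto simp: indicator_def add_increasing2)
    next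
      case False
      then show ?thesis using le[of u] by (cases "0 < u") (auto simp: indicator_def intro!: ennreal_leI)
    qed
  qed
  also have "\<dots> = (\<integral>\<^sup>+u. indicator {0..1::real} u \<partial>lborel) + (\<integral>\<^sup>+u. ennreal (u powr (p - h * q)) * indicator {1..} u \<partial>lborel)"
    by (intro nn_integral_add) auto
  also have "(\<integral>\<^sup>+u. ennreal (u powr (p - h * q)) * indicator {1..} u \<partial>lborel) =
      ennreal (- (1 powr (p - h * q + 1)) / (p - h * q + 1))"
    using assms by (intro nn_integral_has_integral_lebesgue' has_integral_powr_to_inf) auto
  finally have "power_kernel_integral h p q 1 \<le> 1 + ennreal (- (1 / (p - h * q + 1)))" by simp
  also have "\<dots> < \<infinity>" by (simp add: less_top[symmetric])
  finally show ?thesis .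
qed

text \<open>Substituting \<open>x = (t / (1 - t)) powr (1 / h)\<close> turns the integral into Euler's.\<close>

lemma power_kernel_integral_Beta:
  assumes "4 / 3 < h"
  shows "power_kernel_integral h 1 (3/2) 1 = ennreal (Beta (2 / h) (3 / 2 - 2 / h) / h)"
proof -
  define f where "f x = x * (1 + x powr h) powr (- (3/2))" for x
  define g where "g t = (t / (1 - t)) powr (1 / h)" for t
  define g' where "g' t = 1 / h * (t / (1 - t)) powr (1 / h - 1) * (1 - t) powr (- 2)" for t
  define \<beta> where "\<beta> t = t powr (2 / h - 1) * (1 - t) powr (3 / 2 - 2 / h - 1)" for t
  \<comment> \<open>The second Beta argument is positive exactly for \<open>4/3 < h\<close>; with
    \<open>h = 2*H\<close> this is the threshold \<open>2/3 < H\<close>.\<close>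
  have h: "0 < 3 / 2 - 2 / h" "0 < 2 / h" using assms by (simp_all add: field_simps)
  have eq: "f (g t) * g' t = \<beta> t / h" if "0 < t" "t < 1" for t
  proof -
    have "g t powr h = t / (1 - t)" using that assms by (simp add: g_def powr_powr)
    then have "1 + g t powr h = 1 / (1 - t)" using that by (simp add: field_simps)
    then have 1: "(1 + g t powr h) powr (- (3/2)) = (1 - t) powr (3/2)"
      using that by (simp add: powr_minus_divide powr_divide)
    have "g t * (t / (1 - t)) powr (1 / h - 1) = (t / (1 - t)) powr (2 / h - 1)"
      by (simp add: g_def powr_add[symmetric])
    also have "\<dots> = t powr (2 / h - 1) * (1 - t) powr (1 - 2 / h)"
      using that by (simp add: powr_divide powr_minus_divide[of _ "2/h - 1"] powr_diff)
    finally have "f (g t) * g' t = t powr (2 / h - 1) / h * ((1 - t) powr (1 - 2 / h) * ((1 - t) powr (3/2) * (1 - t) powr (-2)))"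
      unfolding f_def g'_def 1 by (simp add: mult_ac)
    also have "\<dots> = \<beta> t / h"
      by (simp add: \<beta>_def powr_add[symmetric])
    finally show ?thesis .
  qed
  have int: "set_integrable lborel (einterval 0 1) (\<lambda>t. f (g t) * g' t)"
  proof -
    have "set_integrable lborel {0..1} (\<lambda>t. \<beta> t / h)"
      unfolding \<beta>_def using integrable_Beta[of "2 / h" "3 / 2 - 2 / h"] h by (intro set_integrable_divide) auto
    then have "set_integrable lborel {0<..<1} (\<lambda>t. \<beta> t / h)"
      by (rule set_integrable_subset) auto
    then show ?thesis using eq
      by (subst set_integrable_cong[where f' = "\<lambda>t. \<beta> t / h"]) (auto simp: einterval_def zero_ereal_def one_ereal_def greaterThanLessThan_def lessThan_def greaterThan_def Int_def)
  qed
  have g0: "(g \<longlongrightarrow> 0) (at_right 0)"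
    unfolding g_def using assms by real_asymp
  have g1: "filterlim g at_top (at_left 1)"
    unfolding g_def using assms by real_asymp
  have der: "DERIV g t :> g' t" if "0 < t" "t < 1" for t
  proof -
    have "((\<lambda>t. t / (1 - t)) has_real_derivative ((1 - t) + t) / ((1 - t) * (1 - t))) (at t)"
      using that by (auto intro!: derivative_eq_intros)
    from DERIV_powr[OF this _ DERIV_const, of "1 / h"]
    have "DERIV g t :> (t / (1 - t)) powr (1 / h) *
      (0 * ln (t / (1 - t)) + (1 - t + t) / ((1 - t) * (1 - t)) * (1 / h) / (t / (1 - t)))"
      using that by (simp add: g_def[abs_def])
    moreover have "(t / (1 - t)) powr (1 / h) = (t / (1 - t)) powr (1 / h - 1) * (t / (1 - t))"
      using that by (simp only: powr_diff) simp
    moreover have "(1 - t) powr (- 2) = 1 / ((1 - t) * (1 - t))"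
      using that by (simp add: powr_minus_divide power2_eq_square)
    ultimately show ?thesis
      unfolding g'_def using that by (elim DERIV_cong) simp
  qed
  have 1: "set_integrable lborel (einterval 0 \<infinity>) f"
    "(LBINT x=0..\<infinity>. f x) = (LBINT x=0..1. (f (g x) * g' x))"
  proof -
    have c1: "isCont f (g x)" if "0 < ereal x" "ereal x < 1" for x
      using that unfolding f_def g_def by (intro continuous_intros) (auto simp: add_nonneg_eq_0_iff)
    have c2: "isCont g' x" if "0 < ereal x" "ereal x < 1" for x
      using that unfolding g'_def by (intro continuous_intros) (auto simp: one_ereal_def)
    have l0: "((ereal \<circ> g \<circ> real_of_ereal) \<longlongrightarrow> 0) (at_right 0)"
      unfolding zero_ereal_def by (simp add: ereal_tendsto_simps g0)
    have l1: "((ereal \<circ> g \<circ> real_of_ereal) \<longlongrightarrow> \<infinity>) (at_left 1)"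
      unfolding one_ereal_def by (simp add: ereal_tendsto_simps g1)
    have d: "DERIV g x :> g' x" if "0 < ereal x" "ereal x < 1" for x
      using der[of x] that by (simp add: one_ereal_def)
    have p: "0 \<le> f (g x)" "0 \<le> g' x" for x
      using assms by (auto simp: f_def g_def g'_def)
    show "set_integrable lborel (einterval 0 \<infinity>) f"
      by (rule interval_integral_substitution_nonneg(1)[OF _ d c1 c2 p(1) p(2) l0 l1 int]) auto
    show "(LBINT x=0..\<infinity>. f x) = (LBINT x=0..1. (f (g x) * g' x))"
      by (rule interval_integral_substitution_nonneg(2)[OF _ d c1 c2 p(1) p(2) l0 l1 int]) auto
  qed
  have "power_kernel_integral h 1 (3/2) 1 = (\<integral>\<^sup>+x. ennreal (indicator {0<..} x * f x) \<partial>lborel)"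
    unfolding power_kernel_integral_def f_def
    by (intro nn_integral_cong) (auto simp: indicator_def)
  also have "\<dots> = ennreal (LBINT x:{0<..}. f x)"
    using 1(1) unfolding set_lebesgue_integral_def set_integrable_def
    by (subst nn_integral_eq_integral)
       (auto simp: einterval_def zero_ereal_def greaterThan_def f_def indicator_def)
  also have "(LBINT x:{0<..}. f x) = (LBINT x=0..\<infinity>. f x)"
    by (simp add: interval_lebesgue_integral_0_infty)
  also have "\<dots> = (LBINT x=0..1. \<beta> x / h)"
    unfolding 1(2) by (intro interval_integral_cong) (auto simp: eq zero_ereal_def one_ereal_def einterval_def)
  also have "\<dots> = (LBINT x:{0..1}. \<beta> x / h)"
    by (simp add: zero_ereal_def one_ereal_def interval_integral_Icc)
  also have "\<dots> = (LBINT x:{0..1}. \<beta> x) / h" by simp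
  also have "(LBINT x:{0..1}. \<beta> x) = Beta (2 / h) (3 / 2 - 2 / h)"
    using has_integral_Beta_real[OF h(2,1)] integrable_Beta[OF h(2,1)]
    unfolding \<beta>_def by (simp add: set_borel_integral_eq_integral(2) integral_unique)
  finally show ?thesis .
qed

section \<open>Iterated integrals over pairs of intervals\<close>

abbreviation nn_integral4 :: "(real \<Rightarrow> real \<Rightarrow> real \<Rightarrow> real \<Rightarrow> ennreal) \<Rightarrow> ennreal" where
  "nn_integral4 F \<equiv> \<integral>\<^sup>+t1. \<integral>\<^sup>+s1. \<integral>\<^sup>+t2. \<integral>\<^sup>+s2. F t1 s1 t2 s2 \<partial>lborel \<partial>lborel \<partial>lborel \<partial>lborel"

text \<open>For disjoint pairs the factors link the variables in the chain \<open>s1\<close>,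
  \<open>t1\<close>, \<open>s2\<close>, \<open>t2\<close>. The two free ends are integrated first,
  \<open>t2\<close> at fixed \<open>s2\<close> and \<open>s1\<close> at fixed \<open>t1\<close>, and
  only the gap factor remains.\<close>

lemma nn_integral_prod_chain:
  fixes f f' :: "real \<Rightarrow> ennreal" and k :: "real \<Rightarrow> real \<Rightarrow> ennreal"
  assumes [measurable]: "f \<in> borel_measurable borel" "f' \<in> borel_measurable borel"
    "case_prod k \<in> borel_measurable (borel \<Otimes>\<^sub>M borel)"
  shows "(nn_integral4 (\<lambda>t1 s1 t2 s2. f (t1 - s1) * f' (t2 - s2) * k t1 s2)) =
    integral\<^sup>N lborel f * integral\<^sup>N lborel f' * (\<integral>\<^sup>+t1. \<integral>\<^sup>+s2. k t1 s2 \<partial>lborel \<partial>lborel)"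
proof -
  have shift: "(\<integral>\<^sup>+t. g (t - s) \<partial>lborel) = integral\<^sup>N lborel g"
    "(\<integral>\<^sup>+t. g (s - t) \<partial>lborel) = integral\<^sup>N lborel g"
    if [measurable]: "g \<in> borel_measurable borel" for g :: "real \<Rightarrow> ennreal" and s
    using nn_integral_real_affine[of g 1 "-s"] nn_integral_real_affine[of g "-1" s] by auto
  have "(\<integral>\<^sup>+t2. \<integral>\<^sup>+s2. f (t1 - s1) * f' (t2 - s2) * k t1 s2 \<partial>lborel \<partial>lborel) =
      f (t1 - s1) * (integral\<^sup>N lborel f' * (\<integral>\<^sup>+s2. k t1 s2 \<partial>lborel))" for t1 s1
  proof -
    have "(\<integral>\<^sup>+t2. \<integral>\<^sup>+s2. f (t1 - s1) * f' (t2 - s2) * k t1 s2 \<partial>lborel \<partial>lborel) =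
       (\<integral>\<^sup>+s2. \<integral>\<^sup>+t2. f (t1 - s1) * f' (t2 - s2) * k t1 s2 \<partial>lborel \<partial>lborel)"
      by (rule lborel_pair.Fubini') measurable
    also have "\<dots> = (\<integral>\<^sup>+s2. f (t1 - s1) * k t1 s2 * (\<integral>\<^sup>+t2. f' (t2 - s2) \<partial>lborel) \<partial>lborel)"
      by (subst nn_integral_cmult[symmetric]) (auto simp: mult_ac)
    also have "\<dots> = (\<integral>\<^sup>+s2. f (t1 - s1) * integral\<^sup>N lborel f' * k t1 s2 \<partial>lborel)"
      by (simp add: shift mult_ac)
    finally show ?thesis by (subst (asm) nn_integral_cmult) (auto simp: mult_ac)
  qed
  then have "(nn_integral4 (\<lambda>t1 s1 t2 s2. f (t1 - s1) * f' (t2 - s2) * k t1 s2)) =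
      (\<integral>\<^sup>+t1. \<integral>\<^sup>+s1. f (t1 - s1) * (integral\<^sup>N lborel f' * (\<integral>\<^sup>+s2. k t1 s2 \<partial>lborel)) \<partial>lborel \<partial>lborel)"
    by simp
  also have "\<dots> = (\<integral>\<^sup>+t1. integral\<^sup>N lborel f * integral\<^sup>N lborel f' * (\<integral>\<^sup>+s2. k t1 s2 \<partial>lborel) \<partial>lborel)"
    by (subst nn_integral_multc) (auto simp: shift mult_ac)
  also have "\<dots> = integral\<^sup>N lborel f * integral\<^sup>N lborel f' * (\<integral>\<^sup>+t1. \<integral>\<^sup>+s2. k t1 s2 \<partial>lborel \<partial>lborel)"
    by (rule nn_integral_cmult) measurable
  finally show ?thesis .
qed

text \<open>For overlapping pairs the chain is \<open>s2\<close>, \<open>s1\<close>,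
  \<open>t1\<close>, \<open>t2\<close>. Integrating from its ends towards \<open>t1\<close> peels
  off one factor at a time, and the weight \<open>g\<close> localizes the last variable.\<close>

lemma nn_integral_prod_overlap:
  fixes \<psi> \<phi> g :: "real \<Rightarrow> ennreal"
  assumes [measurable]: "\<psi> \<in> borel_measurable borel" "\<phi> \<in> borel_measurable borel" "g \<in> borel_measurable borel"
  shows "(nn_integral4 (\<lambda>t1 s1 t2 s2. g t1 * \<psi> (t1 - s1) * \<phi> (s1 - s2) * \<phi> (t1 - t2))) =
    integral\<^sup>N lborel g * integral\<^sup>N lborel \<psi> * (integral\<^sup>N lborel \<phi>)\<^sup>2"
proof -
  have shift: "(\<integral>\<^sup>+t. g (s - t) \<partial>lborel) = integral\<^sup>N lborel g"
    if [measurable]: "g \<in> borel_measurable borel" for g :: "real \<Rightarrow> ennreal" and s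
    using nn_integral_real_affine[of g "-1" s] by auto
  have "(\<integral>\<^sup>+s2. g t1 * \<psi> (t1 - s1) * \<phi> (s1 - s2) * \<phi> (t1 - t2) \<partial>lborel) =
      g t1 * \<psi> (t1 - s1) * \<phi> (t1 - t2) * integral\<^sup>N lborel \<phi>" for t1 s1 t2
    by (subst nn_integral_multc, measurable, subst nn_integral_cmult, measurable) (simp add: shift mult_ac)
  moreover have "(\<integral>\<^sup>+t2. g t1 * \<psi> (t1 - s1) * \<phi> (t1 - t2) * integral\<^sup>N lborel \<phi> \<partial>lborel) =
      g t1 * \<psi> (t1 - s1) * (integral\<^sup>N lborel \<phi>)\<^sup>2" for t1 s1
    by (subst nn_integral_multc, measurable, subst nn_integral_cmult, measurable)
       (simp add: shift mult_ac power2_eq_square)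
  moreover have "(\<integral>\<^sup>+s1. g t1 * \<psi> (t1 - s1) * (integral\<^sup>N lborel \<phi>)\<^sup>2 \<partial>lborel) =
      g t1 * (integral\<^sup>N lborel \<psi> * (integral\<^sup>N lborel \<phi>)\<^sup>2)" for t1
    by (subst nn_integral_multc, measurable, subst nn_integral_cmult, measurable) (simp add: shift mult_ac)
  ultimately show ?thesis by (simp add: nn_integral_multc mult_ac)
qed

lemma nn_integral_gap_powr:
  assumes "0 \<le> T" "0 \<le> r" "r < 1"
  shows "(\<integral>\<^sup>+t. \<integral>\<^sup>+s. ennreal ((s - t) powr (- r)) * (indicator {0..} t * indicator {0<..} (s - t) * indicator {..T} s) \<partial>lborel \<partial>lborel)
    = ennreal (T powr (2 - r) / ((1 - r) * (2 - r)))"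
proof -
  have *: "(\<integral>\<^sup>+s. ennreal ((s - t) powr (- r)) * (indicator {0..} t * indicator {0<..} (s - t) * indicator {..T} s) \<partial>lborel)
    = ennreal ((T - t) powr (1 - r) / (1 - r)) * indicator {0..T} t" for t
  proof (cases "t \<in> {0..T}")
    case True
    define g :: "real \<Rightarrow> ennreal" where "g s = ennreal ((s - t) powr (- r)) * (indicator {0..} t * indicator {0<..} (s - t) * indicator {..T} s)" for s
    have [measurable]: "g \<in> borel_measurable borel" unfolding g_def by measurable
    have "(\<integral>\<^sup>+s. g s \<partial>lborel) = (\<integral>\<^sup>+u. g (t + u) \<partial>lborel)"
      using nn_integral_real_affine[of g 1 t] by simp
    also have "\<dots> = (\<integral>\<^sup>+u. ennreal (u powr (- r)) * indicator {0..T - t} u \<partial>lborel)"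
      using True by (intro nn_integral_cong) (auto simp: g_def indicator_def)
    also have "\<dots> = ennreal ((T - t) powr (1 - r) / (1 - r))"
      using True assms by (intro nn_integral_powr_Icc) auto
    finally show ?thesis using True by (simp add: g_def)
  next
    case False
    then have z: "indicator {0..} t * indicator {0<..} (s - t) * indicator {..T} s = (0::ennreal)" for s
      by (auto simp: indicator_def)
    show ?thesis using False unfolding z by simp
  qed
  have "((\<lambda>x. x powr (1 - r) / (1 - r)) has_integral (T powr (1 - r + 1) / (1 - r + 1) / (1 - r))) {0..T}"
    using assms by (intro has_integral_divide has_integral_powr_from_0) auto
  from nn_integral_has_integral_lebesgue'[OF _ this]
  have "(\<integral>\<^sup>+x. ennreal (x powr (1 - r) / (1 - r)) * indicator {0..T} x \<partial>lborel) = ennreal (T powr (1 - r + 1) / (1 - r + 1) / (1 - r))"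
    using assms by auto
  also have "(\<integral>\<^sup>+x. ennreal (x powr (1 - r) / (1 - r)) * indicator {0..T} x \<partial>lborel) =
     (\<integral>\<^sup>+t. ennreal ((T - t) powr (1 - r) / (1 - r)) * indicator {0..T} t \<partial>lborel)"
    using nn_integral_real_affine[of "\<lambda>x. ennreal (x powr (1 - r) / (1 - r)) * indicator {0..T} x" "-1" T]
    by (auto intro!: nn_integral_cong simp: indicator_def)
  finally show ?thesis unfolding * by (simp add: algebra_simps)
qed


section \<open>The second moment of the leading kernel\<close>

text \<open>Up to the factor \<open>1 / (2 * pi)\<close>, the covariance of \<open>heat_kernel' \<epsilon> (B t1 - B s1)\<close> and \<open>heat_kernel' \<epsilon> (B t2 - B s2)\<close>.\<close>

definition self_intersection_kernel :: "real \<Rightarrow> real \<Rightarrow> real \<Rightarrow> real \<Rightarrow> real \<Rightarrow> real \<Rightarrow> real" where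
  "self_intersection_kernel H \<epsilon> s1 t1 s2 t2 = incr_cov H s1 t1 s2 t2 *
     ((\<epsilon> + (t1 - s1) powr (2*H)) * (\<epsilon> + (t2 - s2) powr (2*H)) - (incr_cov H s1 t1 s2 t2)\<^sup>2) powr (- (3/2))"

lemma self_intersection_kernel_commute:
  "self_intersection_kernel H \<epsilon> s1 t1 s2 t2 = self_intersection_kernel H \<epsilon> s2 t2 s1 t1"
  unfolding self_intersection_kernel_def incr_cov_commute[of H s1 t1] by (simp add: mult.commute)

text \<open>Comparing \<open>(1 - y) powr (3/2)\<close> with the square of \<open>1 - y\<close>
  gives \<open>1 - (1 - y) powr (3/2) <= 2 * y\<close>, and division by
  \<open>(1 - y) powr (3/2)\<close> costs the power of \<open>\<delta>\<close>. The exponent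
  \<open>\<theta>\<close> is left free because the first power of \<open>y\<close> would be too
  singular for the later integration.\<close>

lemma inverse_powr_three_halves_le:
  fixes y \<delta> \<theta> :: real
  assumes "0 \<le> y" "\<delta> \<le> 1 - y" "0 < \<delta>" "0 \<le> \<theta>" "\<theta> \<le> 1"
  shows "(1 - y) powr (- (3/2)) \<le> 1 + 2 * \<delta> powr (- (3/2)) * y powr \<theta>"
proof -
  have y: "0 < 1 - y" "1 - y \<le> 1" using assms by auto
  have "(1 - y) powr 2 \<le> (1 - y) powr (3/2)" using y by (intro powr_mono') auto
  moreover have "(1 - y) powr 2 = 1 - 2 * y + y\<^sup>2" using y by (simp add: power2_eq_square algebra_simps)
  moreover have "0 \<le> y\<^sup>2" by simp
  ultimately have "1 - (1 - y) powr (3/2) \<le> 2 * y" by linarith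
  also have "y \<le> y powr \<theta>"
    using powr_mono'[of \<theta> 1 y] assms y by (cases "y = 0") auto
  finally have 1: "1 - (1 - y) powr (3/2) \<le> 2 * y powr \<theta>" by simp
  have "(1 - y) powr (3/2) \<le> 1" using powr_mono2[of "3/2" "1 - y" 1] y by simp
  moreover have "(1 - y) powr (- (3/2)) \<le> \<delta> powr (- (3/2))" using assms by (intro powr_mono2') auto
  ultimately have "(1 - (1 - y) powr (3/2)) * (1 - y) powr (- (3/2)) \<le> (2 * y powr \<theta>) * \<delta> powr (- (3/2))"
    using 1 by (intro mult_mono) auto
  moreover have "(1 - y) powr (3/2) * (1 - y) powr (- (3/2)) = 1"
    using y by (simp add: powr_add[symmetric])
  ultimately show ?thesis by (simp add: algebra_simps)
qed

text \<open>With \<open>y\<close> the ratio of the squared covariance to \<open>P\<close>, replacing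
  \<open>(1 - y) powr (-(3/2))\<close> by 1 yields the leading term with the sharp constant
  \<open>H * (2*H - 1)\<close>. The determinant bound keeps \<open>1 - y\<close> uniformly away from
  0, so the remainder is a constant times \<open>y powr \<theta>\<close>.\<close>

lemma kernel_disjoint_le:
  fixes H \<epsilon> s1 t1 s2 t2 :: real
  assumes "s1 \<le> t1" "t1 < s2" "s2 \<le> t2" "2 / 3 < H" "H < 1" "0 < \<epsilon>"
  defines "P \<equiv> (\<epsilon> + (t1 - s1) powr (2*H)) * (\<epsilon> + (t2 - s2) powr (2*H))"
    and "c \<equiv> H * (2*H - 1)"
  shows "self_intersection_kernel H \<epsilon> s1 t1 s2 t2 \<le>
     c * ((t1 - s1) * (t2 - s2) * (s2 - t1) powr (2*H-2)) * P powr (- (3/2)) +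
     2 * ((2 - 2 powr H) / 2) powr (- (3/2)) *
       (((t1 - s1) * (t2 - s2) * (s2 - t1) powr (2*H-2)) powr (3*H/2) * P powr (- (1 + 3*H/4)))"
proof -
  let ?\<mu> = "incr_cov H s1 t1 s2 t2" and ?U = "(t1 - s1) * (t2 - s2) * (s2 - t1) powr (2*H-2)"
  let ?v = "(t1 - s1) powr (2*H) * (t2 - s2) powr (2*H)"
  define \<delta> where "\<delta> = (2 - 2 powr H) / (2::real)"
  define y where "y = ?\<mu>\<^sup>2 / P"
  \<comment> \<open>A positive \<open>\<theta>\<close> gains the power
    \<open>2 * \<theta> * (1-H) / H\<close> of \<epsilon> over the leading term. This choice raises
    the covariance to the power \<open>3*H/2\<close>, whose gap exponent \<open>-3*H*(1-H)\<close>
    stays above -1; with \<open>\<theta> = 1\<close> it would be \<open>6*H-6\<close>, integrable at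
    0 only for \<open>H > 5/6\<close>.\<close>
  define \<theta> where "\<theta> = (3*H-2) / 4"
  have \<theta>: "0 \<le> \<theta>" "\<theta> \<le> 1" using assms by (auto simp: \<theta>_def)
  have \<delta>: "0 < \<delta>" "\<delta> \<le> 1" using two_powr_less_2[of H] assms by (auto simp: \<delta>_def)
  have H: "1/2 < H" using assms by simp
  note b = disjoint_bounds[OF assms(1-3) H assms(5)]
  have P: "0 < P" using assms by (auto simp: P_def intro!: mult_pos_pos add_pos_nonneg)
  have c: "0 \<le> c" "c \<le> 1" using assms mult_le_one[of H "2*H-1"] by (auto simp: c_def)
  have U: "0 \<le> ?U" using assms by simp
  have "?v \<le> P" unfolding P_def using assms by (intro mult_mono) auto
  have "\<delta> * ?v \<le> ?v - ?\<mu>\<^sup>2" using b(3) by (simp add: \<delta>_def)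
  then have "?\<mu>\<^sup>2 \<le> (1 - \<delta>) * ?v" by (simp add: algebra_simps)
  also have "\<dots> \<le> (1 - \<delta>) * P" using \<open>?v \<le> P\<close> \<delta> by (intro mult_left_mono) auto
  finally have y: "\<delta> \<le> 1 - y" "0 \<le> y" using P by (auto simp: y_def field_simps)
  have D: "P - ?\<mu>\<^sup>2 = P * (1 - y)" using P by (simp add: y_def field_simps)
  have "self_intersection_kernel H \<epsilon> s1 t1 s2 t2 = ?\<mu> * P powr (- (3/2)) * (1 - y) powr (- (3/2))"
    unfolding self_intersection_kernel_def P_def[symmetric] D using P y \<delta> by (simp add: powr_mult)
  also have "\<dots> \<le> ?\<mu> * P powr (- (3/2)) * (1 + 2 * \<delta> powr (- (3/2)) * y powr \<theta>)"
    using b(1) y \<delta> \<theta> by (intro mult_left_mono inverse_powr_three_halves_le) auto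
  also have "\<dots> = ?\<mu> * P powr (- (3/2)) + 2 * \<delta> powr (- (3/2)) * (?\<mu> * y powr \<theta> * P powr (- (3/2)))"
    by (simp add: algebra_simps)
  also have "?\<mu> * y powr \<theta> * P powr (- (3/2)) = ?\<mu> powr (3*H/2) * P powr (- (1 + 3*H/4))"
  proof -
    have "y powr \<theta> = (?\<mu>\<^sup>2) powr \<theta> * P powr (- \<theta>)"
      using P by (simp add: y_def powr_divide powr_minus_divide)
    also have "(?\<mu>\<^sup>2) powr \<theta> = ?\<mu> powr (2 * \<theta>)"
      using b(1) by (simp add: powr_powr[symmetric])
    finally have "?\<mu> * y powr \<theta> * P powr (- (3/2)) = (?\<mu> * ?\<mu> powr (2 * \<theta>)) * (P powr (- \<theta>) * P powr (- (3/2)))"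
      by (simp only: mult_ac)
    also have "?\<mu> * ?\<mu> powr (2 * \<theta>) = ?\<mu> powr (1 + 2 * \<theta>)"
      using b(1) by (cases "?\<mu> = 0") (auto simp: powr_add)
    also have "1 + 2 * \<theta> = 3*H/2" by (simp add: \<theta>_def field_simps)
    also have "P powr (- \<theta>) * P powr (- (3/2)) = P powr (- (1 + 3*H/4))"
    proof -
      have "- \<theta> + - (3/2) = - (1 + 3*H/4)" by (simp add: \<theta>_def field_simps)
      then show ?thesis by (simp only: powr_add[symmetric])
    qed
    finally show ?thesis .
  qed
  also have "?\<mu> * P powr (- (3/2)) + 2 * \<delta> powr (- (3/2)) * (?\<mu> powr (3*H/2) * P powr (- (1 + 3*H/4)))
     \<le> c * ?U * P powr (- (3/2)) + 2 * \<delta> powr (- (3/2)) * (?U powr (3*H/2) * P powr (- (1 + 3*H/4)))"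
  proof (intro add_mono mult_right_mono mult_left_mono powr_mono2)
    show cU: "?\<mu> \<le> c * ?U" using b(2) by (simp add: c_def mult_ac)
    also have "c * ?U \<le> 1 * ?U" using c U by (intro mult_right_mono) auto
    finally show "?\<mu> \<le> ?U" by simp
  qed (use b(1) assms in auto)
  finally show ?thesis by (simp only: \<delta>_def)
qed

text \<open>The two summands come from the two parts of the covariance bound in
  \<open>overlap_bounds\<close>. The determinant is at least \<open>\<delta> * (M * R)\<close>, and
  since \<open>\<rho>\<close> dominates both endpoint distances, a negative power of
  \<open>R\<close> splits evenly into one factor for each endpoint. This product form is what lets
  the fourfold integral factor.\<close>

lemma kernel_overlap_le:
  fixes H \<epsilon> s1 t1 s2 t2 :: real
  assumes "s1 \<le> t1" "s2 \<le> t2" "s2 \<le> t1" "s1 \<le> t2" "2 / 3 < H" "H < 1" "0 < \<epsilon>"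
  defines "m \<equiv> min (t1 - s1) (t2 - s2)"
  shows "self_intersection_kernel H \<epsilon> s1 t1 s2 t2 \<le> 2 * ((2 - 2 powr H) / 4) powr (- (3/2)) *
     (m powr (- H) * (\<epsilon> + \<bar>s1 - s2\<bar> powr (2*H)) powr (- (3/4)) * (\<epsilon> + \<bar>t1 - t2\<bar> powr (2*H)) powr (- (3/4)) +
      m * (\<epsilon> + m powr (2*H)) powr (- (3/2)) *
       (\<epsilon> + \<bar>s1 - s2\<bar> powr (2*H)) powr (- (1/4 + 1/(4*H))) * (\<epsilon> + \<bar>t1 - t2\<bar> powr (2*H)) powr (- (1/4 + 1/(4*H))))"
proof -
  let ?\<mu> = "incr_cov H s1 t1 s2 t2" and ?u1 = "t1 - s1" and ?u2 = "t2 - s2"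
  define \<rho> where "\<rho> = max \<bar>s1 - s2\<bar> \<bar>t1 - t2\<bar>"
  define \<delta> where "\<delta> = (2 - 2 powr H) / (4::real)"
  have \<delta>: "0 < \<delta>" "\<delta> \<le> 1"
    using two_powr_less_2[of H] ge_one_powr_ge_zero[of 2 H] assms by (auto simp: \<delta>_def)
  have H: "1/2 < H" using assms by simp
  note b = overlap_bounds[OF assms(1-4) H assms(6), folded m_def \<rho>_def]
  have m: "0 \<le> m" using assms by (simp add: m_def)
  have \<rho>: "0 \<le> \<rho>" by (simp add: \<rho>_def)
  define M where "M = \<epsilon> + m powr (2*H)"
  define R where "R = \<epsilon> + \<rho> powr (2*H)"
  have pos: "0 < M" "0 < R" using assms by (auto simp: M_def R_def intro!: add_pos_nonneg)
  let ?D = "(\<epsilon> + ?u1 powr (2*H)) * (\<epsilon> + ?u2 powr (2*H)) - ?\<mu>\<^sup>2"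
  have D: "\<delta> * (M * R) \<le> ?D"
  proof -
    \<comment> \<open>This handles the terms linear in \<epsilon> of the expanded product:
      \<open>m\<close> is the smaller length, and overlap forces \<open>\<rho>\<close> below the
      larger one.\<close>
    have "m powr (2*H) + \<rho> powr (2*H) \<le> ?u1 powr (2*H) + ?u2 powr (2*H)"
    proof -
      have "\<rho> \<le> max ?u1 ?u2" using assms by (auto simp: \<rho>_def)
      then have "\<rho> powr (2*H) \<le> max ?u1 ?u2 powr (2*H)" using \<rho> assms by (intro powr_mono2) auto
      then show ?thesis unfolding m_def by (auto simp: min_def max_def split: if_splits)
    qed
    then have "\<epsilon> * (m powr (2*H) + \<rho> powr (2*H)) \<le> \<epsilon> * (?u1 powr (2*H) + ?u2 powr (2*H))"
      using assms by (intro mult_left_mono) auto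
    then have "1 * (\<epsilon> * \<epsilon> + \<epsilon> * (m powr (2*H) + \<rho> powr (2*H))) \<le> \<epsilon> * \<epsilon> + \<epsilon> * (?u1 powr (2*H) + ?u2 powr (2*H))"
      by simp
    moreover have "\<delta> * (\<epsilon> * \<epsilon> + \<epsilon> * (m powr (2*H) + \<rho> powr (2*H))) \<le> 1 * (\<epsilon> * \<epsilon> + \<epsilon> * (m powr (2*H) + \<rho> powr (2*H)))"
      using \<delta> assms by (intro mult_right_mono) auto
    ultimately have "\<delta> * (\<epsilon> * \<epsilon> + \<epsilon> * (m powr (2*H) + \<rho> powr (2*H))) \<le> \<epsilon> * \<epsilon> + \<epsilon> * (?u1 powr (2*H) + ?u2 powr (2*H))"
      by (rule order_trans[rotated])
    moreover have "\<delta> * (m powr (2*H) * \<rho> powr (2*H)) \<le> ?u1 powr (2*H) * ?u2 powr (2*H) - ?\<mu>\<^sup>2"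
      using b by (simp add: \<delta>_def)
    ultimately have "\<delta> * (\<epsilon> * \<epsilon> + \<epsilon> * (m powr (2*H) + \<rho> powr (2*H))) + \<delta> * (m powr (2*H) * \<rho> powr (2*H)) \<le>
       (\<epsilon> * \<epsilon> + \<epsilon> * (?u1 powr (2*H) + ?u2 powr (2*H))) + (?u1 powr (2*H) * ?u2 powr (2*H) - ?\<mu>\<^sup>2)"
      by (rule add_mono)
    then show ?thesis by (simp add: M_def R_def algebra_simps)
  qed
  have "self_intersection_kernel H \<epsilon> s1 t1 s2 t2 \<le>
      (2 * m * (m powr (2*H-1) + \<rho> powr (2*H-1))) * (\<delta> * (M * R)) powr (- (3/2))"
    unfolding self_intersection_kernel_def using b D pos \<delta> m
    by (intro mult_mono powr_mono2') auto
  also have "(\<delta> * (M * R)) powr (- (3/2)) = \<delta> powr (- (3/2)) * (M powr (- (3/2)) * R powr (- (3/2)))"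
    using \<delta> pos by (simp add: powr_mult)
  also have "(2 * m * (m powr (2*H-1) + \<rho> powr (2*H-1))) * \<dots> =
    2 * \<delta> powr (- (3/2)) * ((m * m powr (2*H-1) * M powr (- (3/2))) * R powr (- (3/2)) +
      m * M powr (- (3/2)) * (\<rho> powr (2*H-1) * R powr (- (3/2))))"
    by (simp add: algebra_simps)
  also have "\<dots> \<le> 2 * \<delta> powr (- (3/2)) * (m powr (- H) *
       ((\<epsilon> + \<bar>s1 - s2\<bar> powr (2*H)) powr (- (3/4)) * (\<epsilon> + \<bar>t1 - t2\<bar> powr (2*H)) powr (- (3/4))) +
      m * M powr (- (3/2)) *
       ((\<epsilon> + \<bar>s1 - s2\<bar> powr (2*H)) powr (- (1/4 + 1/(4*H))) * (\<epsilon> + \<bar>t1 - t2\<bar> powr (2*H)) powr (- (1/4 + 1/(4*H)))))"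
  proof -
    have split: "R powr (- (2 * a)) \<le> (\<epsilon> + \<bar>s1 - s2\<bar> powr (2*H)) powr (- a) * (\<epsilon> + \<bar>t1 - t2\<bar> powr (2*H)) powr (- a)"
      if "0 \<le> a" for a
    proof -
      have "R powr (- (2 * a)) = R powr (- a) * R powr (- a)" by (simp add: powr_add[symmetric])
      also have "\<dots> \<le> (\<epsilon> + \<bar>s1 - s2\<bar> powr (2*H)) powr (- a) * (\<epsilon> + \<bar>t1 - t2\<bar> powr (2*H)) powr (- a)"
        unfolding R_def using assms that
        by (intro mult_mono powr_mono2' add_left_mono powr_mono2 add_pos_nonneg) (auto simp: \<rho>_def)
      finally show ?thesis .
    qed
    have C: "R powr (- (3/2)) \<le> (\<epsilon> + \<bar>s1 - s2\<bar> powr (2*H)) powr (- (3/4)) * (\<epsilon> + \<bar>t1 - t2\<bar> powr (2*H)) powr (- (3/4))"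
      using split[of "3/4"] by simp
    \<comment> \<open>Dropping \<epsilon> from \<open>M\<close> leaves \<open>m powr (-H)\<close>,
      integrable at 0 since \<open>H < 1\<close>. At \<open>m = 0\<close> both sides vanish, as
      \<open>0 powr x = 0\<close>.\<close>
    have A: "m * m powr (2*H-1) * M powr (- (3/2)) \<le> m powr (- H)"
    proof (cases "m = 0")
      case False
      then have "m > 0" using m by simp
      have "M powr (- (3/2)) \<le> (m powr (2*H)) powr (- (3/2))"
        using \<open>m > 0\<close> assms by (intro powr_mono2') (auto simp: M_def)
      then have "m powr (2*H) * M powr (- (3/2)) \<le> m powr (2*H) * (m powr (2*H)) powr (- (3/2))"
        by (intro mult_left_mono) auto
      also have "\<dots> = m powr (- H)"
        by (simp add: powr_powr powr_add[symmetric])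
      also have "m powr (2*H) = m * m powr (2*H-1)" using \<open>m > 0\<close> by (simp add: powr_diff)
      finally show ?thesis .
    qed simp
    \<comment> \<open>The power of \<open>\<rho>\<close> is absorbed into \<open>R\<close>; this
      changes the exponent \<open>-3/2\<close> to \<open>-(1/2 + 1/(2*H))\<close>, twice the
      exponent in the statement.\<close>
    have "\<rho> powr (2*H-1) = (\<rho> powr (2*H)) powr ((2*H-1) / (2*H))"
      using assms by (simp add: powr_powr)
    also have "\<dots> \<le> R powr ((2*H-1) / (2*H))"
      using assms by (intro powr_mono2) (auto simp: R_def)
    finally have "\<rho> powr (2*H-1) * R powr (- (3/2)) \<le> R powr ((2*H-1) / (2*H)) * R powr (- (3/2))"
      by (intro mult_right_mono) auto
    also have "\<dots> = R powr (- (2 * (1/4 + 1/(4*H))))"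
      unfolding powr_add[symmetric] using assms by (intro arg_cong2[where f="(powr)"]) (auto simp: field_simps)
    also note split[of "1/4 + 1/(4*H)"]
    finally have B: "\<rho> powr (2*H-1) * R powr (- (3/2)) \<le>
      (\<epsilon> + \<bar>s1 - s2\<bar> powr (2*H)) powr (- (1/4 + 1/(4*H))) * (\<epsilon> + \<bar>t1 - t2\<bar> powr (2*H)) powr (- (1/4 + 1/(4*H)))"
      using assms by simp
    show ?thesis
      by (intro mult_left_mono[OF add_mono[OF mult_mono[OF A C] mult_left_mono[OF B]]]) (use m in auto)
  qed
  finally show ?thesis by (simp only: M_def \<delta>_def mult.assoc)
qed

lemma nn_integral_even:
  fixes f :: "real \<Rightarrow> ennreal"
  assumes [measurable]: "f \<in> borel_measurable borel" and even: "\<And>x. f (- x) = f x"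
  shows "integral\<^sup>N lborel f = 2 * (\<integral>\<^sup>+x. f x * indicator {0<..} x \<partial>lborel)"
proof -
  have "integral\<^sup>N lborel f = (\<integral>\<^sup>+x. f x * indicator {0<..} x + f x * indicator {..<0} x \<partial>lborel)"
  proof (rule nn_integral_cong_AE)
    have "AE x in lborel. x \<noteq> (0::real)" by (rule AE_lborel_singleton)
    then show "AE x in lborel. f x = f x * indicator {0<..} x + f x * indicator {..<0} x"
      by eventually_elim (auto simp: indicator_def)
  qed
  also have "\<dots> = (\<integral>\<^sup>+x. f x * indicator {0<..} x \<partial>lborel) + (\<integral>\<^sup>+x. f x * indicator {..<0} x \<partial>lborel)"
    by (rule nn_integral_add) measurable
  also have "(\<integral>\<^sup>+x. f x * indicator {..<0} x \<partial>lborel) = (\<integral>\<^sup>+x. f x * indicator {0<..} x \<partial>lborel)"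
    using nn_integral_real_affine[of "\<lambda>x. f x * indicator {..<0} x" "-1" 0]
    by (auto simp: even intro!: nn_integral_cong split: split_indicator)
  finally show ?thesis by (simp add: mult_2)
qed

text \<open>The two intervals are exchanged as blocks, so Fubini for a product of two planes is
  enough. Both orders of a pair thus contribute equally.\<close>

lemma nn_integral_lborel_swap4:
  fixes E :: "real \<Rightarrow> real \<Rightarrow> real \<Rightarrow> real \<Rightarrow> ennreal"
  assumes E[measurable]: "(\<lambda>((t1, s1), (t2, s2)). E t1 s1 t2 s2) \<in> borel_measurable ((borel \<Otimes>\<^sub>M borel) \<Otimes>\<^sub>M (borel \<Otimes>\<^sub>M borel))"
  shows "(nn_integral4 (\<lambda>t1 s1 t2 s2. E t2 s2 t1 s1)) =
    (nn_integral4 (\<lambda>t1 s1 t2 s2. E t1 s1 t2 s2))"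
proof -
  let ?L = "lborel \<Otimes>\<^sub>M lborel :: (real \<times> real) measure"
  interpret L: sigma_finite_measure ?L by (rule lborel_pair.sigma_finite_measure_axioms)
  interpret LL: pair_sigma_finite ?L ?L ..
  have mE[measurable (raw)]: "(\<lambda>x. E (f1 x) (f2 x) (f3 x) (f4 x)) \<in> borel_measurable N"
    if [measurable]: "f1 \<in> borel_measurable N" "f2 \<in> borel_measurable N" "f3 \<in> borel_measurable N" "f4 \<in> borel_measurable N"
    for f1 f2 f3 f4 and N :: "'b measure"
  proof -
    have "(\<lambda>x. ((f1 x, f2 x), (f3 x, f4 x))) \<in> N \<rightarrow>\<^sub>M (borel \<Otimes>\<^sub>M borel) \<Otimes>\<^sub>M (borel \<Otimes>\<^sub>M borel)"
      by measurable
    from measurable_compose[OF this E] show ?thesis by simp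
  qed
  have inner: "(\<integral>\<^sup>+t. \<integral>\<^sup>+s. g (t, s) \<partial>lborel \<partial>lborel) = integral\<^sup>N ?L g"
    if "g \<in> borel_measurable (borel \<Otimes>\<^sub>M borel)" for g :: "real \<times> real \<Rightarrow> ennreal"
    using lborel.nn_integral_fst[of g lborel] that by simp
  have "(nn_integral4 (\<lambda>t1 s1 t2 s2. E t2 s2 t1 s1)) =
      (\<integral>\<^sup>+x. \<integral>\<^sup>+y. E (fst y) (snd y) (fst x) (snd x) \<partial>?L \<partial>?L)"
    using inner[of "\<lambda>y. E (fst y) (snd y) _ _"]
      inner[of "\<lambda>x. \<integral>\<^sup>+t2. \<integral>\<^sup>+s2. E t2 s2 (fst x) (snd x) \<partial>lborel \<partial>lborel"] by simp
  also have "\<dots> = (\<integral>\<^sup>+y. \<integral>\<^sup>+x. E (fst y) (snd y) (fst x) (snd x) \<partial>?L \<partial>?L)"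
    by (rule LL.Fubini') (measurable)
  also have "\<dots> = (nn_integral4 (\<lambda>t1 s1 t2 s2. E t1 s1 t2 s2))"
    using inner[of "\<lambda>y. E _ _ (fst y) (snd y)"]
      inner[of "\<lambda>x. \<integral>\<^sup>+t2. \<integral>\<^sup>+s2. E (fst x) (snd x) t2 s2 \<partial>lborel \<partial>lborel"] by simp
  finally show ?thesis .
qed


definition time_triangle :: "real \<Rightarrow> (real \<times> real) set" where
  "time_triangle T = {(t, s). 0 \<le> s \<and> s \<le> t \<and> t \<le> T}"

lemma sets_time_triangle[measurable]: "time_triangle T \<in> sets (borel \<Otimes>\<^sub>M borel)"
proof -
  have "time_triangle T = {x \<in> space (borel \<Otimes>\<^sub>M borel). 0 \<le> snd x \<and> snd x \<le> fst x \<and> fst x \<le> T}"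
    by (auto simp: time_triangle_def space_pair_measure)
  also have "\<dots> \<in> sets (borel \<Otimes>\<^sub>M borel)" by measurable
  finally show ?thesis .
qed

abbreviation kernel_integral :: "real \<Rightarrow> real \<Rightarrow> real \<Rightarrow> ennreal" where
  "kernel_integral H T \<epsilon> \<equiv> nn_integral4 (\<lambda>t1 s1 t2 s2. ennreal (self_intersection_kernel H \<epsilon> s1 t1 s2 t2) *
     (indicator (time_triangle T) (t1, s1) * indicator (time_triangle T) (t2, s2)))"

section \<open>Integrable majorants of the kernel\<close>

context
  fixes H \<epsilon> T :: real
  assumes H: "2 / 3 < H" "H < 1" and \<epsilon>: "0 < \<epsilon>" and T: "0 < T"
begin

private definition f :: "real \<Rightarrow> real \<Rightarrow> real \<Rightarrow> ennreal" where
  "f p q u = ennreal (u powr p * (\<epsilon> + u powr (2*H)) powr (- q)) * indicator {0<..} u"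

private definition k :: "real \<Rightarrow> real \<Rightarrow> real \<Rightarrow> ennreal" where
  "k r t s = ennreal ((s - t) powr (- r)) * (indicator {0..} t * indicator {0<..} (s - t) * indicator {..T} s)"

private definition \<psi> :: "real \<Rightarrow> ennreal" where
  "\<psi> m = ennreal (m powr (- H)) * indicator {0..T} m"

private definition \<phi> :: "real \<Rightarrow> real \<Rightarrow> ennreal" where
  "\<phi> a x = ennreal ((\<epsilon> + \<bar>x\<bar> powr (2*H)) powr (- a)) * indicator {-T..T} x"

private abbreviation "c1 \<equiv> H * (2*H - 1)"
private abbreviation "c2 \<equiv> 2 * ((2 - 2 powr H) / 2) powr (- (3/2)) :: real"
private abbreviation "c3 \<equiv> 2 * ((2 - 2 powr H) / 4) powr (- (3/2)) :: real"

text \<open>Majorant for pairs whose first interval lies to the left of the second. Only the gap is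
  confined to \<open>[0, T]\<close>, through \<open>k\<close>; the lengths range over the whole
  half-line, which keeps the scaling in \<epsilon> exact.\<close>

private definition E1 :: "real \<Rightarrow> real \<Rightarrow> real \<Rightarrow> real \<Rightarrow> ennreal" where
  "E1 t1 s1 t2 s2 =
     ennreal c1 * (f 1 (3/2) (t1 - s1) * f 1 (3/2) (t2 - s2) * k (2 - 2*H) t1 s2) +
     ennreal c2 * (f (3*H/2) (1 + 3*H/4) (t1 - s1) * f (3*H/2) (1 + 3*H/4) (t2 - s2) * k (3*H*(1 - H)) t1 s2)"

text \<open>Majorant for overlapping pairs whose first interval is the shorter one, so that
  \<open>m = t1 - s1\<close>; the opposite case is reached by exchanging the arguments.\<close>

private definition E2 :: "real \<Rightarrow> real \<Rightarrow> real \<Rightarrow> real \<Rightarrow> ennreal" where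
  "E2 t1 s1 t2 s2 =
     ennreal c3 * (indicator {0..T} t1 * \<psi> (t1 - s1) * \<phi> (3/4) (s1 - s2) * \<phi> (3/4) (t1 - t2)) +
     ennreal c3 * (indicator {0..T} t1 * f 1 (3/2) (t1 - s1) * \<phi> (1/4 + 1/(4*H)) (s1 - s2) * \<phi> (1/4 + 1/(4*H)) (t1 - t2))"

private lemma meas[measurable]:
  "f p q \<in> borel_measurable borel" "\<psi> \<in> borel_measurable borel" "\<phi> a \<in> borel_measurable borel"
  "case_prod (k r) \<in> borel_measurable (borel \<Otimes>\<^sub>M borel)"
  unfolding f_def \<psi>_def \<phi>_def k_def by measurable

private lemma disjoint_E1:
  assumes "0 \<le> s1" "s1 \<le> t1" "t1 < s2" "s2 \<le> t2" "t2 \<le> T"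
  shows "ennreal (self_intersection_kernel H \<epsilon> s1 t1 s2 t2) \<le> E1 t1 s1 t2 s2"
proof -
  let ?u1 = "t1 - s1" and ?u2 = "t2 - s2" and ?b = "s2 - t1"
  let ?V1 = "\<epsilon> + ?u1 powr (2*H)" and ?V2 = "\<epsilon> + ?u2 powr (2*H)"
  have c: "0 \<le> c1" "0 \<le> c2" using H by auto
  note le = kernel_disjoint_le[OF assms(2-4) H \<epsilon>]
  show ?thesis
  proof (cases "?u1 = 0 \<or> ?u2 = 0")
    case True
    then have "self_intersection_kernel H \<epsilon> s1 t1 s2 t2 \<le> 0" using le by auto
    then show ?thesis by (simp add: ennreal_neg)
  next
    case False
    then have u: "0 < ?u1" "0 < ?u2" "0 < ?b" using assms by auto
    have V: "0 < ?V1" "0 < ?V2" using \<epsilon> by (auto intro!: add_pos_nonneg)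
    have k: "k r t1 s2 = ennreal (?b powr (- r))" for r
      using u assms by (simp add: k_def)
    have ff: "f p q ?u1 * f p q ?u2 * k r t1 s2 =
        ennreal ((?u1 powr p * ?V1 powr (- q)) * (?u2 powr p * ?V2 powr (- q)) * ?b powr (- r))" for p q r
      using u by (simp add: k f_def ennreal_mult)
    have "E1 t1 s1 t2 s2 =
      ennreal (c1 * ((?u1 powr 1 * ?V1 powr (- (3/2))) * (?u2 powr 1 * ?V2 powr (- (3/2))) * ?b powr (- (2 - 2*H))) +
        c2 * ((?u1 powr (3*H/2) * ?V1 powr (- (1 + 3*H/4))) * (?u2 powr (3*H/2) * ?V2 powr (- (1 + 3*H/4))) * ?b powr (- (3*H*(1 - H)))))"
      unfolding E1_def ff using c by (simp add: ennreal_mult[symmetric] ennreal_plus[symmetric] del: ennreal_plus)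
    also have "c1 * ((?u1 powr 1 * ?V1 powr (- (3/2))) * (?u2 powr 1 * ?V2 powr (- (3/2))) * ?b powr (- (2 - 2*H))) =
       c1 * (?u1 * ?u2 * ?b powr (2*H-2)) * (?V1 * ?V2) powr (- (3/2))"
      using u V by (simp add: powr_mult)
    also have "c2 * ((?u1 powr (3*H/2) * ?V1 powr (- (1 + 3*H/4))) * (?u2 powr (3*H/2) * ?V2 powr (- (1 + 3*H/4))) * ?b powr (- (3*H*(1 - H)))) =
      c2 * ((?u1 * ?u2 * ?b powr (2*H-2)) powr (3*H/2) * (?V1 * ?V2) powr (- (1 + 3*H/4)))"
    proof -
      have "(?b powr (2*H-2)) powr (3*H/2) = ?b powr (- (3*H*(1 - H)))"
      proof -
        have "(2*H-2) * (3*H/2) = - (3*H*(1 - H))" by (simp add: field_simps)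
        then show ?thesis by (simp only: powr_powr)
      qed
      then show ?thesis using u V by (simp add: powr_mult)
    qed
    finally show ?thesis using le by (simp add: ennreal_leI)
  qed
qed

private lemma overlap_E2:
  assumes "0 \<le> s1" "s1 \<le> t1" "t1 \<le> T" "0 \<le> s2" "s2 \<le> t2" "t2 \<le> T" "s2 \<le> t1" "s1 \<le> t2" "t1 - s1 \<le> t2 - s2"
  shows "ennreal (self_intersection_kernel H \<epsilon> s1 t1 s2 t2) \<le> E2 t1 s1 t2 s2"
proof -
  let ?m = "t1 - s1"
  have c: "0 \<le> c3" by auto
  have m: "min ?m (t2 - s2) = ?m" using assms by simp
  note le = kernel_overlap_le[OF assms(2,5,7,8) H \<epsilon>, unfolded m]
  show ?thesis
  proof (cases "?m = 0")
    case True
    \<comment> \<open>The singular factor is harmless here because \<open>0 powr (-H) = 0\<close>: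
      the bound itself vanishes for a degenerate interval.\<close>
    then have "self_intersection_kernel H \<epsilon> s1 t1 s2 t2 \<le> 0" using le by simp
    then show ?thesis by (simp add: ennreal_neg)
  next
    case False
    then have u: "0 < ?m" using assms by auto
    have \<phi>: "\<phi> a (s1 - s2) = ennreal ((\<epsilon> + \<bar>s1 - s2\<bar> powr (2*H)) powr (- a))"
      "\<phi> a (t1 - t2) = ennreal ((\<epsilon> + \<bar>t1 - t2\<bar> powr (2*H)) powr (- a))" for a
      using assms by (simp_all add: \<phi>_def)
    have f: "f 1 (3/2) ?m = ennreal (?m * (\<epsilon> + ?m powr (2*H)) powr (- (3/2)))"
      using u by (simp add: f_def)
    have \<psi>: "\<psi> ?m = ennreal (?m powr (- H))" using u assms by (simp add: \<psi>_def)
    have g: "indicator {0..T} t1 = (1::ennreal)" using assms by simp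
    have "E2 t1 s1 t2 s2 = ennreal (c3 *
     (?m powr (- H) * (\<epsilon> + \<bar>s1 - s2\<bar> powr (2*H)) powr (- (3/4)) * (\<epsilon> + \<bar>t1 - t2\<bar> powr (2*H)) powr (- (3/4)) +
      ?m * (\<epsilon> + ?m powr (2*H)) powr (- (3/2)) *
       (\<epsilon> + \<bar>s1 - s2\<bar> powr (2*H)) powr (- (1/4 + 1/(4*H))) * (\<epsilon> + \<bar>t1 - t2\<bar> powr (2*H)) powr (- (1/4 + 1/(4*H)))))"
      unfolding E2_def \<phi> f \<psi> g using c u
      by (simp add: ennreal_mult[symmetric] ennreal_plus[symmetric] distrib_left del: ennreal_plus)
    then show ?thesis using le by (simp add: ennreal_leI)
  qed
qed

text \<open>One of the four terms dominates on its own, according to the relative position of the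
  intervals; adding all four avoids cutting the domain of integration into pieces.\<close>

private lemma kernel_le_E:
  "ennreal (self_intersection_kernel H \<epsilon> s1 t1 s2 t2) * (indicator (time_triangle T) (t1, s1) * indicator (time_triangle T) (t2, s2))
    \<le> (E1 t1 s1 t2 s2 + E2 t1 s1 t2 s2) + (E1 t2 s2 t1 s1 + E2 t2 s2 t1 s1)"
proof (cases "(t1, s1) \<in> time_triangle T \<and> (t2, s2) \<in> time_triangle T")
  case True
  then have tt: "0 \<le> s1" "s1 \<le> t1" "t1 \<le> T" "0 \<le> s2" "s2 \<le> t2" "t2 \<le> T"
    by (auto simp: time_triangle_def)
  let ?K = "ennreal (self_intersection_kernel H \<epsilon> s1 t1 s2 t2)"
  have comm: "?K = ennreal (self_intersection_kernel H \<epsilon> s2 t2 s1 t1)"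
    by (simp only: self_intersection_kernel_commute[of H \<epsilon> s1])
  consider "t1 < s2" | "t2 < s1" | "s2 \<le> t1" "s1 \<le> t2" "t1 - s1 \<le> t2 - s2" | "s2 \<le> t1" "s1 \<le> t2" "t2 - s2 \<le> t1 - s1"
    by linarith
  then have "?K \<le> E1 t1 s1 t2 s2 \<or> ?K \<le> E1 t2 s2 t1 s1 \<or> ?K \<le> E2 t1 s1 t2 s2 \<or> ?K \<le> E2 t2 s2 t1 s1"
  proof cases
    case 1 then show ?thesis using disjoint_E1[of s1 t1 s2 t2] tt by simp
  next
    case 2 then show ?thesis using disjoint_E1[of s2 t2 s1 t1] tt unfolding comm by simp
  next
    case 3 then show ?thesis using overlap_E2[of s1 t1 s2 t2] tt by simp
  next
    case 4 then show ?thesis using overlap_E2[of s2 t2 s1 t1] tt unfolding comm by simp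
  qed
  then have "?K \<le> (E1 t1 s1 t2 s2 + E2 t1 s1 t2 s2) + (E1 t2 s2 t1 s1 + E2 t2 s2 t1 s1)"
  proof (elim disjE)
    assume "?K \<le> E1 t1 s1 t2 s2" then show ?thesis by (rule add_increasing2[OF zero_le add_increasing2[OF zero_le]])
  next
    assume "?K \<le> E2 t1 s1 t2 s2" then show ?thesis by (rule add_increasing2[OF zero_le add_increasing[OF zero_le]])
  next
    assume "?K \<le> E1 t2 s2 t1 s1" then show ?thesis by (rule add_increasing[OF zero_le add_increasing2[OF zero_le]])
  next
    assume "?K \<le> E2 t2 s2 t1 s1" then show ?thesis by (rule add_increasing[OF zero_le add_increasing[OF zero_le]])
  qed
  then show ?thesis using True by simp
qed (auto simp: indicator_def)

private lemma integral_f: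
  assumes "0 \<le> p" "1 < 2*H * q - p" "0 \<le> q"
  shows "integral\<^sup>N lborel (f p q) = ennreal (\<epsilon> powr ((p + 1) / (2*H) - q) * enn2real (power_kernel_integral (2*H) p q 1))"
proof -
  have "integral\<^sup>N lborel (f p q) = power_kernel_integral (2*H) p q \<epsilon>"
    by (simp add: f_def[abs_def] power_kernel_integral_def)
  also have "\<dots> = ennreal (\<epsilon> powr ((p + 1) / (2*H) - q)) * power_kernel_integral (2*H) p q 1"
    using \<epsilon> H by (intro power_kernel_integral_scale) auto
  also have "power_kernel_integral (2*H) p q 1 = ennreal (enn2real (power_kernel_integral (2*H) p q 1))"
    using power_kernel_integral_finite[OF assms(1,2,3)] H by (simp add: less_top)
  finally show ?thesis by (simp add: ennreal_mult)
qed

text \<open>Since \<open>2*H * (3/4) > 1\<close>, the power is integrable at infinity: the cut-off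
  at \<open>T\<close> is dropped, and scaling produces the power of \<epsilon>.\<close>

private lemma integral_\<phi>_1:
  "integral\<^sup>N lborel (\<phi> (3/4)) \<le> ennreal (2 * \<epsilon> powr (1/(2*H) - 3/4) * enn2real (power_kernel_integral (2*H) 0 (3/4) 1))"
proof -
  have "integral\<^sup>N lborel (\<phi> (3/4)) = 2 * (\<integral>\<^sup>+x. \<phi> (3/4) x * indicator {0<..} x \<partial>lborel)"
    by (rule nn_integral_even) (auto simp: \<phi>_def indicator_def)
  also have "\<dots> \<le> 2 * integral\<^sup>N lborel (f 0 (3/4))"
    by (intro mult_left_mono nn_integral_mono) (auto simp: \<phi>_def f_def indicator_def)
  also have "integral\<^sup>N lborel (f 0 (3/4)) = ennreal (\<epsilon> powr ((0 + 1) / (2*H) - 3/4) * enn2real (power_kernel_integral (2*H) 0 (3/4) 1))"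
    using H by (intro integral_f) auto
  also have "2 * \<dots> = ennreal (2 * \<epsilon> powr (1/(2*H) - 3/4) * enn2real (power_kernel_integral (2*H) 0 (3/4) 1))"
    by (simp add: ennreal_mult mult.assoc)
  finally show ?thesis .
qed

private lemma integral_\<phi>_2:
  "integral\<^sup>N lborel (\<phi> (1/4 + 1/(4*H))) \<le> ennreal (2 * (T powr (1/2 - H/2) / (1/2 - H/2)))"
proof -
  let ?a = "1/4 + 1/(4*H)"
  have a: "0 \<le> ?a" using H by (intro add_nonneg_nonneg) auto
  have r: "2*H * ?a = (1 + H) / 2" using H by (simp add: field_simps)
  have "integral\<^sup>N lborel (\<phi> ?a) = 2 * (\<integral>\<^sup>+x. \<phi> ?a x * indicator {0<..} x \<partial>lborel)"
    by (rule nn_integral_even) (auto simp: \<phi>_def indicator_def)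
  also have "\<dots> \<le> 2 * (\<integral>\<^sup>+u. ennreal (u powr (- ((1 + H) / 2))) * indicator {0..T} u \<partial>lborel)"
  proof (intro mult_left_mono nn_integral_mono)
    fix x :: real
    show "\<phi> ?a x * indicator {0<..} x \<le> ennreal (x powr (- ((1 + H) / 2))) * indicator {0..T} x"
    proof (cases "0 < x \<and> x \<le> T")
      case True
      have "(\<epsilon> + x powr (2*H)) powr (- ?a) \<le> (x powr (2*H)) powr (- ?a)"
        by (intro powr_mono2') (use a in linarith, use True in simp, use \<epsilon> in simp)
      also have "\<dots> = x powr (- ((1 + H) / 2))" unfolding r[symmetric] by (simp only: powr_powr mult_minus_right)
      finally show ?thesis using True by (simp add: \<phi>_def ennreal_leI)
    qed (auto simp: \<phi>_def indicator_def)
  qed auto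
  also have "(\<integral>\<^sup>+u. ennreal (u powr (- ((1 + H) / 2))) * indicator {0..T} u \<partial>lborel) =
      ennreal (T powr (1 - (1 + H) / 2) / (1 - (1 + H) / 2))"
    using H T by (intro nn_integral_powr_Icc) auto
  also have "1 - (1 + H) / 2 = 1/2 - H/2" by (simp add: field_simps)
  also have "2 * ennreal (T powr (1/2 - H/2) / (1/2 - H/2)) = ennreal (2 * (T powr (1/2 - H/2) / (1/2 - H/2)))"
    using H by (subst ennreal_mult) auto
  finally show ?thesis .
qed

text \<open>The gap integral with exponent \<open>2 - 2*H\<close> is
  \<open>T powr (2*H) / ((2*H-1) * (2*H))\<close>, which \<open>c1\<close> turns into
  \<open>T powr (2*H) / 2\<close>. The other half of the leading constant comes from the exchanged
  pairs.\<close>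

private lemma integral_E1:
  defines "J1 \<equiv> Beta (1/H) (3/2 - 1/H) / (2*H)"
    and "J2 \<equiv> enn2real (power_kernel_integral (2*H) (3*H/2) (1 + 3*H/4) 1)"
  shows "(nn_integral4 (\<lambda>t1 s1 t2 s2. E1 t1 s1 t2 s2)) =
    ennreal (T powr (2*H) / 2 * J1\<^sup>2 * \<epsilon> powr (2/H - 3) +
      c2 * J2\<^sup>2 * (T powr (2 - 3*H*(1-H)) / ((1 - 3*H*(1-H)) * (2 - 3*H*(1-H)))) * \<epsilon> powr (1/H - 1/2 - 3*H/2))"
proof -
  \<comment> \<open>Integrability of the correction at small gaps; the left-hand side is at most
    \<open>3/4\<close>, its value at \<open>H = 1/2\<close>.\<close>
  have H3: "3*H*(1-H) < 1"
  proof -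
    have "0 < 3 * (H - 1/2)\<^sup>2 + 1/4" by (intro add_nonneg_pos) auto
    then show ?thesis by (simp add: power2_eq_square algebra_simps)
  qed
  \<comment> \<open>Convergence of the correction at large lengths; the two sides differ by
    \<open>(3*H - 2) * (H + 1) / 2\<close>.\<close>
  have H2: "1 < 2*H * (1 + 3*H/4) - 3*H/2"
  proof -
    have "0 < (3*H - 2) * (H + 1)" using H by (intro mult_pos_pos) auto
    then show ?thesis by (simp add: algebra_simps)
  qed
  have "power_kernel_integral (2*H) 1 (3/2) 1 = ennreal (Beta (2/(2*H)) (3/2 - 2/(2*H)) / (2*H))"
    using H by (intro power_kernel_integral_Beta) auto
  moreover have "0 \<le> Beta (1/H) (3/2 - 1/H)"
    using H by (simp add: Beta_def Gamma_real_pos less_imp_le field_simps)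
  moreover have "2/(2*H) = 1/H" by simp
  ultimately have J1: "enn2real (power_kernel_integral (2*H) 1 (3/2) 1) = J1"
    using H by (simp add: J1_def)
  have F1: "integral\<^sup>N lborel (f 1 (3/2)) = ennreal (\<epsilon> powr (1/H - 3/2) * J1)"
    using integral_f[of 1 "3/2"] H by (simp add: J1)
  have F2: "integral\<^sup>N lborel (f (3*H/2) (1 + 3*H/4)) = ennreal (\<epsilon> powr ((3*H/2 + 1)/(2*H) - (1 + 3*H/4)) * J2)"
    using integral_f[of "3*H/2" "1 + 3*H/4"] H H2 by (simp add: J2_def)
  have e1: "(\<epsilon> powr (1/H - 3/2))\<^sup>2 = \<epsilon> powr (2/H - 3)"
    using \<epsilon> by (simp add: power2_eq_square powr_add[symmetric])
  have e2: "(\<epsilon> powr ((3*H/2 + 1)/(2*H) - (1 + 3*H/4)))\<^sup>2 = \<epsilon> powr (1/H - 1/2 - 3*H/2)"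
  proof -
    have "2 * ((3*H/2 + 1)/(2*H) - (1 + 3*H/4)) = 1/H - 1/2 - 3*H/2"
      using H by (simp add: field_simps)
    then show ?thesis by (simp only: power2_eq_square powr_add[symmetric] mult_2)
  qed
  have K1: "(\<integral>\<^sup>+t. \<integral>\<^sup>+s. k (2 - 2*H) t s \<partial>lborel \<partial>lborel) = ennreal (T powr (2*H) / ((2*H-1) * (2*H)))"
    unfolding k_def using nn_integral_gap_powr[of T "2 - 2*H"] H T by simp
  have K2: "(\<integral>\<^sup>+t. \<integral>\<^sup>+s. k (3*H*(1-H)) t s \<partial>lborel \<partial>lborel) = ennreal (T powr (2 - 3*H*(1-H)) / ((1 - 3*H*(1-H)) * (2 - 3*H*(1-H))))"
    unfolding k_def using nn_integral_gap_powr[of T "3*H*(1-H)"] H H3 T by simp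
  have J: "0 \<le> J1" "0 \<le> J2" using J1 by (auto simp: J2_def simp flip: J1)
  have "(nn_integral4 (\<lambda>t1 s1 t2 s2. E1 t1 s1 t2 s2)) =
    ennreal c1 * (nn_integral4 (\<lambda>t1 s1 t2 s2. f 1 (3/2) (t1 - s1) * f 1 (3/2) (t2 - s2) * k (2 - 2*H) t1 s2)) +
    ennreal c2 * (nn_integral4 (\<lambda>t1 s1 t2 s2. f (3*H/2) (1 + 3*H/4) (t1 - s1) * f (3*H/2) (1 + 3*H/4) (t2 - s2) * k (3*H*(1 - H)) t1 s2))"
    unfolding E1_def by (simp add: nn_integral_add nn_integral_cmult)
  also have "\<dots> = ennreal c1 * (ennreal (\<epsilon> powr (1/H - 3/2) * J1) * ennreal (\<epsilon> powr (1/H - 3/2) * J1) * ennreal (T powr (2*H) / ((2*H-1) * (2*H)))) +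
     ennreal c2 * (ennreal (\<epsilon> powr ((3*H/2 + 1)/(2*H) - (1 + 3*H/4)) * J2) * ennreal (\<epsilon> powr ((3*H/2 + 1)/(2*H) - (1 + 3*H/4)) * J2) *
        ennreal (T powr (2 - 3*H*(1-H)) / ((1 - 3*H*(1-H)) * (2 - 3*H*(1-H)))))"
    by (simp only: nn_integral_prod_chain[OF meas(1) meas(1) meas(4)] F1 F2 K1 K2)
  also have "\<dots> = ennreal (c1 * (\<epsilon> powr (1/H - 3/2) * J1 * (\<epsilon> powr (1/H - 3/2) * J1) * (T powr (2*H) / ((2*H-1) * (2*H)))) +
     c2 * ((\<epsilon> powr ((3*H/2 + 1)/(2*H) - (1 + 3*H/4)) * J2) * (\<epsilon> powr ((3*H/2 + 1)/(2*H) - (1 + 3*H/4)) * J2) *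
        (T powr (2 - 3*H*(1-H)) / ((1 - 3*H*(1-H)) * (2 - 3*H*(1-H))))))"
    using H H3 J by (simp add: ennreal_mult[symmetric] ennreal_plus[symmetric] del: ennreal_plus)
  also have "c1 * (\<epsilon> powr (1/H - 3/2) * J1 * (\<epsilon> powr (1/H - 3/2) * J1) * (T powr (2*H) / ((2*H-1) * (2*H)))) =
     T powr (2*H) / 2 * J1\<^sup>2 * \<epsilon> powr (2/H - 3)"
    unfolding e1[symmetric] using H by (simp add: power2_eq_square field_simps)
  also have "c2 * ((\<epsilon> powr ((3*H/2 + 1)/(2*H) - (1 + 3*H/4)) * J2) * (\<epsilon> powr ((3*H/2 + 1)/(2*H) - (1 + 3*H/4)) * J2) *
        (T powr (2 - 3*H*(1-H)) / ((1 - 3*H*(1-H)) * (2 - 3*H*(1-H))))) =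
     c2 * J2\<^sup>2 * (T powr (2 - 3*H*(1-H)) / ((1 - 3*H*(1-H)) * (2 - 3*H*(1-H)))) * \<epsilon> powr (1/H - 1/2 - 3*H/2)"
    unfolding e2[symmetric] by (simp add: power2_eq_square)
  finally show ?thesis .
qed

text \<open>Each summand carries \<open>\<epsilon> powr (1/H - 3/2)\<close> once: in the first it
  comes from the two endpoint factors, in the second from the length factor. The leading term on
  disjoint pairs carries the square of this diverging power, so overlaps are negligible.\<close>

private lemma integral_E2:
  defines "J1 \<equiv> enn2real (power_kernel_integral (2*H) 1 (3/2) 1)"
    and "J3 \<equiv> enn2real (power_kernel_integral (2*H) 0 (3/4) 1)"
  shows "(nn_integral4 (\<lambda>t1 s1 t2 s2. E2 t1 s1 t2 s2)) \<le>
    ennreal (c3 * (T * (T powr (1 - H) / (1 - H)) * (2 * J3)\<^sup>2 + T * J1 * (2 * (T powr (1/2 - H/2) / (1/2 - H/2)))\<^sup>2) * \<epsilon> powr (1/H - 3/2))"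
proof -
  let ?K = "2 * (T powr (1/2 - H/2) / (1/2 - H/2))"
  have J: "0 \<le> J1" "0 \<le> J3" by (auto simp: J1_def J3_def)
  have G: "integral\<^sup>N lborel (indicator {0..T}) = ennreal T" using T by simp
  have F1: "integral\<^sup>N lborel (f 1 (3/2)) = ennreal (\<epsilon> powr (1/H - 3/2) * J1)"
    using integral_f[of 1 "3/2"] H by (simp add: J1_def)
  have \<Psi>: "integral\<^sup>N lborel \<psi> = ennreal (T powr (1 - H) / (1 - H))"
    unfolding \<psi>_def using nn_integral_powr_Icc[of T H] H T by simp
  have e: "(\<epsilon> powr (1/(2*H) - 3/4))\<^sup>2 = \<epsilon> powr (1/H - 3/2)"
    using \<epsilon> by (simp add: power2_eq_square powr_add[symmetric])
  have "(nn_integral4 (\<lambda>t1 s1 t2 s2. E2 t1 s1 t2 s2)) =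
    ennreal c3 * (nn_integral4 (\<lambda>t1 s1 t2 s2. indicator {0..T} t1 * \<psi> (t1 - s1) * \<phi> (3/4) (s1 - s2) * \<phi> (3/4) (t1 - t2))) +
    ennreal c3 * (nn_integral4 (\<lambda>t1 s1 t2 s2. indicator {0..T} t1 * f 1 (3/2) (t1 - s1) * \<phi> (1/4 + 1/(4*H)) (s1 - s2) * \<phi> (1/4 + 1/(4*H)) (t1 - t2)))"
    unfolding E2_def by (simp add: nn_integral_add nn_integral_cmult)
  also have "\<dots> = ennreal c3 * (integral\<^sup>N lborel (indicator {0..T}) * integral\<^sup>N lborel \<psi> * (integral\<^sup>N lborel (\<phi> (3/4)))\<^sup>2) +
     ennreal c3 * (integral\<^sup>N lborel (indicator {0..T}) * integral\<^sup>N lborel (f 1 (3/2)) * (integral\<^sup>N lborel (\<phi> (1/4 + 1/(4*H))))\<^sup>2)"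
    by (subst (1 2) nn_integral_prod_overlap) auto
  also have "\<dots> \<le> ennreal c3 * (ennreal T * ennreal (T powr (1 - H) / (1 - H)) * (ennreal (2 * \<epsilon> powr (1/(2*H) - 3/4) * J3))\<^sup>2) +
     ennreal c3 * (ennreal T * ennreal (\<epsilon> powr (1/H - 3/2) * J1) * (ennreal ?K)\<^sup>2)"
    unfolding G F1 \<Psi> J3_def by (intro add_mono mult_left_mono power_mono integral_\<phi>_1 integral_\<phi>_2) auto
  also have "\<dots> = ennreal (c3 * (T * (T powr (1 - H) / (1 - H)) * (2 * \<epsilon> powr (1/(2*H) - 3/4) * J3)\<^sup>2) +
     c3 * (T * (\<epsilon> powr (1/H - 3/2) * J1) * ?K\<^sup>2))"
    using H T J by (simp add: ennreal_mult[symmetric] ennreal_plus[symmetric] ennreal_power del: ennreal_plus)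
  also have "c3 * (T * (T powr (1 - H) / (1 - H)) * (2 * \<epsilon> powr (1/(2*H) - 3/4) * J3)\<^sup>2) +
     c3 * (T * (\<epsilon> powr (1/H - 3/2) * J1) * ?K\<^sup>2) =
    c3 * (T * (T powr (1 - H) / (1 - H)) * (2 * J3)\<^sup>2 + T * J1 * ?K\<^sup>2) * \<epsilon> powr (1/H - 3/2)"
    unfolding power_mult_distrib e by (simp add: distrib_left mult_ac)
  finally show ?thesis .
qed

private lemma integral_kernel_le_E:
  "kernel_integral H T \<epsilon> \<le>
    2 * ((nn_integral4 (\<lambda>t1 s1 t2 s2. E1 t1 s1 t2 s2)) +
      (nn_integral4 (\<lambda>t1 s1 t2 s2. E2 t1 s1 t2 s2)))"
proof -
  define E where "E t1 s1 t2 s2 = E1 t1 s1 t2 s2 + E2 t1 s1 t2 s2" for t1 s1 t2 s2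
  have [measurable (raw)]: "(\<lambda>x. E1 (f1 x) (f2 x) (f3 x) (f4 x)) \<in> borel_measurable N"
      "(\<lambda>x. E2 (f1 x) (f2 x) (f3 x) (f4 x)) \<in> borel_measurable N"
      "(\<lambda>x. E (f1 x) (f2 x) (f3 x) (f4 x)) \<in> borel_measurable N"
    if [measurable]: "f1 \<in> borel_measurable N" "f2 \<in> borel_measurable N" "f3 \<in> borel_measurable N" "f4 \<in> borel_measurable N"
    for f1 f2 f3 f4 and N :: "'b measure"
    unfolding E_def E1_def E2_def by measurable
  have "kernel_integral H T \<epsilon> \<le>
    (nn_integral4 (\<lambda>t1 s1 t2 s2. E t1 s1 t2 s2 + E t2 s2 t1 s1))"
    unfolding E_def by (intro nn_integral_mono kernel_le_E)
  also have "\<dots> = (nn_integral4 (\<lambda>t1 s1 t2 s2. E t1 s1 t2 s2)) +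
     (nn_integral4 (\<lambda>t1 s1 t2 s2. E t2 s2 t1 s1))"
    by (simp add: nn_integral_add)
  also have "(nn_integral4 (\<lambda>t1 s1 t2 s2. E t2 s2 t1 s1)) =
     (nn_integral4 (\<lambda>t1 s1 t2 s2. E t1 s1 t2 s2))"
    by (rule nn_integral_lborel_swap4, unfold case_prod_beta') measurable
  also have "(nn_integral4 (\<lambda>t1 s1 t2 s2. E t1 s1 t2 s2)) =
     (nn_integral4 (\<lambda>t1 s1 t2 s2. E1 t1 s1 t2 s2)) +
      (nn_integral4 (\<lambda>t1 s1 t2 s2. E2 t1 s1 t2 s2))"
    by (simp add: nn_integral_add E_def)
  finally show ?thesis by (simp only: mult_2)
qed

lemmas kernel_integral_le_explicit = order_trans[OF integral_kernel_le_E mult_left_mono[OF add_mono[OF eq_refl[OF integral_E1] integral_E2] zero_le]]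

end

text \<open>The leading power of \<open>\<epsilon>\<close> comes from disjoint pairs of intervals, with the sharp constant; overlapping pairs
  contribute the last term only.\<close>

lemma kernel_integral_le:
  fixes H T :: real
  assumes H: "2 / 3 < H" "H < 1" and T: "0 < T"
  shows "\<exists>A B. 0 \<le> A \<and> 0 \<le> B \<and> (\<forall>\<epsilon>>0.
    kernel_integral H T \<epsilon> \<le>
    ennreal (T powr (2*H) * (Beta (1/H) (3/2 - 1/H) / (2*H))\<^sup>2 * \<epsilon> powr (2/H - 3) +
       A * \<epsilon> powr (1/H - 1/2 - 3*H/2) + B * \<epsilon> powr (1/H - 3/2)))"
proof -
  have H3: "3*H*(1-H) < 1"
  proof -
    have "0 < 3 * (H - 1/2)\<^sup>2 + 1/4" by (intro add_nonneg_pos) auto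
    then show ?thesis by (simp add: power2_eq_square algebra_simps)
  qed
  define A where "A = 2 * ((2 - 2 powr H) / 2) powr (- (3/2)) * (enn2real (power_kernel_integral (2*H) (3*H/2) (1 + 3*H/4) 1))\<^sup>2 *
     (T powr (2 - 3*H*(1-H)) / ((1 - 3*H*(1-H)) * (2 - 3*H*(1-H))))"
  define B where "B = 2 * ((2 - 2 powr H) / 4) powr (- (3/2)) * (T * (T powr (1 - H) / (1 - H)) * (2 * enn2real (power_kernel_integral (2*H) 0 (3/4) 1))\<^sup>2 +
     T * enn2real (power_kernel_integral (2*H) 1 (3/2) 1) * (2 * (T powr (1/2 - H/2) / (1/2 - H/2)))\<^sup>2)"
  have AB: "0 \<le> A" "0 \<le> B" using H H3 T by (auto simp: A_def B_def intro!: mult_nonneg_nonneg add_nonneg_nonneg)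
  show ?thesis
  proof (rule exI[of _ "2 * A"], rule exI[of _ "2 * B"], intro conjI allI impI)
    fix \<epsilon> :: real assume \<epsilon>: "0 < \<epsilon>"
    let ?M = "T powr (2*H) / 2 * (Beta (1/H) (3/2 - 1/H) / (2*H))\<^sup>2 * \<epsilon> powr (2/H - 3)"
    note kernel_integral_le_explicit[OF H \<epsilon> T, folded A_def B_def]
    also have "2 * (ennreal (?M + A * \<epsilon> powr (1/H - 1/2 - 3*H/2)) + ennreal (B * \<epsilon> powr (1/H - 3/2))) =
      ennreal (2 * (?M + A * \<epsilon> powr (1/H - 1/2 - 3*H/2) + B * \<epsilon> powr (1/H - 3/2)))"
    proof -
      have "2 * (ennreal x + ennreal y) = ennreal (2 * (x + y))" if "0 \<le> x" "0 \<le> y" for x y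
        using that by (simp add: ennreal_mult distrib_left)
      from this[of "?M + A * \<epsilon> powr (1/H - 1/2 - 3*H/2)" "B * \<epsilon> powr (1/H - 3/2)"] show ?thesis
        using AB by simp
    qed
    also have "2 * (?M + A * \<epsilon> powr (1/H - 1/2 - 3*H/2) + B * \<epsilon> powr (1/H - 3/2)) =
       T powr (2*H) * (Beta (1/H) (3/2 - 1/H) / (2*H))\<^sup>2 * \<epsilon> powr (2/H - 3) +
       2 * A * \<epsilon> powr (1/H - 1/2 - 3*H/2) + 2 * B * \<epsilon> powr (1/H - 3/2)"
      by (simp add: distrib_left)
    finally show "kernel_integral H T \<epsilon> \<le>
    ennreal (T powr (2*H) * (Beta (1/H) (3/2 - 1/H) / (2*H))\<^sup>2 * \<epsilon> powr (2/H - 3) +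
       2 * A * \<epsilon> powr (1/H - 1/2 - 3*H/2) + 2 * B * \<epsilon> powr (1/H - 3/2))" .
  qed (use AB in auto)
qed


section \<open>Gaussian pairs and the derivative of the heat kernel\<close>

lemma exp_quadratic_eq_normal_density:
  fixes V m x :: real
  assumes "0 < V"
  shows "exp (- (V * (x - m)\<^sup>2 / 2)) = sqrt (2 * pi / V) * normal_density m (1 / sqrt V) x"
  using assms by (simp add: normal_density_def real_sqrt_divide real_sqrt_mult power_divide)

lemma integrable_power_gaussian:
  assumes "0 < V"
  shows "integrable lborel (\<lambda>x. x ^ k * exp (- (V * x\<^sup>2 / 2)) :: real)"
proof -
  have "(\<lambda>x. x ^ k * exp (- (V * x\<^sup>2 / 2))) = (\<lambda>x. sqrt (2 * pi / V) * (normal_density 0 (1 / sqrt V) x * (x - 0) ^ k))"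
    using exp_quadratic_eq_normal_density[OF assms, of _ 0] by (auto simp: fun_eq_iff)
  then show ?thesis using assms by (simp only:) (intro integrable_mult_right integrable_normal_moment, simp)
qed

lemma integral_square_gaussian:
  assumes "0 < V"
  shows "(\<integral>x. x\<^sup>2 * exp (- (V * x\<^sup>2 / 2)) \<partial>lborel) = sqrt (2 * pi) * V powr (- (3/2))"
proof -
  have "(\<lambda>x. x\<^sup>2 * exp (- (V * x\<^sup>2 / 2))) = (\<lambda>x. sqrt (2 * pi / V) * (normal_density 0 (1 / sqrt V) x * (x - 0) ^ (2 * 1)))"
    using exp_quadratic_eq_normal_density[OF assms, of _ 0] by (auto simp: fun_eq_iff)
  then have "(\<integral>x. x\<^sup>2 * exp (- (V * x\<^sup>2 / 2)) \<partial>lborel) = sqrt (2 * pi / V) * (fact (2 * 1) / ((2 / (1 / sqrt V)\<^sup>2) ^ 1 * fact 1))"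
    using integral_normal_moment_even[of "1 / sqrt V" 0 1] assms by simp
  also have "\<dots> = sqrt (2 * pi) * (1 / (V * sqrt V))"
    using assms by (simp add: power_divide real_sqrt_divide)
  also have "V * sqrt V = V powr (3/2)"
    using assms powr_add[of V 1 "1/2"] by (simp add: powr_half_sqrt)
  finally show ?thesis by (simp add: powr_minus_divide)
qed

text \<open>Completing the square turns the integrand into a multiple of \<open>x\<close> times a
  normal density with mean \<open>-(b / V)\<close>.\<close>

lemma has_bochner_integral_linear_gaussian:
  fixes V b :: real
  assumes "0 < V"
  shows "has_bochner_integral lborel (\<lambda>x. x * exp (- (V * x\<^sup>2 + 2 * b * x) / 2))
    (- (b / V) * sqrt (2 * pi / V) * exp (b\<^sup>2 / (2 * V)))"
proof -
  have "x * exp (- (V * x\<^sup>2 + 2 * b * x) / 2) =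
      (normal_density (- (b / V)) (1 / sqrt V) x * x) * (sqrt (2 * pi / V) * exp (b\<^sup>2 / (2 * V)))" for x
  proof -
    have "- (V * x\<^sup>2 + 2 * b * x) / 2 = - (V * (x - (- (b / V)))\<^sup>2 / 2) + b\<^sup>2 / (2 * V)"
      using assms by (simp add: power2_eq_square field_simps)
    then have "exp (- (V * x\<^sup>2 + 2 * b * x) / 2) = exp (- (V * (x - (- (b / V)))\<^sup>2 / 2)) * exp (b\<^sup>2 / (2 * V))"
      by (simp only: exp_add)
    then show ?thesis
      unfolding exp_quadratic_eq_normal_density[OF assms] by (simp add: mult_ac)
  qed
  moreover have "has_bochner_integral lborel
     (\<lambda>x. (normal_density (- (b / V)) (1 / sqrt V) x * x) * (sqrt (2 * pi / V) * exp (b\<^sup>2 / (2 * V))))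
     (- (b / V) * (sqrt (2 * pi / V) * exp (b\<^sup>2 / (2 * V))))"
    using assms by (intro has_bochner_integral_mult_left normal_moment_nz_1) simp
  ultimately show ?thesis by (simp only: mult.assoc)
qed

lemma integral_cos_std_normal:
  "(\<integral>x. std_normal_density x * cos (t * x) \<partial>lborel) = exp (- (t\<^sup>2 / 2))"
proof -
  interpret real_distribution std_normal_distribution by (rule real_dist_normal_dist)
  have "(\<integral>x. std_normal_density x * cos (t * x) \<partial>lborel) = (\<integral>x. cos (t * x) \<partial>std_normal_distribution)"
    by (subst integral_density) auto
  also have "\<dots> = (\<integral>x. Re (iexp (t * x)) \<partial>std_normal_distribution)"
    by (simp add: Re_exp)
  also have "\<dots> = Re (\<integral>x. iexp (t * x) \<partial>std_normal_distribution)"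
    by (rule integral_Re) (rule integrable_iexp, auto)
  also have "\<dots> = Re (char std_normal_distribution t)"
    by (simp add: char_def)
  also have "\<dots> = exp (- (t\<^sup>2 / 2))"
    unfolding char_std_normal_distribution by simp
  finally show ?thesis .
qed

lemma integral_cos_gaussian:
  assumes "0 < V"
  shows "(\<integral>x. cos (t * x) * exp (- (V * x\<^sup>2 / 2)) \<partial>lborel) = sqrt (2 * pi / V) * exp (- (t\<^sup>2 / (2 * V)))"
proof -
  have V: "sqrt V > 0" using assms by simp
  have "(\<integral>x. cos (t * x) * exp (- (V * x\<^sup>2 / 2)) \<partial>lborel) =
      \<bar>1 / sqrt V\<bar> *\<^sub>R (\<integral>x. cos (t * (0 + (1 / sqrt V) * x)) * exp (- (V * (0 + (1 / sqrt V) * x)\<^sup>2 / 2)) \<partial>lborel)"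
    using V by (intro lborel_integral_real_affine) auto
  also have "(\<lambda>x. cos (t * (0 + (1 / sqrt V) * x)) * exp (- (V * (0 + (1 / sqrt V) * x)\<^sup>2 / 2))) =
     (\<lambda>x. sqrt (2 * pi) * (std_normal_density x * cos ((t / sqrt V) * x)))"
    using assms by (auto simp: fun_eq_iff std_normal_density_def power_divide power_mult_distrib)
  also have "(\<integral>x. sqrt (2 * pi) * (std_normal_density x * cos ((t / sqrt V) * x)) \<partial>lborel) = sqrt (2 * pi) * exp (- ((t / sqrt V)\<^sup>2 / 2))"
    by (simp only: integral_mult_right_zero integral_cos_std_normal)
  finally show ?thesis
    using assms by (simp add: power_divide real_sqrt_divide mult_ac)
qed

text \<open>Integrating \<open>d/d\<xi> (sin (\<xi> x) exp (-\<epsilon> \<xi>\<^sup>2 / 2))\<close> over the line gives zero.\<close>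

lemma integral_sin_gaussian:
  assumes "0 < \<epsilon>"
  shows "(\<integral>\<xi>. \<xi> * sin (\<xi> * x) * exp (- (\<epsilon> * \<xi>\<^sup>2 / 2)) \<partial>lborel) = x / \<epsilon> * (sqrt (2 * pi / \<epsilon>) * exp (- (x\<^sup>2 / (2 * \<epsilon>))))"
proof -
  define w where "w \<xi> = exp (- (\<epsilon> * \<xi>\<^sup>2 / 2))" for \<xi>
  have [measurable]: "w \<in> borel_measurable borel" unfolding w_def by measurable
  have w: "integrable lborel w" using integrable_power_gaussian[OF assms, of 0] by (simp add: w_def[abs_def])
  have w1: "integrable lborel (\<lambda>\<xi>. \<xi> * w \<xi>)" using integrable_power_gaussian[OF assms, of 1] by (simp add: w_def[abs_def])
  have i1: "integrable lborel (\<lambda>\<xi>. \<xi> * sin (\<xi> * x) * w \<xi>)"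
    by (rule Bochner_Integration.integrable_bound[OF w1])
       (auto simp: abs_mult w_def intro!: mult_right_mono mult_left_le AE_I2)
  have i2: "integrable lborel (\<lambda>\<xi>. cos (x * \<xi>) * w \<xi>)"
    by (rule Bochner_Integration.integrable_bound[OF w])
       (auto simp: abs_mult w_def intro!: mult_left_le_one_le AE_I2)
  let ?f = "\<lambda>\<xi>. x * (cos (x * \<xi>) * w \<xi>) - \<epsilon> * (\<xi> * sin (\<xi> * x) * w \<xi>)"
  have "(LBINT \<xi>=-\<infinity>..\<infinity>. ?f \<xi>) = 0 - 0"
  proof (rule interval_integral_FTC_integrable[where F = "\<lambda>\<xi>. sin (\<xi> * x) * w \<xi>"])
    have "w = (\<lambda>\<xi>. exp ((- (\<epsilon> / 2)) * \<xi>\<^sup>2))" by (simp add: w_def fun_eq_iff)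
    then have "(w has_real_derivative - (\<epsilon> * \<xi>) * w \<xi>) (at \<xi>)" for \<xi>
      by (auto intro!: derivative_eq_intros)
    from DERIV_mult[OF _ this]
    show "((\<lambda>\<xi>. sin (\<xi> * x) * w \<xi>) has_vector_derivative ?f \<xi>) (at \<xi>)" for \<xi>
      unfolding has_real_derivative_iff_has_vector_derivative[symmetric]
      by (rule DERIV_cong) (auto intro!: derivative_eq_intros simp: algebra_simps)
    show "isCont ?f \<xi>" for \<xi> unfolding w_def by (intro continuous_intros) auto
    show "set_integrable lborel (einterval (- \<infinity>) \<infinity>) ?f"
      using i1 i2 by (simp add: set_integrable_def)
    have wt: "(w \<longlongrightarrow> 0) at_top" "(w \<longlongrightarrow> 0) at_bot"
      unfolding w_def using assms by real_asymp+
    have "((\<lambda>\<xi>. sin (\<xi> * x) * w \<xi>) \<longlongrightarrow> 0) F" if "(w \<longlongrightarrow> 0) F" for F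
      by (rule Lim_null_comparison[OF _ that]) (auto simp: abs_mult w_def intro!: mult_left_le_one_le always_eventually)
    with wt show "(((\<lambda>\<xi>. sin (\<xi> * x) * w \<xi>) \<circ> real_of_ereal) \<longlongrightarrow> 0) (at_right (- \<infinity>))"
      "(((\<lambda>\<xi>. sin (\<xi> * x) * w \<xi>) \<circ> real_of_ereal) \<longlongrightarrow> 0) (at_left \<infinity>)"
      by (simp_all add: ereal_tendsto_simps)
  qed auto
  then have "(\<integral>\<xi>. ?f \<xi> \<partial>lborel) = 0"
    by (simp add: interval_integral_to_infinity_eq interval_lebesgue_integral_def set_lebesgue_integral_def)
  then have "\<epsilon> * (\<integral>\<xi>. \<xi> * sin (\<xi> * x) * w \<xi> \<partial>lborel) = x * (\<integral>\<xi>. cos (x * \<xi>) * w \<xi> \<partial>lborel)"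
    using i1 i2 by simp
  then show ?thesis
    using assms integral_cos_gaussian[OF assms, of x] by (simp add: w_def field_simps)
qed

definition heat_kernel' :: "real \<Rightarrow> real \<Rightarrow> real" where
  "heat_kernel' \<epsilon> x = - (x / \<epsilon>) * heat_kernel \<epsilon> x"

lemma deriv_heat_kernel:
  assumes "0 < \<epsilon>"
  shows "deriv (heat_kernel \<epsilon>) x = heat_kernel' \<epsilon> x"
proof (rule DERIV_imp_deriv)
  show "(heat_kernel \<epsilon> has_field_derivative heat_kernel' \<epsilon> x) (at x)"
    unfolding heat_kernel_def[abs_def] heat_kernel'_def heat_kernel_def using assms
    by (auto intro!: derivative_eq_intros simp: field_simps)
qed

text \<open>As a superposition of sines, the kernel has expectations that reduce to Gaussian
  characteristic functions. No joint density is involved, so proportional or vanishing increments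
  fall under the same computation.\<close>

lemma heat_kernel'_fourier:
  assumes "0 < \<epsilon>"
  shows "heat_kernel' \<epsilon> x = - (1 / (2 * pi)) * (\<integral>\<xi>. \<xi> * sin (\<xi> * x) * exp (- (\<epsilon> * \<xi>\<^sup>2 / 2)) \<partial>lborel)"
proof -
  have "(2 * pi * \<epsilon>) powr (- 1 / 2) = 1 / (2 * pi) * sqrt (2 * pi / \<epsilon>)"
  proof -
    have "(2 * pi * \<epsilon>) powr (- 1 / 2) = 1 / sqrt (2 * pi * \<epsilon>)"
      using assms by (simp add: powr_minus_divide powr_half_sqrt flip: minus_divide_left)
    also have "\<dots> = 1 / (sqrt (2 * pi) * sqrt \<epsilon>)" by (simp add: real_sqrt_mult)
    also have "\<dots> = sqrt (2 * pi) / ((sqrt (2 * pi) * sqrt (2 * pi)) * sqrt \<epsilon>)"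
      by (simp del: real_sqrt_mult_self)
    also have "\<dots> = 1 / (2 * pi) * sqrt (2 * pi / \<epsilon>)"
      by (simp add: real_sqrt_divide)
    finally show ?thesis .
  qed
  then show ?thesis
    unfolding integral_sin_gaussian[OF assms] heat_kernel'_def heat_kernel_def by simp
qed

lemma heat_kernel'_measurable[measurable]: "heat_kernel' \<epsilon> \<in> borel_measurable borel"
  unfolding heat_kernel'_def[abs_def] heat_kernel_def by measurable

lemma heat_kernel'_bounded:
  assumes "0 < \<epsilon>"
  shows "\<bar>heat_kernel' \<epsilon> x\<bar> \<le> 1 / (2 * pi) * (\<integral>\<xi>. \<bar>\<xi>\<bar> * exp (- (\<epsilon> * \<xi>\<^sup>2 / 2)) \<partial>lborel)"
proof -
  have "integrable lborel (\<lambda>\<xi>. \<xi> * exp (- (\<epsilon> * \<xi>\<^sup>2 / 2)))"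
    using integrable_power_gaussian[OF assms, of 1] by simp
  from integrable_abs[OF this] have i: "integrable lborel (\<lambda>\<xi>. \<bar>\<xi>\<bar> * exp (- (\<epsilon> * \<xi>\<^sup>2 / 2)))"
    by (simp add: abs_mult)
  have "norm (\<integral>\<xi>. \<xi> * sin (\<xi> * x) * exp (- (\<epsilon> * \<xi>\<^sup>2 / 2)) \<partial>lborel) \<le> (\<integral>\<xi>. \<bar>\<xi>\<bar> * exp (- (\<epsilon> * \<xi>\<^sup>2 / 2)) \<partial>lborel)"
    by (rule Bochner_Integration.integral_norm_bound_integral[OF _ i] , rule Bochner_Integration.integrable_bound[OF i])
       (auto simp: abs_mult intro!: mult_right_mono mult_left_le AE_I2)
  then show ?thesis unfolding heat_kernel'_fourier[OF assms] by (simp add: abs_mult divide_right_mono)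
qed

section \<open>Expectations for Gaussian pairs\<close>

lemma (in prob_space) centered_normal_rv:
  assumes [measurable]: "Z \<in> borel_measurable M" and \<gamma>: "0 \<le> \<gamma>"
    and d: "distr M borel Z = centered_normal \<gamma>"
  shows "integrable M (\<lambda>\<omega>. (Z \<omega>)\<^sup>2)" "expectation (\<lambda>\<omega>. (Z \<omega>)\<^sup>2) = \<gamma>"
    "expectation (\<lambda>\<omega>. cos (Z \<omega>)) = exp (- (\<gamma> / 2))"
proof -
  have "integrable (centered_normal \<gamma>) (\<lambda>x. x\<^sup>2) \<and> (\<integral>x. x\<^sup>2 \<partial>centered_normal \<gamma>) = \<gamma> \<and>
     (\<integral>x. cos x \<partial>centered_normal \<gamma>) = exp (- (\<gamma> / 2))"
  proof (cases "\<gamma> = 0")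
    case True
    interpret r: prob_space "return borel (0::real)" by (rule prob_space_return) simp
    have "integrable (return borel (0::real)) (\<lambda>x. x\<^sup>2)"
      by (rule r.integrable_const_bound[of _ 0]) (auto simp: AE_return)
    then show ?thesis using True by (simp add: centered_normal_def integral_return)
  next
    case False
    then have g: "0 < \<gamma>" using \<gamma> by simp
    have nd: "normal_density 0 (sqrt \<gamma>) x * y = y * exp (- ((1 / \<gamma>) * x\<^sup>2 / 2)) / sqrt (2 * pi * \<gamma>)" for x y
      using g by (simp add: normal_density_def)
    have nn: "0 \<le> normal_density 0 (sqrt \<gamma>) x" for x by simp
    have i: "integrable lborel (\<lambda>x. normal_density 0 (sqrt \<gamma>) x * x\<^sup>2)"
      using integrable_normal_moment[of "sqrt \<gamma>" 0 2] g by simp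
    have "(\<integral>x. normal_density 0 (sqrt \<gamma>) x * x\<^sup>2 \<partial>lborel) = \<gamma>"
      using integral_normal_moment_even[of "sqrt \<gamma>" 0 1] g by simp
    moreover have "(\<integral>x. normal_density 0 (sqrt \<gamma>) x * cos x \<partial>lborel) = exp (- (\<gamma> / 2))"
    proof -
      have "(\<integral>x. normal_density 0 (sqrt \<gamma>) x * cos x \<partial>lborel) =
          (\<integral>x. cos (1 * x) * exp (- ((1 / \<gamma>) * x\<^sup>2 / 2)) / sqrt (2 * pi * \<gamma>) \<partial>lborel)"
        by (simp only: nd mult_1)
      also have "\<dots> = (sqrt (2 * pi / (1 / \<gamma>)) * exp (- (1\<^sup>2 / (2 * (1 / \<gamma>))))) / sqrt (2 * pi * \<gamma>)"
        using g by (simp only: integral_divide_zero integral_cos_gaussian[of "1 / \<gamma>" 1] zero_less_divide_1_iff)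
      also have "\<dots> = exp (- (\<gamma> / 2))" using g by simp
      finally show ?thesis .
    qed
    ultimately show ?thesis
      using False g i nn
      by (simp add: centered_normal_def integrable_density integral_density)
  qed
  then show "integrable M (\<lambda>\<omega>. (Z \<omega>)\<^sup>2)" "expectation (\<lambda>\<omega>. (Z \<omega>)\<^sup>2) = \<gamma>"
    "expectation (\<lambda>\<omega>. cos (Z \<omega>)) = exp (- (\<gamma> / 2))"
    unfolding d[symmetric] by (simp_all add: integrable_distr_eq integral_distr)
qed

text \<open>The bounded factor \<open>G\<close> is later first the other kernel and then a sine, so
  that two applications transform both factors of a product.\<close>

lemma (in prob_space) expectation_heat_kernel'_fourier:
  assumes [measurable]: "Y \<in> borel_measurable M" "G \<in> borel_measurable M"
    and G: "\<And>\<omega>. \<omega> \<in> space M \<Longrightarrow> \<bar>G \<omega>\<bar> \<le> C" and \<epsilon>: "0 < \<epsilon>"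
  shows "expectation (\<lambda>\<omega>. G \<omega> * heat_kernel' \<epsilon> (Y \<omega>)) =
    - (1 / (2 * pi)) * (\<integral>\<xi>. \<xi> * exp (- (\<epsilon> * \<xi>\<^sup>2 / 2)) * expectation (\<lambda>\<omega>. G \<omega> * sin (\<xi> * Y \<omega>)) \<partial>lborel)"
proof -
  interpret P: pair_sigma_finite M "lborel :: real measure" ..
  define w where "w \<xi> = exp (- (\<epsilon> * \<xi>\<^sup>2 / 2))" for \<xi>
  have [measurable]: "w \<in> borel_measurable borel" unfolding w_def by measurable
  have "integrable lborel (\<lambda>\<xi>. \<xi> * w \<xi>)" using integrable_power_gaussian[OF \<epsilon>, of 1] by (simp add: w_def[abs_def])
  from integrable_abs[OF this] have i: "integrable lborel (\<lambda>\<xi>. C * (\<bar>\<xi>\<bar> * w \<xi>))"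
    by (simp add: abs_mult w_def)
  define F where "F \<omega> \<xi> = G \<omega> * (\<xi> * sin (\<xi> * Y \<omega>) * w \<xi>)" for \<omega> \<xi>
  have [measurable]: "case_prod F \<in> borel_measurable (M \<Otimes>\<^sub>M lborel)" unfolding F_def by measurable
  have C: "0 \<le> C" using G not_empty by fastforce
  have bd: "\<bar>F \<omega> \<xi>\<bar> \<le> C * (\<bar>\<xi>\<bar> * w \<xi>)" if "\<omega> \<in> space M" for \<omega> \<xi>
  proof -
    have "\<bar>F \<omega> \<xi>\<bar> = \<bar>G \<omega>\<bar> * (\<bar>\<xi>\<bar> * \<bar>sin (\<xi> * Y \<omega>)\<bar> * w \<xi>)" by (simp add: F_def abs_mult w_def)
    also have "\<dots> \<le> C * (\<bar>\<xi>\<bar> * 1 * w \<xi>)"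
      using G[OF that] C by (intro mult_mono) (auto simp: w_def)
    finally show ?thesis by simp
  qed
  have int: "integrable (M \<Otimes>\<^sub>M lborel) (case_prod F)"
  proof (rule Bochner_Integration.integrable_bound)
    show "integrable (M \<Otimes>\<^sub>M lborel) (\<lambda>(\<omega>, \<xi>). C * (\<bar>\<xi>\<bar> * w \<xi>))"
      by (rule P.Fubini_integrable) (use i in \<open>auto simp: case_prod_beta\<close>)
    show "AE x in M \<Otimes>\<^sub>M lborel. norm (case_prod F x) \<le> norm (case x of (\<omega>, \<xi>) \<Rightarrow> C * (\<bar>\<xi>\<bar> * w \<xi>))"
      by (rule AE_I2) (use bd C in \<open>auto simp: space_pair_measure abs_mult w_def\<close>)
  qed measurable
  have "G \<omega> * heat_kernel' \<epsilon> (Y \<omega>) = - (1 / (2 * pi)) * (\<integral>\<xi>. F \<omega> \<xi> \<partial>lborel)" for \<omega>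
    unfolding heat_kernel'_fourier[OF \<epsilon>] F_def w_def integral_mult_right_zero
    by (rule mult.left_commute)
  then have "expectation (\<lambda>\<omega>. G \<omega> * heat_kernel' \<epsilon> (Y \<omega>)) = expectation (\<lambda>\<omega>. - (1 / (2 * pi)) * (\<integral>\<xi>. F \<omega> \<xi> \<partial>lborel))"
    by (simp only:)
  also have "\<dots> = - (1 / (2 * pi)) * expectation (\<lambda>\<omega>. \<integral>\<xi>. F \<omega> \<xi> \<partial>lborel)" by simp
  also have "expectation (\<lambda>\<omega>. \<integral>\<xi>. F \<omega> \<xi> \<partial>lborel) = (\<integral>\<xi>. expectation (\<lambda>\<omega>. F \<omega> \<xi>) \<partial>lborel)"
    by (rule P.Fubini_integral[OF int, symmetric])
  also have "(\<lambda>\<xi>. expectation (\<lambda>\<omega>. F \<omega> \<xi>)) = (\<lambda>\<xi>. \<xi> * w \<xi> * expectation (\<lambda>\<omega>. G \<omega> * sin (\<xi> * Y \<omega>)))"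
    unfolding F_def by (subst integral_mult_right_zero[symmetric]) (simp add: mult_ac)
  finally show ?thesis by (simp add: w_def)
qed

text \<open>Joint normality through the laws of linear combinations, as in
  \<open>centered_gaussian_process\<close>, which includes degenerate pairs.\<close>

definition gaussian_pair :: "'a measure \<Rightarrow> ('a \<Rightarrow> real) \<Rightarrow> ('a \<Rightarrow> real) \<Rightarrow> bool" where
  "gaussian_pair M X Y \<longleftrightarrow> X \<in> borel_measurable M \<and> Y \<in> borel_measurable M \<and>
     (\<forall>a b. \<exists>\<gamma>\<ge>0. distr M borel (\<lambda>\<omega>. a * X \<omega> + b * Y \<omega>) = centered_normal \<gamma>)"

context prob_space
begin

context
  fixes X Y :: "'a \<Rightarrow> real"
  assumes XY: "gaussian_pair M X Y"
begin

lemma gaussian_pair_measurable: "X \<in> borel_measurable M" "Y \<in> borel_measurable M"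
  using XY by (auto simp: gaussian_pair_def)

private lemma combination:
  obtains \<gamma> where "0 \<le> \<gamma>" "distr M borel (\<lambda>\<omega>. a * X \<omega> + b * Y \<omega>) = centered_normal \<gamma>"
    "(\<lambda>\<omega>. a * X \<omega> + b * Y \<omega>) \<in> borel_measurable M"
proof -
  have "\<exists>\<gamma>\<ge>0. distr M borel (\<lambda>\<omega>. a * X \<omega> + b * Y \<omega>) = centered_normal \<gamma>"
    using XY by (simp add: gaussian_pair_def)
  moreover have "(\<lambda>\<omega>. a * X \<omega> + b * Y \<omega>) \<in> borel_measurable M"
    using gaussian_pair_measurable by measurable
  ultimately show ?thesis using that by blast
qed

lemma gaussian_pair_integrable:
  "integrable M (\<lambda>\<omega>. (X \<omega>)\<^sup>2)" "integrable M (\<lambda>\<omega>. (Y \<omega>)\<^sup>2)" "integrable M (\<lambda>\<omega>. X \<omega> * Y \<omega>)"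
  "integrable M X" "integrable M Y"
proof -
  have lin: "integrable M (\<lambda>\<omega>. (a * X \<omega> + b * Y \<omega>)\<^sup>2)" for a b
  proof -
    obtain \<gamma> where c: "0 \<le> \<gamma>" "distr M borel (\<lambda>\<omega>. a * X \<omega> + b * Y \<omega>) = centered_normal \<gamma>"
      "(\<lambda>\<omega>. a * X \<omega> + b * Y \<omega>) \<in> borel_measurable M" by (rule combination)
    show ?thesis by (rule centered_normal_rv(1)[OF c(3,1,2)])
  qed
  show x: "integrable M (\<lambda>\<omega>. (X \<omega>)\<^sup>2)" and y: "integrable M (\<lambda>\<omega>. (Y \<omega>)\<^sup>2)"
    using lin[of 1 0] lin[of 0 1] by simp_all
  have "integrable M (\<lambda>\<omega>. ((1 * X \<omega> + 1 * Y \<omega>)\<^sup>2 - (X \<omega>)\<^sup>2 - (Y \<omega>)\<^sup>2) / 2)"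
    using lin[of 1 1] x y by (intro integrable_divide Bochner_Integration.integrable_diff)
  also have "(\<lambda>\<omega>. ((1 * X \<omega> + 1 * Y \<omega>)\<^sup>2 - (X \<omega>)\<^sup>2 - (Y \<omega>)\<^sup>2) / 2) = (\<lambda>\<omega>. X \<omega> * Y \<omega>)"
    by (simp add: power2_sum)
  finally show "integrable M (\<lambda>\<omega>. X \<omega> * Y \<omega>)" .
  show "integrable M X" "integrable M Y"
    using x y gaussian_pair_measurable by (auto intro: square_integrable_imp_integrable)
qed

lemma gaussian_pair_quadratic:
  "expectation (\<lambda>\<omega>. (a * X \<omega> + b * Y \<omega>)\<^sup>2) = a\<^sup>2 * expectation (\<lambda>\<omega>. (X \<omega>)\<^sup>2) +
     2 * a * b * expectation (\<lambda>\<omega>. X \<omega> * Y \<omega>) + b\<^sup>2 * expectation (\<lambda>\<omega>. (Y \<omega>)\<^sup>2)"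
proof -
  have "(\<lambda>\<omega>. (a * X \<omega> + b * Y \<omega>)\<^sup>2) = (\<lambda>\<omega>. a\<^sup>2 * (X \<omega>)\<^sup>2 + (2 * a * b) * (X \<omega> * Y \<omega>) + b\<^sup>2 * (Y \<omega>)\<^sup>2)"
    by (auto simp: fun_eq_iff power2_sum power_mult_distrib)
  then show ?thesis
    using gaussian_pair_integrable by simp
qed

lemma gaussian_pair_cos:
  "expectation (\<lambda>\<omega>. cos (a * X \<omega> + b * Y \<omega>)) = exp (- ((a\<^sup>2 * expectation (\<lambda>\<omega>. (X \<omega>)\<^sup>2) +
     2 * a * b * expectation (\<lambda>\<omega>. X \<omega> * Y \<omega>) + b\<^sup>2 * expectation (\<lambda>\<omega>. (Y \<omega>)\<^sup>2)) / 2))"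
proof -
  obtain \<gamma> where c: "0 \<le> \<gamma>" "distr M borel (\<lambda>\<omega>. a * X \<omega> + b * Y \<omega>) = centered_normal \<gamma>"
    "(\<lambda>\<omega>. a * X \<omega> + b * Y \<omega>) \<in> borel_measurable M" by (rule combination)
  show ?thesis
    unfolding gaussian_pair_quadratic[symmetric] centered_normal_rv(2,3)[OF c(3,1,2)] ..
qed

text \<open>Once both kernels are replaced by sines, the expectation of their product is a
  difference of two Gaussian exponentials in \<open>\<xi>\<close> and \<open>\<eta>\<close>.
  Integrating out \<open>\<eta>\<close> leaves a Gaussian second moment in \<open>\<xi>\<close> with
  coefficient \<open>A\<close>, the Schur complement of \<open>V2\<close>, and \<open>V2 * A\<close>
  is the determinant.\<close>

lemma expectation_heat_kernel'_pair:
  assumes \<epsilon>: "0 < \<epsilon>" and \<delta>: "0 < \<delta>"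
  defines "v1 \<equiv> expectation (\<lambda>\<omega>. (X \<omega>)\<^sup>2)" and "v2 \<equiv> expectation (\<lambda>\<omega>. (Y \<omega>)\<^sup>2)"
    and "\<mu> \<equiv> expectation (\<lambda>\<omega>. X \<omega> * Y \<omega>)"
  shows "expectation (\<lambda>\<omega>. heat_kernel' \<epsilon> (X \<omega>) * heat_kernel' \<delta> (Y \<omega>)) =
    \<mu> * ((\<epsilon> + v1) * (\<delta> + v2) - \<mu>\<^sup>2) powr (- (3/2)) / (2 * pi)"
proof -
  note [measurable] = gaussian_pair_measurable
  have v: "0 \<le> v1" "0 \<le> v2" by (simp_all add: v1_def v2_def)
  define V1 where "V1 = \<epsilon> + v1"
  define V2 where "V2 = \<delta> + v2"
  have V: "0 < V1" "0 < V2" using v \<epsilon> \<delta> by (auto simp: V1_def V2_def)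
  have ss: "expectation (\<lambda>\<omega>. sin (\<xi> * X \<omega>) * sin (\<eta> * Y \<omega>)) =
     (exp (- ((\<xi>\<^sup>2 * v1 - 2 * \<xi> * \<eta> * \<mu> + \<eta>\<^sup>2 * v2) / 2)) - exp (- ((\<xi>\<^sup>2 * v1 + 2 * \<xi> * \<eta> * \<mu> + \<eta>\<^sup>2 * v2) / 2))) / 2" for \<xi> \<eta>
  proof -
    have i: "integrable M (\<lambda>\<omega>. cos (\<xi> * X \<omega> + c * Y \<omega>))" for c
      by (rule integrable_const_bound[of _ 1]) auto
    have "(\<lambda>\<omega>. sin (\<xi> * X \<omega>) * sin (\<eta> * Y \<omega>)) = (\<lambda>\<omega>. (cos (\<xi> * X \<omega> + (- \<eta>) * Y \<omega>) - cos (\<xi> * X \<omega> + \<eta> * Y \<omega>)) / 2)"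
      by (simp add: fun_eq_iff cos_add cos_diff)
    then have "expectation (\<lambda>\<omega>. sin (\<xi> * X \<omega>) * sin (\<eta> * Y \<omega>)) =
        (expectation (\<lambda>\<omega>. cos (\<xi> * X \<omega> + (- \<eta>) * Y \<omega>)) - expectation (\<lambda>\<omega>. cos (\<xi> * X \<omega> + \<eta> * Y \<omega>))) / 2"
      using i[of "- \<eta>"] i[of \<eta>] by simp
    then show ?thesis
      unfolding gaussian_pair_cos v1_def v2_def \<mu>_def by simp
  qed
  have inner: "(\<integral>\<eta>. \<eta> * exp (- (\<delta> * \<eta>\<^sup>2 / 2)) * expectation (\<lambda>\<omega>. sin (\<xi> * X \<omega>) * sin (\<eta> * Y \<omega>)) \<partial>lborel) =
     (\<mu> * \<xi> / V2) * sqrt (2 * pi / V2) * exp (- ((v1 - \<mu>\<^sup>2 / V2) * \<xi>\<^sup>2 / 2))" for \<xi>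
  proof -
    let ?I = "\<lambda>c. (\<lambda>\<eta>. \<eta> * exp (- (V2 * \<eta>\<^sup>2 + 2 * c * \<eta>) / 2))"
    have "\<eta> * exp (- (\<delta> * \<eta>\<^sup>2 / 2)) * expectation (\<lambda>\<omega>. sin (\<xi> * X \<omega>) * sin (\<eta> * Y \<omega>)) =
        exp (- (\<xi>\<^sup>2 * v1 / 2)) / 2 * (?I (- (\<mu> * \<xi>)) \<eta> - ?I (\<mu> * \<xi>) \<eta>)" for \<eta>
    proof -
      have e: "exp (- (\<delta> * \<eta>\<^sup>2 / 2)) * exp (- ((\<xi>\<^sup>2 * v1 + c + \<eta>\<^sup>2 * v2) / 2)) =
          exp (- (\<xi>\<^sup>2 * v1 / 2)) * exp (- (V2 * \<eta>\<^sup>2 + c) / 2)" for c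
        unfolding exp_add[symmetric] V2_def by (simp add: field_simps)
      have "\<eta> * exp (- (\<delta> * \<eta>\<^sup>2 / 2)) * expectation (\<lambda>\<omega>. sin (\<xi> * X \<omega>) * sin (\<eta> * Y \<omega>)) =
        \<eta> / 2 * (exp (- (\<delta> * \<eta>\<^sup>2 / 2)) * exp (- ((\<xi>\<^sup>2 * v1 + (- (2 * \<xi> * \<eta> * \<mu>)) + \<eta>\<^sup>2 * v2) / 2)) -
          exp (- (\<delta> * \<eta>\<^sup>2 / 2)) * exp (- ((\<xi>\<^sup>2 * v1 + 2 * \<xi> * \<eta> * \<mu> + \<eta>\<^sup>2 * v2) / 2)))"
      proof -
        have "x * y * ((p - q) / 2) = x / 2 * (y * p - y * q)" for x y p q :: real
          by (simp add: right_diff_distrib)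
        then show ?thesis unfolding ss by simp
      qed
      also have "\<dots> = exp (- (\<xi>\<^sup>2 * v1 / 2)) / 2 * (?I (- (\<mu> * \<xi>)) \<eta> - ?I (\<mu> * \<xi>) \<eta>)"
        unfolding e by (simp add: algebra_simps)
      finally show ?thesis .
    qed
    then have "(\<integral>\<eta>. \<eta> * exp (- (\<delta> * \<eta>\<^sup>2 / 2)) * expectation (\<lambda>\<omega>. sin (\<xi> * X \<omega>) * sin (\<eta> * Y \<omega>)) \<partial>lborel) =
       (\<integral>\<eta>. exp (- (\<xi>\<^sup>2 * v1 / 2)) / 2 * (?I (- (\<mu> * \<xi>)) \<eta> - ?I (\<mu> * \<xi>) \<eta>) \<partial>lborel)"
      by (simp only:)
    also have "\<dots> = exp (- (\<xi>\<^sup>2 * v1 / 2)) / 2 * ((\<integral>\<eta>. ?I (- (\<mu> * \<xi>)) \<eta> \<partial>lborel) - (\<integral>\<eta>. ?I (\<mu> * \<xi>) \<eta> \<partial>lborel))"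
      using has_bochner_integral_linear_gaussian[OF V(2), of "- (\<mu> * \<xi>)"] has_bochner_integral_linear_gaussian[OF V(2), of "\<mu> * \<xi>"]
      unfolding integral_mult_right_zero
      by (subst Bochner_Integration.integral_diff) (auto simp: has_bochner_integral_iff)
    also have "\<dots> = exp (- (\<xi>\<^sup>2 * v1 / 2)) * ((\<mu> * \<xi> / V2) * sqrt (2 * pi / V2) * exp ((\<mu> * \<xi>)\<^sup>2 / (2 * V2)))"
      unfolding has_bochner_integral_integral_eq[OF has_bochner_integral_linear_gaussian[OF V(2)]] by simp
    also have "\<dots> = (\<mu> * \<xi> / V2) * sqrt (2 * pi / V2) * (exp (- (\<xi>\<^sup>2 * v1 / 2)) * exp ((\<mu> * \<xi>)\<^sup>2 / (2 * V2)))"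
      by (simp only: mult_ac)
    also have "exp (- (\<xi>\<^sup>2 * v1 / 2)) * exp ((\<mu> * \<xi>)\<^sup>2 / (2 * V2)) = exp (- ((v1 - \<mu>\<^sup>2 / V2) * \<xi>\<^sup>2 / 2))"
      unfolding exp_add[symmetric] using V by (simp add: field_simps power_mult_distrib)
    finally show ?thesis .
  qed
  define A where "A = V1 - \<mu>\<^sup>2 / V2"
  have A: "0 < A"
  proof -
    \<comment> \<open>The second moment of \<open>V2 * X - \<mu> * Y\<close> gives Cauchy-Schwarz
      for possibly degenerate pairs; \<open>\<epsilon>\<close> and \<open>\<delta>\<close> make the
      resulting inequality for \<open>A\<close> strict.\<close>
    have "0 \<le> expectation (\<lambda>\<omega>. (V2 * X \<omega> + (- \<mu>) * Y \<omega>)\<^sup>2)" by simp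
    also have "\<dots> = V2\<^sup>2 * v1 - 2 * V2 * \<mu>\<^sup>2 + \<mu>\<^sup>2 * v2"
      unfolding gaussian_pair_quadratic v1_def v2_def \<mu>_def by (simp add: power2_eq_square)
    also have "\<dots> = V2\<^sup>2 * A - (V2\<^sup>2 * \<epsilon> + \<delta> * \<mu>\<^sup>2)"
      using V unfolding A_def V1_def by (simp add: power2_eq_square field_simps V2_def)
    finally have "V2\<^sup>2 * \<epsilon> + \<delta> * \<mu>\<^sup>2 \<le> V2\<^sup>2 * A" by simp
    moreover have "0 < V2\<^sup>2 * \<epsilon> + \<delta> * \<mu>\<^sup>2" using V \<epsilon> \<delta> by (intro add_pos_nonneg) auto
    ultimately have "0 < V2\<^sup>2 * A" by linarith
    then show ?thesis by (simp add: zero_less_mult_iff)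
  qed
  have "expectation (\<lambda>\<omega>. heat_kernel' \<delta> (Y \<omega>) * heat_kernel' \<epsilon> (X \<omega>)) =
    - (1 / (2 * pi)) * (\<integral>\<xi>. \<xi> * exp (- (\<epsilon> * \<xi>\<^sup>2 / 2)) * expectation (\<lambda>\<omega>. heat_kernel' \<delta> (Y \<omega>) * sin (\<xi> * X \<omega>)) \<partial>lborel)"
    using heat_kernel'_bounded[OF \<delta>] \<epsilon> by (intro expectation_heat_kernel'_fourier) auto
  also have "(\<lambda>\<xi>. expectation (\<lambda>\<omega>. heat_kernel' \<delta> (Y \<omega>) * sin (\<xi> * X \<omega>))) =
     (\<lambda>\<xi>. - (1 / (2 * pi)) * ((\<mu> * \<xi> / V2) * sqrt (2 * pi / V2) * exp (- ((v1 - \<mu>\<^sup>2 / V2) * \<xi>\<^sup>2 / 2))))"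
  proof
    fix \<xi>
    have "expectation (\<lambda>\<omega>. sin (\<xi> * X \<omega>) * heat_kernel' \<delta> (Y \<omega>)) =
      - (1 / (2 * pi)) * (\<integral>\<eta>. \<eta> * exp (- (\<delta> * \<eta>\<^sup>2 / 2)) * expectation (\<lambda>\<omega>. sin (\<xi> * X \<omega>) * sin (\<eta> * Y \<omega>)) \<partial>lborel)"
      using \<delta> by (intro expectation_heat_kernel'_fourier[where C = 1]) auto
    then show "expectation (\<lambda>\<omega>. heat_kernel' \<delta> (Y \<omega>) * sin (\<xi> * X \<omega>)) =
        - (1 / (2 * pi)) * ((\<mu> * \<xi> / V2) * sqrt (2 * pi / V2) * exp (- ((v1 - \<mu>\<^sup>2 / V2) * \<xi>\<^sup>2 / 2)))"
      unfolding inner by (simp only: mult.commute)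
  qed
  also have "(\<lambda>\<xi>. \<xi> * exp (- (\<epsilon> * \<xi>\<^sup>2 / 2)) * (- (1 / (2 * pi)) * ((\<mu> * \<xi> / V2) * sqrt (2 * pi / V2) * exp (- ((v1 - \<mu>\<^sup>2 / V2) * \<xi>\<^sup>2 / 2))))) =
     (\<lambda>\<xi>. - (1 / (2 * pi)) * (\<mu> / V2) * sqrt (2 * pi / V2) * (\<xi>\<^sup>2 * exp (- (A * \<xi>\<^sup>2 / 2))))"
  proof
    fix \<xi>
    have e: "exp (- (\<epsilon> * \<xi>\<^sup>2 / 2)) * exp (- ((v1 - \<mu>\<^sup>2 / V2) * \<xi>\<^sup>2 / 2)) = exp (- (A * \<xi>\<^sup>2 / 2))"
      unfolding exp_add[symmetric] A_def V1_def by (simp add: algebra_simps add_divide_distrib diff_divide_distrib)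
    show "\<xi> * exp (- (\<epsilon> * \<xi>\<^sup>2 / 2)) * (- (1 / (2 * pi)) * ((\<mu> * \<xi> / V2) * sqrt (2 * pi / V2) * exp (- ((v1 - \<mu>\<^sup>2 / V2) * \<xi>\<^sup>2 / 2)))) =
      - (1 / (2 * pi)) * (\<mu> / V2) * sqrt (2 * pi / V2) * (\<xi>\<^sup>2 * exp (- (A * \<xi>\<^sup>2 / 2)))"
      unfolding e[symmetric] by (simp add: power2_eq_square)
  qed
  also have "(\<integral>\<xi>. - (1 / (2 * pi)) * (\<mu> / V2) * sqrt (2 * pi / V2) * (\<xi>\<^sup>2 * exp (- (A * \<xi>\<^sup>2 / 2))) \<partial>lborel) =
     - (1 / (2 * pi)) * (\<mu> / V2) * sqrt (2 * pi / V2) * (sqrt (2 * pi) * A powr (- (3/2)))"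
    by (simp only: integral_mult_right_zero integral_square_gaussian[OF A])
  also have "- (1 / (2 * pi)) * \<dots> = \<mu> * (1 / (V2 * sqrt V2)) * A powr (- (3/2)) / (2 * pi)"
  proof -
    have "sqrt (2 * pi / V2) * sqrt (2 * pi) = 2 * pi / sqrt V2"
      by (simp add: real_sqrt_divide)
    then have "(1 / (2 * pi)) * ((1 / (2 * pi)) * (\<mu> / V2) * (sqrt (2 * pi / V2) * sqrt (2 * pi)) * A powr (- (3/2))) =
      \<mu> * (1 / (V2 * sqrt V2)) * A powr (- (3/2)) / (2 * pi)" by simp
    then show ?thesis by (simp only: mult_ac mult_minus_left mult_minus_right minus_minus)
  qed
  also have "1 / (V2 * sqrt V2) = V2 powr (- (3/2))"
  proof -
    have "V2 * sqrt V2 = V2 powr (3/2)"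
      using V powr_add[of V2 1 "1/2"] by (simp add: powr_half_sqrt)
    then show ?thesis by (simp add: powr_minus_divide)
  qed
  also have "\<mu> * V2 powr (- (3/2)) * A powr (- (3/2)) = \<mu> * (V2 * A) powr (- (3/2))"
    using V A by (simp add: powr_mult)
  also have "V2 * A = (\<epsilon> + v1) * (\<delta> + v2) - \<mu>\<^sup>2"
    using V unfolding A_def by (simp add: field_simps V1_def V2_def)
  finally show ?thesis by (simp only: mult.commute)
qed

end

end


text \<open>For large \<open>n\<close> the function \<open>- sqrt (2 * pi) * n powr (3/2) * heat_kernel' n\<close> is close to the identity.\<close>

lemma (in prob_space) expectation_heat_kernel'_linear:
  assumes XY: "gaussian_pair M X Y" and \<epsilon>: "0 < \<epsilon>"
  shows "expectation (\<lambda>\<omega>. heat_kernel' \<epsilon> (X \<omega>) * Y \<omega>) =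
    - (expectation (\<lambda>\<omega>. X \<omega> * Y \<omega>) * (\<epsilon> + expectation (\<lambda>\<omega>. (X \<omega>)\<^sup>2)) powr (- (3/2)) / sqrt (2 * pi))"
proof -
  note [measurable] = gaussian_pair_measurable[OF XY]
  define v1 v2 \<mu> where "v1 = expectation (\<lambda>\<omega>. (X \<omega>)\<^sup>2)" and "v2 = expectation (\<lambda>\<omega>. (Y \<omega>)\<^sup>2)"
    and "\<mu> = expectation (\<lambda>\<omega>. X \<omega> * Y \<omega>)"
  have v: "0 \<le> v1" "0 \<le> v2" by (simp_all add: v1_def v2_def)
  \<comment> \<open>The identity damped by a wide Gaussian: it converges to \<open>y\<close>, its
    absolute value is at most that of \<open>y\<close>, and it is a multiple of a kernel covered by
    the pair formula.\<close>
  define h where "h n y = - (sqrt (2 * pi) * real (Suc n) powr (3/2)) * heat_kernel' (real (Suc n)) y" for n y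
  have h: "h n y = y * exp (- (y\<^sup>2 / (2 * real (Suc n))))" for n y
  proof -
    have "(2 * pi * real (Suc n)) powr (- 1 / 2) = 1 / (sqrt (2 * pi) * real (Suc n) powr (1/2))"
      by (simp add: powr_minus_divide powr_mult powr_half_sqrt real_sqrt_mult flip: minus_divide_left)
    moreover have "real (Suc n) powr (3/2) = real (Suc n) * real (Suc n) powr (1/2)"
      using powr_add[of "real (Suc n)" 1 "1/2"] by simp
    ultimately show ?thesis
      by (simp add: h_def heat_kernel'_def heat_kernel_def del: of_nat_Suc)
  qed
  have m: "(\<lambda>\<omega>. heat_kernel' \<epsilon> (X \<omega>) * h n (Y \<omega>)) \<in> borel_measurable M" for n
    unfolding h_def by measurable
  obtain C where C: "\<And>x. \<bar>heat_kernel' \<epsilon> x\<bar> \<le> C" using heat_kernel'_bounded[OF \<epsilon>] by blast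
  have C0: "0 \<le> C" using C[of 0] by linarith
  have lim1: "(\<lambda>n. expectation (\<lambda>\<omega>. heat_kernel' \<epsilon> (X \<omega>) * h n (Y \<omega>))) \<longlonglongrightarrow> expectation (\<lambda>\<omega>. heat_kernel' \<epsilon> (X \<omega>) * Y \<omega>)"
  proof (rule integral_dominated_convergence[where w = "\<lambda>\<omega>. C * \<bar>Y \<omega>\<bar>"])
    show "integrable M (\<lambda>\<omega>. C * \<bar>Y \<omega>\<bar>)" using gaussian_pair_integrable[OF XY] by simp
    have "(\<lambda>n. y * exp (- (y\<^sup>2 / (2 * real (Suc n))))) \<longlonglongrightarrow> y" for y :: real
      by real_asymp
    then show "AE \<omega> in M. (\<lambda>n. heat_kernel' \<epsilon> (X \<omega>) * h n (Y \<omega>)) \<longlonglongrightarrow> heat_kernel' \<epsilon> (X \<omega>) * Y \<omega>"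
      unfolding h by (intro AE_I2 tendsto_mult_left)
    show "AE \<omega> in M. norm (heat_kernel' \<epsilon> (X \<omega>) * h n (Y \<omega>)) \<le> C * \<bar>Y \<omega>\<bar>" for n
      unfolding h using C C0 by (auto simp: abs_mult intro!: mult_mono mult_left_le AE_I2)
  qed (use m in measurable)
  have "expectation (\<lambda>\<omega>. heat_kernel' \<epsilon> (X \<omega>) * h n (Y \<omega>)) =
      - (\<mu> / sqrt (2 * pi)) * (((\<epsilon> + v1) * (real (Suc n) + v2) - \<mu>\<^sup>2) / real (Suc n)) powr (- (3/2))"
    if "0 < (\<epsilon> + v1) * (real (Suc n) + v2) - \<mu>\<^sup>2" for n
  proof -
    let ?D = "(\<epsilon> + v1) * (real (Suc n) + v2) - \<mu>\<^sup>2"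
    have "expectation (\<lambda>\<omega>. heat_kernel' \<epsilon> (X \<omega>) * h n (Y \<omega>)) =
      expectation (\<lambda>\<omega>. - (sqrt (2 * pi) * real (Suc n) powr (3/2)) * (heat_kernel' \<epsilon> (X \<omega>) * heat_kernel' (real (Suc n)) (Y \<omega>)))"
      unfolding h_def by (simp only: mult_ac)
    also have "\<dots> = - (sqrt (2 * pi) * real (Suc n) powr (3/2)) * (\<mu> * ?D powr (- (3/2)) / (2 * pi))"
      unfolding integral_mult_right_zero v1_def v2_def \<mu>_def
      by (subst expectation_heat_kernel'_pair[OF XY \<epsilon>]) (simp_all del: of_nat_Suc)
    also have "\<dots> = - (\<mu> * (sqrt (2 * pi) / (2 * pi))) * (?D powr (- (3/2)) * real (Suc n) powr (3/2))"
      by (simp del: of_nat_Suc)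
    also have "?D powr (- (3/2)) * real (Suc n) powr (3/2) = (?D / real (Suc n)) powr (- (3/2))"
      using that by (simp add: powr_divide powr_minus_divide del: of_nat_Suc)
    also have "sqrt (2 * pi) / (2 * pi) = 1 / sqrt (2 * pi)"
      by (simp add: field_simps)
    finally show ?thesis by simp
  qed
  moreover have "eventually (\<lambda>n. 0 < (\<epsilon> + v1) * (real (Suc n) + v2) - \<mu>\<^sup>2) sequentially"
  proof -
    have "0 < \<epsilon> + v1" using \<epsilon> v by simp
    then show ?thesis by real_asymp
  qed
  ultimately have ev: "eventually (\<lambda>n. expectation (\<lambda>\<omega>. heat_kernel' \<epsilon> (X \<omega>) * h n (Y \<omega>)) =
      - (\<mu> / sqrt (2 * pi)) * (((\<epsilon> + v1) * (real (Suc n) + v2) - \<mu>\<^sup>2) / real (Suc n)) powr (- (3/2))) sequentially"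
    by (auto elim: eventually_mono)
  have "(\<lambda>n. ((\<epsilon> + v1) * (real (Suc n) + v2) - \<mu>\<^sup>2) / real (Suc n)) \<longlonglongrightarrow> \<epsilon> + v1"
    by real_asymp
  then have "(\<lambda>n. - (\<mu> / sqrt (2 * pi)) * (((\<epsilon> + v1) * (real (Suc n) + v2) - \<mu>\<^sup>2) / real (Suc n)) powr (- (3/2)))
     \<longlonglongrightarrow> - (\<mu> / sqrt (2 * pi)) * (\<epsilon> + v1) powr (- (3/2))"
    using \<epsilon> v by (intro tendsto_mult_left tendsto_powr tendsto_const) auto
  with ev have "(\<lambda>n. expectation (\<lambda>\<omega>. heat_kernel' \<epsilon> (X \<omega>) * h n (Y \<omega>))) \<longlonglongrightarrow> - (\<mu> / sqrt (2 * pi)) * (\<epsilon> + v1) powr (- (3/2))"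
    by (simp add: tendsto_cong)
  from LIMSEQ_unique[OF lim1 this] show ?thesis by (simp add: v1_def \<mu>_def)
qed

section \<open>Increments of the process and convergence in law\<close>

lemma incr_cov_self: "s \<le> t \<Longrightarrow> incr_cov H s t s t = (t - s) powr (2*H)"
  by (simp add: incr_cov_def abs_minus_commute)

lemma incr_cov_nonneg:
  assumes "s1 \<le> t1" "s2 \<le> t2" "1 / 2 < H" "H < 1"
  shows "0 \<le> incr_cov H s1 t1 s2 t2"
proof -
  consider "t1 < s2" | "t2 < s1" | "s2 \<le> t1" "s1 \<le> t2" by linarith
  then show ?thesis
  proof cases
    case 1 then show ?thesis using disjoint_bounds(1)[of s1 t1 s2 t2 H] assms by simp
  next
    case 2 then show ?thesis using disjoint_bounds(1)[of s2 t2 s1 t1 H] assms incr_cov_commute by metis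
  next
    case 3 then show ?thesis using overlap_bounds[of s1 t1 s2 t2 H] assms by simp
  qed
qed

lemma gaussian_pair_increments:
  assumes "fractional_brownian_motion H M B" and t: "0 \<le> s1" "0 \<le> t1" "0 \<le> s2" "0 \<le> t2"
  shows "gaussian_pair M (\<lambda>\<omega>. B t1 \<omega> - B s1 \<omega>) (\<lambda>\<omega>. B t2 \<omega> - B s2 \<omega>)"
proof -
  have g: "centered_gaussian_process M B" using assms by (simp add: fractional_brownian_motion_def)
  then have m: "\<And>t. 0 \<le> t \<Longrightarrow> B t \<in> borel_measurable M" by (simp add: centered_gaussian_process_def)
  have "\<exists>\<gamma>\<ge>0. distr M borel (\<lambda>\<omega>. a * (B t1 \<omega> - B s1 \<omega>) + b * (B t2 \<omega> - B s2 \<omega>)) = centered_normal \<gamma>" for a b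
  proof -
    define A where "A = {t1, s1, t2, s2}"
    \<comment> \<open>The coefficients are accumulated because the four times need not be
      distinct.\<close>
    define c :: "real \<Rightarrow> real" where "c t = (if t = t1 then a else 0) - (if t = s1 then a else 0) + (if t = t2 then b else 0) - (if t = s2 then b else 0)" for t
    have "\<exists>\<gamma>\<ge>0. distr M borel (\<lambda>\<omega>. \<Sum>t\<in>A. c t * B t \<omega>) = centered_normal \<gamma>"
      using g t by (simp add: centered_gaussian_process_def A_def)
    moreover have "(\<Sum>t\<in>A. c t * B t \<omega>) = a * (B t1 \<omega> - B s1 \<omega>) + b * (B t2 \<omega> - B s2 \<omega>)" for \<omega>
    proof -
      have fin: "finite A" by (simp add: A_def)
      have d: "(\<Sum>t\<in>A. (if t = r then e else 0) * B t \<omega>) = e * B r \<omega>" if "r \<in> A" for r e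
      proof -
        have "(\<Sum>t\<in>A. (if t = r then e else 0) * B t \<omega>) = (\<Sum>t\<in>A. if t = r then e * B t \<omega> else 0)"
          by (intro sum.cong) auto
        then show ?thesis using that fin by (simp add: sum.delta)
      qed
      have "(\<Sum>t\<in>A. c t * B t \<omega>) = (\<Sum>t\<in>A. (if t = t1 then a else 0) * B t \<omega>) - (\<Sum>t\<in>A. (if t = s1 then a else 0) * B t \<omega>)
         + (\<Sum>t\<in>A. (if t = t2 then b else 0) * B t \<omega>) - (\<Sum>t\<in>A. (if t = s2 then b else 0) * B t \<omega>)"
        unfolding c_def by (simp only: left_diff_distrib distrib_right sum.distrib sum_subtractf)
      also have "\<dots> = a * B t1 \<omega> - a * B s1 \<omega> + b * B t2 \<omega> - b * B s2 \<omega>"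
        by (subst (1 2 3 4) d) (auto simp: A_def)
      finally show ?thesis by (simp add: algebra_simps)
    qed
    ultimately show ?thesis by simp
  qed
  then show ?thesis using m t by (auto simp: gaussian_pair_def)
qed

lemma fbm_increments:
  assumes B: "fractional_brownian_motion H M B" and t: "0 \<le> s1" "0 \<le> t1" "0 \<le> s2" "0 \<le> t2"
  shows "(\<integral>\<omega>. (B t1 \<omega> - B s1 \<omega>) * (B t2 \<omega> - B s2 \<omega>) \<partial>M) = incr_cov H s1 t1 s2 t2"
proof -
  interpret prob_space M using B by (simp add: fractional_brownian_motion_def centered_gaussian_process_def)
  have g: "centered_gaussian_process M B" using assms by (simp add: fractional_brownian_motion_def)
  then have m: "\<And>t. 0 \<le> t \<Longrightarrow> B t \<in> borel_measurable M" by (simp add: centered_gaussian_process_def)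
  have cov: "(\<integral>\<omega>. B t \<omega> * B s \<omega> \<partial>M) = (t powr (2 * H) + s powr (2 * H) - \<bar>t - s\<bar> powr (2 * H)) / 2"
    if "0 \<le> t" "0 \<le> s" for t s using B that by (simp add: fractional_brownian_motion_def)
  have sq: "integrable M (\<lambda>\<omega>. (B t \<omega>)\<^sup>2)" if "0 \<le> t" for t
  proof -
    have "\<And>A a. finite A \<Longrightarrow> A \<subseteq> {0..} \<Longrightarrow> \<exists>\<gamma>\<ge>0. distr M borel (\<lambda>\<omega>. \<Sum>t\<in>A. a t * B t \<omega>) = centered_normal \<gamma>"
      using g by (simp add: centered_gaussian_process_def)
    from this[of "{t}" "\<lambda>_. 1"] that obtain \<gamma> where "0 \<le> \<gamma>" "distr M borel (B t) = centered_normal \<gamma>"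
      by auto
    then show ?thesis using centered_normal_rv(1)[OF m[OF that]] by simp
  qed
  have int: "integrable M (\<lambda>\<omega>. B t \<omega> * B s \<omega>)" if "0 \<le> t" "0 \<le> s" for t s
  proof (rule Bochner_Integration.integrable_bound)
    show "integrable M (\<lambda>\<omega>. (B t \<omega>)\<^sup>2 + (B s \<omega>)\<^sup>2)" using sq that by simp
    show "(\<lambda>\<omega>. B t \<omega> * B s \<omega>) \<in> borel_measurable M" using m that by simp
    show "AE \<omega> in M. norm (B t \<omega> * B s \<omega>) \<le> norm ((B t \<omega>)\<^sup>2 + (B s \<omega>)\<^sup>2)"
    proof (rule AE_I2)
      fix \<omega>
      have "0 \<le> (\<bar>B t \<omega>\<bar> - \<bar>B s \<omega>\<bar>)\<^sup>2" "0 \<le> \<bar>B t \<omega>\<bar> * \<bar>B s \<omega>\<bar>" by auto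
      moreover have "(\<bar>B t \<omega>\<bar> - \<bar>B s \<omega>\<bar>)\<^sup>2 = (B t \<omega>)\<^sup>2 + (B s \<omega>)\<^sup>2 - 2 * (\<bar>B t \<omega>\<bar> * \<bar>B s \<omega>\<bar>)"
        by (simp add: power2_diff mult.assoc)
      ultimately have "\<bar>B t \<omega>\<bar> * \<bar>B s \<omega>\<bar> \<le> (B t \<omega>)\<^sup>2 + (B s \<omega>)\<^sup>2" by linarith
      then show "norm (B t \<omega> * B s \<omega>) \<le> norm ((B t \<omega>)\<^sup>2 + (B s \<omega>)\<^sup>2)"
        by (simp add: abs_mult)
    qed
  qed
  have "(\<lambda>\<omega>. (B t1 \<omega> - B s1 \<omega>) * (B t2 \<omega> - B s2 \<omega>)) =
     (\<lambda>\<omega>. B t1 \<omega> * B t2 \<omega> - B t1 \<omega> * B s2 \<omega> - B s1 \<omega> * B t2 \<omega> + B s1 \<omega> * B s2 \<omega>)"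
    by (simp add: fun_eq_iff algebra_simps)
  then have "(\<integral>\<omega>. (B t1 \<omega> - B s1 \<omega>) * (B t2 \<omega> - B s2 \<omega>) \<partial>M) =
     (\<integral>\<omega>. B t1 \<omega> * B t2 \<omega> \<partial>M) - (\<integral>\<omega>. B t1 \<omega> * B s2 \<omega> \<partial>M) - (\<integral>\<omega>. B s1 \<omega> * B t2 \<omega> \<partial>M) + (\<integral>\<omega>. B s1 \<omega> * B s2 \<omega> \<partial>M)"
    using int t by simp
  also have "\<dots> = incr_cov H s1 t1 s2 t2"
    using t by (simp add: cov incr_cov_def) (simp add: field_simps)
  finally show ?thesis .
qed

text \<open>\<open>Z\<close> is only assumed integrable, so that it may be an unbounded increment
  or, when a square is expanded, the time integral itself.\<close>

lemma (in prob_space) expectation_integral_swap: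
  fixes g :: "'b \<Rightarrow> 'a \<Rightarrow> real"
  assumes L: "sigma_finite_measure L" and D[measurable]: "D \<in> sets L" and fin: "emeasure L D < \<infinity>"
    and [measurable]: "case_prod g \<in> borel_measurable (L \<Otimes>\<^sub>M M)"
    and g: "\<And>x \<omega>. x \<in> space L \<Longrightarrow> \<omega> \<in> space M \<Longrightarrow> \<bar>g x \<omega>\<bar> \<le> C * indicator D x"
    and Z: "integrable M Z"
  shows "integrable L (\<lambda>x. expectation (\<lambda>\<omega>. g x \<omega> * Z \<omega>))"
    "expectation (\<lambda>\<omega>. (\<integral>x. g x \<omega> \<partial>L) * Z \<omega>) = (\<integral>x. expectation (\<lambda>\<omega>. g x \<omega> * Z \<omega>) \<partial>L)"
    "integrable M (\<lambda>\<omega>. (\<integral>x. g x \<omega> \<partial>L) * Z \<omega>)"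
proof -
  interpret L: sigma_finite_measure L by fact
  interpret P: pair_sigma_finite L M ..
  have [measurable]: "Z \<in> borel_measurable M" using Z by simp
  have iD: "integrable L (indicator D :: 'b \<Rightarrow> real)" using D fin by (intro integrable_real_indicator) auto
  have int: "integrable (L \<Otimes>\<^sub>M M) (\<lambda>(x, \<omega>). g x \<omega> * Z \<omega>)"
  proof (rule Bochner_Integration.integrable_bound)
    show "integrable (L \<Otimes>\<^sub>M M) (\<lambda>(x, \<omega>). C * indicator D x * \<bar>Z \<omega>\<bar>)"
      by (rule P.Fubini_integrable)
         (use Z iD in \<open>auto simp: case_prod_beta abs_mult intro!: AE_I2\<close>)
    show "AE z in L \<Otimes>\<^sub>M M. norm (case z of (x, \<omega>) \<Rightarrow> g x \<omega> * Z \<omega>) \<le> norm (case z of (x, \<omega>) \<Rightarrow> C * indicator D x * \<bar>Z \<omega>\<bar>)"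
    proof (rule AE_I2)
      fix z assume "z \<in> space (L \<Otimes>\<^sub>M M)"
      then obtain x \<omega> where z: "z = (x, \<omega>)" "x \<in> space L" "\<omega> \<in> space M"
        by (auto simp: space_pair_measure)
      have "\<bar>g x \<omega>\<bar> * \<bar>Z \<omega>\<bar> \<le> \<bar>C * indicator D x\<bar> * \<bar>Z \<omega>\<bar>"
        using g[OF z(2,3)] by (intro mult_right_mono) auto
      then show "norm (case z of (x, \<omega>) \<Rightarrow> g x \<omega> * Z \<omega>) \<le> norm (case z of (x, \<omega>) \<Rightarrow> C * indicator D x * \<bar>Z \<omega>\<bar>)"
        by (simp add: z abs_mult)
    qed
  qed measurable
  show "integrable L (\<lambda>x. expectation (\<lambda>\<omega>. g x \<omega> * Z \<omega>))"
    using P.integrable_fst'[OF int] by simp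
  show "expectation (\<lambda>\<omega>. (\<integral>x. g x \<omega> \<partial>L) * Z \<omega>) = (\<integral>x. expectation (\<lambda>\<omega>. g x \<omega> * Z \<omega>) \<partial>L)"
    using P.Fubini_integral[OF int] by simp
  show "integrable M (\<lambda>\<omega>. (\<integral>x. g x \<omega> \<partial>L) * Z \<omega>)"
    using P.integrable_snd[OF int] by simp
qed

text \<open>A non-integrable function has Bochner integral 0, so the bound can be used before
  integrability of the covariance kernel is known.\<close>

lemma ennreal_integral_le_nn_integral:
  assumes "\<And>x. 0 \<le> f x"
  shows "ennreal (integral\<^sup>L M f) \<le> (\<integral>\<^sup>+x. ennreal (f x) \<partial>M)"
proof (cases "integrable M f")
  case True
  then show ?thesis using assms by (simp add: nn_integral_eq_integral)
qed (simp add: not_integrable_integral_eq)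

text \<open>Off the event that \<open>X i\<close> and \<open>Z\<close> differ by at least
  \<open>r\<close>, \<open>Z <= x - r\<close> implies \<open>X i <= x\<close>, which implies
  \<open>Z <= x + r\<close>. Chebyshev's inequality makes this event unlikely, and continuity of the
  limiting distribution function at \<open>x\<close> absorbs the shift by \<open>r\<close>.\<close>

lemma (in prob_space) converges_in_law_of_L2:
  fixes X :: "'i \<Rightarrow> 'a \<Rightarrow> real"
  assumes X: "\<forall>\<^sub>F i in F. X i \<in> borel_measurable M" and Z[measurable]: "Z \<in> borel_measurable M"
    and int: "\<forall>\<^sub>F i in F. integrable M (\<lambda>\<omega>. (X i \<omega> - Z \<omega>)\<^sup>2)"
    and lim: "((\<lambda>i. expectation (\<lambda>\<omega>. (X i \<omega> - Z \<omega>)\<^sup>2)) \<longlongrightarrow> 0) F"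
  shows "converges_in_law M X (distr M borel Z) F"
  unfolding converges_in_law_def
proof (intro conjI allI impI X)
  fix x assume cont: "isCont (cdf (distr M borel Z)) x"
  have cdf: "cdf (distr M borel Y) y = prob {\<omega> \<in> space M. Y \<omega> \<le> y}" if "Y \<in> borel_measurable M" for Y y
    using that by (simp add: cdf_def measure_distr vimage_def Int_def conj_commute)
  show "((\<lambda>i. cdf (distr M borel (X i)) x) \<longlongrightarrow> cdf (distr M borel Z) x) F"
  proof (rule tendstoI)
    fix e :: real assume e: "0 < e"
    from cont have "\<exists>d>0. \<forall>y. dist y x < d \<longrightarrow> dist (cdf (distr M borel Z) y) (cdf (distr M borel Z) x) < e / 2"
      using e unfolding continuous_at_eps_delta by (meson half_gt_zero)
    then obtain d where d: "0 < d" "\<And>y. dist y x < d \<Longrightarrow> dist (cdf (distr M borel Z) y) (cdf (distr M borel Z) x) < e / 2"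
      by blast
    define r where "r = d / 2"
    have r: "0 < r" using d by (simp add: r_def)
    have near: "\<bar>cdf (distr M borel Z) (x + r) - cdf (distr M borel Z) x\<bar> < e / 2"
      "\<bar>cdf (distr M borel Z) (x - r) - cdf (distr M borel Z) x\<bar> < e / 2"
      using d(2)[of "x + r"] d(2)[of "x - r"] d(1) by (simp_all add: r_def dist_real_def)
    have "\<forall>\<^sub>F i in F. expectation (\<lambda>\<omega>. (X i \<omega> - Z \<omega>)\<^sup>2) < e / 2 * r\<^sup>2"
      using lim e r by (intro order_tendstoD) auto
    with X int show "\<forall>\<^sub>F i in F. dist (cdf (distr M borel (X i)) x) (cdf (distr M borel Z) x) < e"
    proof eventually_elim
      case (elim i)
      note [measurable] = elim(1)
      let ?A = "{\<omega> \<in> space M. r\<^sup>2 \<le> (X i \<omega> - Z \<omega>)\<^sup>2}"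
      have "prob ?A \<le> expectation (\<lambda>\<omega>. (X i \<omega> - Z \<omega>)\<^sup>2) / r\<^sup>2"
        using elim r by (intro integral_Markov_inequality_measure[where A = "{}"]) auto
      also have "\<dots> < e / 2" using elim r by (simp add: field_simps)
      finally have A: "prob ?A < e / 2" .
      have "prob {\<omega> \<in> space M. X i \<omega> \<le> x} \<le> prob ({\<omega> \<in> space M. Z \<omega> \<le> x + r} \<union> ?A)"
      proof (rule finite_measure_mono)
        show "{\<omega> \<in> space M. X i \<omega> \<le> x} \<subseteq> {\<omega> \<in> space M. Z \<omega> \<le> x + r} \<union> ?A"
        proof
          fix \<omega> assume "\<omega> \<in> {\<omega> \<in> space M. X i \<omega> \<le> x}"
          then have w: "\<omega> \<in> space M" "X i \<omega> \<le> x" by auto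
          show "\<omega> \<in> {\<omega> \<in> space M. Z \<omega> \<le> x + r} \<union> ?A"
          proof (cases "Z \<omega> \<le> x + r")
            case False
            then have "r\<^sup>2 \<le> (Z \<omega> - X i \<omega>)\<^sup>2" using w r by (intro power_mono) auto
            then show ?thesis using w by (simp add: power2_commute)
          qed (use w in auto)
        qed
      qed measurable
      also have "\<dots> \<le> prob {\<omega> \<in> space M. Z \<omega> \<le> x + r} + prob ?A"
        by (rule measure_Un_le) measurable
      finally have up: "prob {\<omega> \<in> space M. X i \<omega> \<le> x} \<le> prob {\<omega> \<in> space M. Z \<omega> \<le> x + r} + prob ?A" .
      have "prob {\<omega> \<in> space M. Z \<omega> \<le> x - r} \<le> prob ({\<omega> \<in> space M. X i \<omega> \<le> x} \<union> ?A)"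
      proof (rule finite_measure_mono)
        show "{\<omega> \<in> space M. Z \<omega> \<le> x - r} \<subseteq> {\<omega> \<in> space M. X i \<omega> \<le> x} \<union> ?A"
        proof
          fix \<omega> assume "\<omega> \<in> {\<omega> \<in> space M. Z \<omega> \<le> x - r}"
          then have w: "\<omega> \<in> space M" "Z \<omega> \<le> x - r" by auto
          show "\<omega> \<in> {\<omega> \<in> space M. X i \<omega> \<le> x} \<union> ?A"
          proof (cases "X i \<omega> \<le> x")
            case False
            then have "r\<^sup>2 \<le> (X i \<omega> - Z \<omega>)\<^sup>2" using w r by (intro power_mono) auto
            then show ?thesis using w by simp
          qed (use w in auto)
        qed
      qed measurable
      also have "\<dots> \<le> prob {\<omega> \<in> space M. X i \<omega> \<le> x} + prob ?A"
        by (rule measure_Un_le) measurable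
      finally have lo: "prob {\<omega> \<in> space M. Z \<omega> \<le> x - r} \<le> prob {\<omega> \<in> space M. X i \<omega> \<le> x} + prob ?A" .
      show ?case
        using near up lo A unfolding cdf[OF elim(1)] cdf[OF Z] dist_real_def by linarith
    qed
  qed
qed


section \<open>Moments of the approximations\<close>

text \<open>Dropping \<epsilon> bounds the mass beyond \<open>\<eta>\<close> by the integral of
  \<open>u powr (1 - 3*H)\<close>, finite as \<open>3*H > 2\<close>. This bound does not depend on
  \<epsilon>, whereas the total mass diverges as \<epsilon> tends to 0; hence the concentration at
  small lengths.\<close>

lemma power_kernel_integral_truncated:
  fixes H \<epsilon> \<eta> :: real
  assumes H: "2 / 3 < H" "H < 1" and \<epsilon>: "0 < \<epsilon>" and \<eta>: "0 < \<eta>"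
  shows "ennreal (\<epsilon> powr (1/H - 3/2) * (Beta (1/H) (3/2 - 1/H) / (2*H)) - \<eta> powr (2 - 3*H) / (3*H - 2))
    \<le> (\<integral>\<^sup>+u. ennreal (u * (\<epsilon> + u powr (2*H)) powr (- (3/2))) * indicator {0<..\<eta>} u \<partial>lborel)"
proof -
  let ?w = "\<lambda>u. u * (\<epsilon> + u powr (2*H)) powr (- (3/2))"
  have "ennreal (\<epsilon> powr (1/H - 3/2) * (Beta (1/H) (3/2 - 1/H) / (2*H))) = power_kernel_integral (2*H) 1 (3/2) \<epsilon>"
  proof -
    have "(1 + 1) / (2*H) = 1/H" "2 / (2*H) = 1/H" by simp_all
    then show ?thesis
      using power_kernel_integral_scale[of \<epsilon> "2*H" 1 "3/2"] power_kernel_integral_Beta[of "2*H"] H \<epsilon>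
      by (simp only: ennreal_mult' powr_ge_zero)
  qed
  also have "\<dots> \<le> (\<integral>\<^sup>+u. ennreal (?w u) * indicator {0<..\<eta>} u + ennreal (u powr (1 - 3*H)) * indicator {\<eta>..} u \<partial>lborel)"
    unfolding power_kernel_integral_def
  proof (intro nn_integral_mono)
    fix u :: real
    show "ennreal (u powr 1 * (\<epsilon> + u powr (2*H)) powr (- (3/2))) * indicator {0<..} u
       \<le> ennreal (?w u) * indicator {0<..\<eta>} u + ennreal (u powr (1 - 3*H)) * indicator {\<eta>..} u"
    proof (cases "0 < u \<and> \<eta> < u")
      case True
      have "(\<epsilon> + u powr (2*H)) powr (- (3/2)) \<le> (u powr (2*H)) powr (- (3/2))"
        using \<epsilon> True by (intro powr_mono2') auto
      also have "\<dots> = u powr (- (3*H))" by (simp add: powr_powr)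
      finally have "u powr 1 * (\<epsilon> + u powr (2*H)) powr (- (3/2)) \<le> u powr 1 * u powr (- (3*H))"
        by (intro mult_left_mono) auto
      also have "\<dots> = u powr (1 - 3*H)" by (simp only: powr_add[symmetric]) simp
      finally show ?thesis using True by (simp add: ennreal_leI)
    qed (auto simp: indicator_def add_increasing2)
  qed
  also have "\<dots> = (\<integral>\<^sup>+u. ennreal (?w u) * indicator {0<..\<eta>} u \<partial>lborel) + (\<integral>\<^sup>+u. ennreal (u powr (1 - 3*H)) * indicator {\<eta>..} u \<partial>lborel)"
    by (intro nn_integral_add) auto
  also have "(\<integral>\<^sup>+u. ennreal (u powr (1 - 3*H)) * indicator {\<eta>..} u \<partial>lborel) = ennreal (- (\<eta> powr (1 - 3*H + 1)) / (1 - 3*H + 1))"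
    using H \<eta> by (intro nn_integral_has_integral_lebesgue' has_integral_powr_to_inf) auto
  also have "- (\<eta> powr (1 - 3*H + 1)) / (1 - 3*H + 1) = \<eta> powr (2 - 3*H) / (3*H - 2)"
    using H by (simp add: field_simps)
  finally show ?thesis
    using H by (simp add: ennreal_minus[symmetric] ennreal_minus_le_iff add.commute)
qed

text \<open>Convexity of the power \<open>2*H\<close> bounds the covariance from below by
  \<open>H * (t - s) * (s powr (2*H-1) + (T - t) powr (2*H-1))\<close>. Each summand involves one
  endpoint only, so a shift separates it from the length, and the two contribute equally.\<close>

lemma cross_integral_ge:
  fixes H \<epsilon> \<eta> T :: real
  assumes H: "2 / 3 < H" "H < 1" and \<epsilon>: "0 < \<epsilon>" and \<eta>: "0 < \<eta>" "\<eta> < T"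
  shows "ennreal ((T - \<eta>) powr (2*H) * (\<epsilon> powr (1/H - 3/2) * (Beta (1/H) (3/2 - 1/H) / (2*H)) - \<eta> powr (2 - 3*H) / (3*H - 2)))
    \<le> (\<integral>\<^sup>+t. \<integral>\<^sup>+s. ennreal ((\<epsilon> + (t - s) powr (2*H)) powr (- (3/2)) * incr_cov H s t 0 T) * indicator (time_triangle T) (t, s) \<partial>lborel \<partial>lborel)"
proof -
  define f where "f u = ennreal (u * (\<epsilon> + u powr (2*H)) powr (- (3/2))) * indicator {0<..\<eta>} u" for u
  \<comment> \<open>The cut-offs in \<open>g1\<close> and \<open>g2\<close> guarantee that an
    interval of length at most \<open>\<eta>\<close> starting at \<open>s\<close>, or ending at
    \<open>t\<close>, stays inside \<open>[0, T]\<close>.\<close>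
  define g1 where "g1 s = ennreal (H * s powr (2*H-1)) * indicator {0..T - \<eta>} s" for s
  define g2 where "g2 t = ennreal (H * (T - t) powr (2*H-1)) * indicator {\<eta>..T} t" for t
  have [measurable]: "f \<in> borel_measurable borel" "g1 \<in> borel_measurable borel" "g2 \<in> borel_measurable borel"
    unfolding f_def g1_def g2_def by measurable
  have pw: "f (t - s) * g1 s + f (t - s) * g2 t \<le>
      ennreal ((\<epsilon> + (t - s) powr (2*H)) powr (- (3/2)) * incr_cov H s t 0 T) * indicator (time_triangle T) (t, s)" for t s
  proof (cases "0 < t - s \<and> t - s \<le> \<eta> \<and> (s \<in> {0..T - \<eta>} \<or> t \<in> {\<eta>..T})")
    case True
    then have u: "0 < t - s" "0 \<le> s" "t \<le> T" by auto
    let ?w = "(\<epsilon> + (t - s) powr (2*H)) powr (- (3/2))"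
    have "2*H * (t - s) * s powr (2*H-1) \<le> t powr (2*H) - s powr (2*H)"
      using u H by (intro powr_diff_le(1)) auto
    moreover have "2*H * ((T - s) - (T - t)) * (T - t) powr (2*H-1) \<le> (T - s) powr (2*H) - (T - t) powr (2*H)"
      using u H by (intro powr_diff_le(1)) auto
    moreover have "2 * incr_cov H s t 0 T = (t powr (2*H) - s powr (2*H)) + ((T - s) powr (2*H) - (T - t) powr (2*H))"
      using u by (simp add: incr_cov_def abs_minus_commute)
    ultimately have "(t - s) * (H * s powr (2*H-1) + H * (T - t) powr (2*H-1)) \<le> incr_cov H s t 0 T"
      by (simp add: algebra_simps)
    then have le: "?w * ((t - s) * (H * s powr (2*H-1) + H * (T - t) powr (2*H-1))) \<le> ?w * incr_cov H s t 0 T"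
      by (intro mult_left_mono) auto
    have "f (t - s) * g1 s + f (t - s) * g2 t \<le>
        ennreal ((t - s) * ?w) * ennreal (H * s powr (2*H-1)) + ennreal ((t - s) * ?w) * ennreal (H * (T - t) powr (2*H-1))"
      by (intro add_mono mult_mono) (auto simp: f_def g1_def g2_def indicator_def)
    also have "\<dots> = ennreal (?w * ((t - s) * (H * s powr (2*H-1) + H * (T - t) powr (2*H-1))))"
    proof -
      have "ennreal (u * w) * ennreal a + ennreal (u * w) * ennreal b = ennreal (w * (u * (a + b)))"
        if "0 \<le> u" "0 \<le> w" "0 \<le> a" "0 \<le> b" for u w a b
        using that by (simp add: ennreal_mult distrib_left mult_ac)
      then show ?thesis using u H by simp
    qed
    also have "\<dots> \<le> ennreal (?w * incr_cov H s t 0 T)" by (rule ennreal_leI[OF le])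
    also have "\<dots> = ennreal (?w * incr_cov H s t 0 T) * indicator (time_triangle T) (t, s)"
      using u by (simp add: time_triangle_def)
    finally show ?thesis .
  next
    case False
    then have "f (t - s) * g1 s = 0" "f (t - s) * g2 t = 0"
      by (auto simp: f_def g1_def g2_def indicator_def)
    then show ?thesis by (simp only: add_0 zero_le)
  qed
  have shift: "(\<integral>\<^sup>+t. f (t - s) \<partial>lborel) = integral\<^sup>N lborel f" "(\<integral>\<^sup>+s. f (t - s) \<partial>lborel) = integral\<^sup>N lborel f" for s t
    using nn_integral_real_affine[of f 1 "-s"] nn_integral_real_affine[of f "-1" t] by auto
  have I1: "integral\<^sup>N lborel g1 = ennreal ((T - \<eta>) powr (2*H) / 2)"
  proof -
    have "((\<lambda>s. H * s powr (2*H-1)) has_integral (H * ((T - \<eta>) powr (2*H-1+1) / (2*H-1+1)))) {0..T - \<eta>}"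
      using H \<eta> by (intro has_integral_mult_right has_integral_powr_from_0) auto
    from nn_integral_has_integral_lebesgue'[OF _ this] show ?thesis
      using H by (simp add: g1_def[abs_def])
  qed
  have I2: "integral\<^sup>N lborel g2 = integral\<^sup>N lborel g1"
    using nn_integral_real_affine[of g2 "-1" T] unfolding g1_def g2_def
    by (auto simp: indicator_def intro!: nn_integral_cong)
  have "ennreal ((T - \<eta>) powr (2*H) * (\<epsilon> powr (1/H - 3/2) * (Beta (1/H) (3/2 - 1/H) / (2*H)) - \<eta> powr (2 - 3*H) / (3*H - 2)))
      = ennreal ((T - \<eta>) powr (2*H)) * ennreal (\<epsilon> powr (1/H - 3/2) * (Beta (1/H) (3/2 - 1/H) / (2*H)) - \<eta> powr (2 - 3*H) / (3*H - 2))"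
    by (rule ennreal_mult') simp
  also have "\<dots> \<le> ennreal ((T - \<eta>) powr (2*H)) * integral\<^sup>N lborel f"
    unfolding f_def using power_kernel_integral_truncated[OF H \<epsilon> \<eta>(1)] by (intro mult_left_mono) auto
  also have "\<dots> = integral\<^sup>N lborel f * integral\<^sup>N lborel g1 + integral\<^sup>N lborel f * integral\<^sup>N lborel g2"
  proof -
    have "ennreal ((T - \<eta>) powr (2*H)) = ennreal ((T - \<eta>) powr (2*H) / 2) + ennreal ((T - \<eta>) powr (2*H) / 2)"
      by (subst ennreal_plus[symmetric]) auto
    then show ?thesis unfolding I2 I1 by (simp only: distrib_right distrib_left mult.commute)
  qed
  also have "integral\<^sup>N lborel f * integral\<^sup>N lborel g1 = (\<integral>\<^sup>+s. \<integral>\<^sup>+t. f (t - s) * g1 s \<partial>lborel \<partial>lborel)"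
    by (simp add: nn_integral_multc shift nn_integral_cmult)
  also have "\<dots> = (\<integral>\<^sup>+t. \<integral>\<^sup>+s. f (t - s) * g1 s \<partial>lborel \<partial>lborel)"
    by (rule lborel_pair.Fubini') measurable
  also have "integral\<^sup>N lborel f * integral\<^sup>N lborel g2 = (\<integral>\<^sup>+t. \<integral>\<^sup>+s. f (t - s) * g2 t \<partial>lborel \<partial>lborel)"
    by (simp add: nn_integral_multc shift nn_integral_cmult)
  also have "(\<integral>\<^sup>+t. \<integral>\<^sup>+s. f (t - s) * g1 s \<partial>lborel \<partial>lborel) + (\<integral>\<^sup>+t. \<integral>\<^sup>+s. f (t - s) * g2 t \<partial>lborel \<partial>lborel) =
      (\<integral>\<^sup>+t. \<integral>\<^sup>+s. f (t - s) * g1 s + f (t - s) * g2 t \<partial>lborel \<partial>lborel)"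
    by (simp add: nn_integral_add)
  also have "\<dots> \<le> (\<integral>\<^sup>+t. \<integral>\<^sup>+s. ennreal ((\<epsilon> + (t - s) powr (2*H)) powr (- (3/2)) * incr_cov H s t 0 T) * indicator (time_triangle T) (t, s) \<partial>lborel \<partial>lborel)"
    by (intro nn_integral_mono pw)
  finally show ?thesis .
qed


section \<open>The approximations as random variables and their moments\<close>

lemma measurable_incr_cov[measurable (raw)]:
  assumes [measurable]: "a \<in> borel_measurable N" "b \<in> borel_measurable N" "c \<in> borel_measurable N" "d \<in> borel_measurable N"
  shows "(\<lambda>x. incr_cov H (a x) (b x) (c x) (d x)) \<in> borel_measurable N"
  unfolding incr_cov_def by measurable

lemma measurable_self_intersection_kernel[measurable (raw)]:
  assumes [measurable]: "a \<in> borel_measurable N" "b \<in> borel_measurable N" "c \<in> borel_measurable N" "d \<in> borel_measurable N"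
  shows "(\<lambda>x. self_intersection_kernel H \<epsilon> (a x) (b x) (c x) (d x)) \<in> borel_measurable N"
  unfolding self_intersection_kernel_def by measurable

lemma emeasure_time_triangle: "emeasure (lborel \<Otimes>\<^sub>M lborel) (time_triangle T) < \<infinity>"
proof -
  have "emeasure (lborel \<Otimes>\<^sub>M lborel) (time_triangle T) \<le> emeasure (lborel \<Otimes>\<^sub>M lborel) ({0..T} \<times> {0..T})"
    by (rule emeasure_mono) (auto simp: time_triangle_def)
  also have "\<dots> = emeasure lborel {0..T} * emeasure lborel {0..T}"
    by (rule lborel.emeasure_pair_measure_Times) auto
  also have "\<dots> < \<infinity>" by (simp add: ennreal_mult_less_top emeasure_lborel_Icc_eq)
  finally show ?thesis .
qed

context
  fixes M :: "'a measure" and B :: "real \<Rightarrow> 'a \<Rightarrow> real" and H T \<epsilon> :: real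
  assumes T: "0 < T" and H: "2 / 3 < H" "H < 1"
    and B: "fractional_brownian_motion H M B" and BM: "measurable_process M B" and \<epsilon>: "0 < \<epsilon>"
begin

interpretation prob_space M
  using B by (simp add: fractional_brownian_motion_def centered_gaussian_process_def)

private abbreviation "L \<equiv> lborel \<Otimes>\<^sub>M lborel :: (real \<times> real) measure"

text \<open>The process is controlled at nonnegative times only; \<open>max 0\<close> makes the
  integrand jointly measurable over the whole plane, and the triangle removes the values thus
  added.\<close>

private definition g :: "real \<times> real \<Rightarrow> 'a \<Rightarrow> real" where
  "g x \<omega> = heat_kernel' \<epsilon> (B (max 0 (fst x)) \<omega> - B (max 0 (snd x)) \<omega>) * indicator (time_triangle T) x"

private lemma measurable_B[measurable (raw)]:
  assumes [measurable]: "a \<in> borel_measurable N" "b \<in> N \<rightarrow>\<^sub>M M"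
  shows "(\<lambda>x. B (max 0 (a x)) (b x)) \<in> borel_measurable N"
proof -
  have "(\<lambda>x. (max 0 (a x), b x)) \<in> N \<rightarrow>\<^sub>M restrict_space borel {0..} \<Otimes>\<^sub>M M"
    by (intro measurable_Pair measurable_restrict_space2) auto
  from measurable_compose[OF this BM[unfolded measurable_process_def]] show ?thesis by simp
qed

private lemma measurable_g[measurable]: "case_prod g \<in> borel_measurable (L \<Otimes>\<^sub>M M)"
  unfolding g_def by measurable

private lemma g_bound: "\<exists>C. \<forall>x \<omega>. \<bar>g x \<omega>\<bar> \<le> C * indicator (time_triangle T) x"
proof -
  obtain C where C: "\<And>x. \<bar>heat_kernel' \<epsilon> x\<bar> \<le> C" using heat_kernel'_bounded[OF \<epsilon>] by blast
  then show ?thesis by (intro exI[of _ C]) (auto simp: g_def abs_mult indicator_def)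
qed

private lemma sigma_finite_L: "sigma_finite_measure L"
  by (rule lborel_pair.sigma_finite_measure_axioms)

private lemma sets_D[measurable]: "time_triangle T \<in> sets L"
  using sets_time_triangle[of T] by simp

private lemma dslt_approx_eq:
  assumes \<omega>: "\<omega> \<in> space M"
  shows "dslt_approx B T \<epsilon> \<omega> = (\<integral>x. g x \<omega> \<partial>L)"
proof -
  obtain C where C: "\<And>x \<omega>. \<bar>g x \<omega>\<bar> \<le> C * indicator (time_triangle T) x" using g_bound by blast
  have "(\<lambda>x. g x \<omega>) \<in> borel_measurable L"
    using measurable_compose[OF measurable_Pair2'[OF \<omega>, of L] measurable_g] by simp
  moreover have "integrable L (\<lambda>x. C * indicator (time_triangle T) x)"
    using emeasure_time_triangle[of T] by (intro integrable_mult_right integrable_real_indicator) auto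
  ultimately have int: "integrable L (\<lambda>x. g x \<omega>)"
  proof (elim Bochner_Integration.integrable_bound[rotated], intro AE_I2)
    show "norm (g x \<omega>) \<le> norm (C * indicator (time_triangle T) x)" for x
      using order_trans[OF C abs_ge_self] by simp
  qed
  have "indicator {0..T} t *\<^sub>R (\<integral>s. indicator {0..t} s *\<^sub>R deriv (heat_kernel \<epsilon>) (B t \<omega> - B s \<omega>) \<partial>lborel) = (\<integral>s. g (t, s) \<omega> \<partial>lborel)" for t
  proof (cases "t \<in> {0..T}")
    case True
    then show ?thesis
      by (auto simp: deriv_heat_kernel[OF \<epsilon>] g_def time_triangle_def indicator_def
          intro!: Bochner_Integration.integral_cong)
  next
    case False
    then have "g (t, s) \<omega> = 0" for s by (auto simp: g_def time_triangle_def indicator_def)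
    then show ?thesis using False by simp
  qed
  then have "dslt_approx B T \<epsilon> \<omega> = (\<integral>t. \<integral>s. g (t, s) \<omega> \<partial>lborel \<partial>lborel)"
    unfolding dslt_approx_def set_lebesgue_integral_def by simp
  also have "\<dots> = (\<integral>x. g x \<omega> \<partial>L)"
    by (rule lborel_pair.integral_fst'[OF int])
  finally show ?thesis .
qed

lemma dslt_approx_measurable: "dslt_approx B T \<epsilon> \<in> borel_measurable M"
proof -
  have "(\<lambda>(\<omega>, x). g x \<omega>) \<in> borel_measurable (M \<Otimes>\<^sub>M L)"
    using measurable_pair_swap[OF measurable_g] by (simp add: case_prod_beta')
  then have "(\<lambda>\<omega>. \<integral>x. g x \<omega> \<partial>L) \<in> borel_measurable M"
    by (rule sigma_finite_measure.borel_measurable_lebesgue_integral[OF sigma_finite_L])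
  then show ?thesis by (subst measurable_cong[OF dslt_approx_eq])
qed

private lemma pair: "0 \<le> s \<Longrightarrow> 0 \<le> t \<Longrightarrow> 0 \<le> s' \<Longrightarrow> 0 \<le> t' \<Longrightarrow>
    gaussian_pair M (\<lambda>\<omega>. B t \<omega> - B s \<omega>) (\<lambda>\<omega>. B t' \<omega> - B s' \<omega>)"
  by (rule gaussian_pair_increments[OF B])

private lemma second_moment: "0 \<le> s \<Longrightarrow> s \<le> t \<Longrightarrow> expectation (\<lambda>\<omega>. (B t \<omega> - B s \<omega>)\<^sup>2) = (t - s) powr (2*H)"
  using fbm_increments[OF B, of s t s t] by (simp add: power2_eq_square incr_cov_self)

text \<open>Expectation and time integral are exchanged twice, first with the time integral itself
  as the random factor, then with the bounded variable \<open>g x\<close>.\<close>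

lemma dslt_approx_second_moment:
  "integrable M (\<lambda>\<omega>. (dslt_approx B T \<epsilon> \<omega>)\<^sup>2)"
  "ennreal (expectation (\<lambda>\<omega>. (dslt_approx B T \<epsilon> \<omega>)\<^sup>2)) \<le> ennreal (1 / (2 * pi)) *
    kernel_integral H T \<epsilon>"
proof -
  obtain C where C: "\<And>x \<omega>. \<bar>g x \<omega>\<bar> \<le> C * indicator (time_triangle T) x" using g_bound by blast
  note swap = expectation_integral_swap[OF sigma_finite_L sets_D emeasure_time_triangle measurable_g C]
  have mg: "g y \<in> borel_measurable M" for y
    using measurable_compose[OF measurable_Pair1' measurable_g, of y] by (simp add: space_pair_measure)
  have C0: "\<bar>g y \<omega>\<bar> \<le> \<bar>C\<bar>" for y \<omega>
    using C[of y \<omega>] by (cases "y \<in> time_triangle T") auto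
  have ig: "integrable M (g y)" for y
    using mg C0 by (intro integrable_const_bound[of _ "\<bar>C\<bar>"]) auto
  let ?a = "\<lambda>\<omega>. \<integral>x. g x \<omega> \<partial>L"
  have ia: "integrable M ?a" using swap(3)[of "\<lambda>_. 1"] by simp
  have sq: "(dslt_approx B T \<epsilon> \<omega>)\<^sup>2 = ?a \<omega> * ?a \<omega>" if "\<omega> \<in> space M" for \<omega>
    using dslt_approx_eq[OF that] by (simp add: power2_eq_square)
  show "integrable M (\<lambda>\<omega>. (dslt_approx B T \<epsilon> \<omega>)\<^sup>2)"
    using swap(3)[OF ia] by (subst Bochner_Integration.integrable_cong[OF refl sq])
  have val: "expectation (\<lambda>\<omega>. g y \<omega> * g x \<omega>) = 1 / (2 * pi) * (self_intersection_kernel H \<epsilon> (snd x) (fst x) (snd y) (fst y) *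
     (indicator (time_triangle T) x * indicator (time_triangle T) y))" for x y
  proof (cases "x \<in> time_triangle T \<and> y \<in> time_triangle T")
    case True
    obtain t1 s1 t2 s2 where xy: "x = (t1, s1)" "y = (t2, s2)" by (cases x, cases y)
    have t: "0 \<le> s1" "s1 \<le> t1" "0 \<le> s2" "s2 \<le> t2" using True by (auto simp: xy time_triangle_def)
    have "expectation (\<lambda>\<omega>. g y \<omega> * g x \<omega>) =
      expectation (\<lambda>\<omega>. heat_kernel' \<epsilon> (B t1 \<omega> - B s1 \<omega>) * heat_kernel' \<epsilon> (B t2 \<omega> - B s2 \<omega>))"
      using True t by (simp add: g_def xy mult.commute)
    also have "\<dots> = incr_cov H s1 t1 s2 t2 * ((\<epsilon> + (t1 - s1) powr (2*H)) * (\<epsilon> + (t2 - s2) powr (2*H)) - (incr_cov H s1 t1 s2 t2)\<^sup>2) powr (- (3/2)) / (2 * pi)"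
      using t by (subst expectation_heat_kernel'_pair[OF pair \<epsilon> \<epsilon>]) (simp_all add: second_moment fbm_increments[OF B])
    finally show ?thesis using True by (simp add: self_intersection_kernel_def xy)
  qed (auto simp: g_def)
  let ?K = "\<lambda>x y. self_intersection_kernel H \<epsilon> (snd x) (fst x) (snd y) (fst y) * (indicator (time_triangle T) x * indicator (time_triangle T) y)"
  define Kn :: "real \<times> real \<Rightarrow> real \<times> real \<Rightarrow> ennreal" where
    "Kn x y = ennreal (self_intersection_kernel H \<epsilon> (snd x) (fst x) (snd y) (fst y)) *
      (indicator (time_triangle T) x * indicator (time_triangle T) y)" for x y
  have inv2pi: "0 \<le> 1 / (2 * pi)" by simp
  have mK[measurable (raw)]: "(\<lambda>z. Kn (a z) (b z)) \<in> borel_measurable N"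
    if "a \<in> N \<rightarrow>\<^sub>M L" "b \<in> N \<rightarrow>\<^sub>M L" for a b and N :: "'n measure"
  proof -
    have "(N \<rightarrow>\<^sub>M L) = (N \<rightarrow>\<^sub>M borel \<Otimes>\<^sub>M borel)"
      by (intro measurable_cong_sets refl sets_pair_measure_cong sets_lborel)
    with that have [measurable]: "a \<in> N \<rightarrow>\<^sub>M borel \<Otimes>\<^sub>M borel" "b \<in> N \<rightarrow>\<^sub>M borel \<Otimes>\<^sub>M borel" by simp_all
    show ?thesis unfolding Kn_def by measurable
  qed
  have KL[measurable]: "Kn x \<in> borel_measurable L" for x
    by (rule mK[of "\<lambda>_. x" L "\<lambda>y. y"]) (auto simp: space_pair_measure)
  have KI[measurable]: "(\<lambda>x. \<integral>\<^sup>+y. Kn x y \<partial>L) \<in> borel_measurable L"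
    by (rule sigma_finite_measure.borel_measurable_nn_integral[OF sigma_finite_L]) (unfold case_prod_beta', intro mK measurable_fst measurable_snd)
  \<comment> \<open>Increments are nonnegatively correlated for \<open>H > 1/2\<close>; this sign
    permits the passage to nonnegative integrals.\<close>
  have K0: "0 \<le> 1 / (2 * pi) * ?K x y" for x y
  proof (cases "x \<in> time_triangle T \<and> y \<in> time_triangle T")
    case True
    then have "0 \<le> incr_cov H (snd x) (fst x) (snd y) (fst y)"
      using H by (intro incr_cov_nonneg) (auto simp: time_triangle_def)
    then show ?thesis by (simp add: self_intersection_kernel_def)
  qed auto
  have "expectation (\<lambda>\<omega>. (dslt_approx B T \<epsilon> \<omega>)\<^sup>2) = expectation (\<lambda>\<omega>. ?a \<omega> * ?a \<omega>)"
    by (intro Bochner_Integration.integral_cong refl sq)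
  also have "\<dots> = (\<integral>x. expectation (\<lambda>\<omega>. g x \<omega> * ?a \<omega>) \<partial>L)" by (rule swap(2)[OF ia])
  also have "\<dots> = (\<integral>x. \<integral>y. 1 / (2 * pi) * ?K x y \<partial>L \<partial>L)"
  proof (intro Bochner_Integration.integral_cong refl)
    fix x
    have "expectation (\<lambda>\<omega>. g x \<omega> * ?a \<omega>) = expectation (\<lambda>\<omega>. ?a \<omega> * g x \<omega>)" by (simp only: mult.commute)
    also have "\<dots> = (\<integral>y. expectation (\<lambda>\<omega>. g y \<omega> * g x \<omega>) \<partial>L)" by (rule swap(2)[OF ig])
    finally show "expectation (\<lambda>\<omega>. g x \<omega> * ?a \<omega>) = (\<integral>y. 1 / (2 * pi) * ?K x y \<partial>L)" unfolding val .
  qed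
  finally have eq: "expectation (\<lambda>\<omega>. (dslt_approx B T \<epsilon> \<omega>)\<^sup>2) = (\<integral>x. \<integral>y. 1 / (2 * pi) * ?K x y \<partial>L \<partial>L)" .
  have "ennreal (expectation (\<lambda>\<omega>. (dslt_approx B T \<epsilon> \<omega>)\<^sup>2)) \<le> (\<integral>\<^sup>+x. ennreal (\<integral>y. 1 / (2 * pi) * ?K x y \<partial>L) \<partial>L)"
    unfolding eq
  proof (rule ennreal_integral_le_nn_integral)
    show "0 \<le> (\<integral>y. 1 / (2 * pi) * ?K x y \<partial>L)" for x
      by (rule Bochner_Integration.integral_nonneg) (rule K0)
  qed
  also have "\<dots> \<le> (\<integral>\<^sup>+x. \<integral>\<^sup>+y. ennreal (1 / (2 * pi) * ?K x y) \<partial>L \<partial>L)"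
  proof (rule nn_integral_mono)
    show "ennreal (\<integral>y. 1 / (2 * pi) * ?K x y \<partial>L) \<le> (\<integral>\<^sup>+y. ennreal (1 / (2 * pi) * ?K x y) \<partial>L)" for x
      by (rule ennreal_integral_le_nn_integral) (rule K0)
  qed
  also have "\<dots> = (\<integral>\<^sup>+x. \<integral>\<^sup>+y. ennreal (1 / (2 * pi)) * Kn x y \<partial>L \<partial>L)"
  proof -
    have "ennreal (1 / (2 * pi) * ?K x y) = ennreal (1 / (2 * pi)) * Kn x y" for x y
    proof (cases "x \<in> time_triangle T \<and> y \<in> time_triangle T")
      case True
      then show ?thesis unfolding Kn_def by (simp only: indicator_simps mult_1_right ennreal_mult'[OF inv2pi])
    next
      case False
      then have "indicator (time_triangle T) x * indicator (time_triangle T) y = (0::real)"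
        "indicator (time_triangle T) x * indicator (time_triangle T) y = (0::ennreal)" by auto
      then show ?thesis unfolding Kn_def by (simp only: mult_zero_right ennreal_0)
    qed
    then show ?thesis by (simp only:)
  qed
  also have "\<dots> = ennreal (1 / (2 * pi)) * (\<integral>\<^sup>+x. \<integral>\<^sup>+y. Kn x y \<partial>L \<partial>L)"
  proof -
    have "(\<integral>\<^sup>+y. ennreal (1 / (2 * pi)) * Kn x y \<partial>L) = ennreal (1 / (2 * pi)) * (\<integral>\<^sup>+y. Kn x y \<partial>L)" for x
      by (rule nn_integral_cmult[OF KL])
    moreover have "(\<integral>\<^sup>+x. ennreal (1 / (2 * pi)) * (\<integral>\<^sup>+y. Kn x y \<partial>L) \<partial>L) = ennreal (1 / (2 * pi)) * (\<integral>\<^sup>+x. \<integral>\<^sup>+y. Kn x y \<partial>L \<partial>L)"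
      by (rule nn_integral_cmult[OF KI])
    ultimately show ?thesis by simp
  qed
  also have "(\<integral>\<^sup>+x. \<integral>\<^sup>+y. Kn x y \<partial>L \<partial>L) = (\<integral>\<^sup>+x. \<integral>\<^sup>+t2. \<integral>\<^sup>+s2. Kn x (t2, s2) \<partial>lborel \<partial>lborel \<partial>L)"
  proof (intro nn_integral_cong lborel.nn_integral_fst[symmetric])
    show "Kn x \<in> borel_measurable L" for x by (rule KL)
  qed
  also have "\<dots> = (nn_integral4 (\<lambda>t1 s1 t2 s2. Kn (t1, s1) (t2, s2)))"
    by (rule lborel.nn_integral_fst[symmetric]) measurable
  also have "\<dots> = kernel_integral H T \<epsilon>"
    by (simp only: Kn_def fst_conv snd_conv)
  finally show "ennreal (expectation (\<lambda>\<omega>. (dslt_approx B T \<epsilon> \<omega>)\<^sup>2)) \<le> ennreal (1 / (2 * pi)) *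
    kernel_integral H T \<epsilon>" .
qed

text \<open>The cross moment is at most 0, because \<open>heat_kernel'\<close> has the sign opposite
  to its argument. The factor \<open>- sqrt (2 * pi)\<close> makes it nonnegative, so that an
  inequality in \<open>ennreal\<close> can be read back as a real one.\<close>

lemma dslt_approx_cross_moment:
  "integrable M (\<lambda>\<omega>. dslt_approx B T \<epsilon> \<omega> * (B T \<omega> - B 0 \<omega>))"
  "ennreal (- sqrt (2 * pi) * expectation (\<lambda>\<omega>. dslt_approx B T \<epsilon> \<omega> * (B T \<omega> - B 0 \<omega>))) =
    (\<integral>\<^sup>+t. \<integral>\<^sup>+s. ennreal ((\<epsilon> + (t - s) powr (2*H)) powr (- (3/2)) * incr_cov H s t 0 T) * indicator (time_triangle T) (t, s) \<partial>lborel \<partial>lborel)"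
  "0 \<le> - sqrt (2 * pi) * expectation (\<lambda>\<omega>. dslt_approx B T \<epsilon> \<omega> * (B T \<omega> - B 0 \<omega>))"
proof -
  obtain C where C: "\<And>x \<omega>. \<bar>g x \<omega>\<bar> \<le> C * indicator (time_triangle T) x" using g_bound by blast
  let ?Z = "\<lambda>\<omega>. B T \<omega> - B 0 \<omega>"
  let ?Q = "\<lambda>x. (\<epsilon> + (fst x - snd x) powr (2*H)) powr (- (3/2)) * incr_cov H (snd x) (fst x) 0 T * indicator (time_triangle T) x"
  have iZ: "integrable M ?Z"
    using pair[of 0 T 0 T] T by (intro gaussian_pair_integrable(4)) auto
  note swap = expectation_integral_swap[OF sigma_finite_L sets_D emeasure_time_triangle measurable_g C iZ]
  have eq: "dslt_approx B T \<epsilon> \<omega> * ?Z \<omega> = (\<integral>x. g x \<omega> \<partial>L) * ?Z \<omega>" if "\<omega> \<in> space M" for \<omega>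
    using dslt_approx_eq[OF that] by simp
  show "integrable M (\<lambda>\<omega>. dslt_approx B T \<epsilon> \<omega> * ?Z \<omega>)"
    using swap(3) by (subst Bochner_Integration.integrable_cong[OF refl eq])
  have val: "expectation (\<lambda>\<omega>. g x \<omega> * ?Z \<omega>) = - (1 / sqrt (2 * pi)) * ?Q x" for x
  proof (cases "x \<in> time_triangle T")
    case True
    obtain t s where x: "x = (t, s)" by (cases x)
    have t: "0 \<le> s" "s \<le> t" using True by (auto simp: x time_triangle_def)
    have "expectation (\<lambda>\<omega>. g x \<omega> * ?Z \<omega>) = expectation (\<lambda>\<omega>. heat_kernel' \<epsilon> (B t \<omega> - B s \<omega>) * ?Z \<omega>)"
      using True t by (simp add: g_def x)
    also have "\<dots> = - (incr_cov H s t 0 T * (\<epsilon> + (t - s) powr (2*H)) powr (- (3/2)) / sqrt (2 * pi))"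
      using t T by (subst expectation_heat_kernel'_linear[OF pair \<epsilon>]) (simp_all add: second_moment fbm_increments[OF B])
    finally show ?thesis using True by (simp add: x)
  qed (simp add: g_def)
  have Q0: "0 \<le> ?Q x" for x
  proof (cases "x \<in> time_triangle T")
    case True
    then have "0 \<le> incr_cov H (snd x) (fst x) 0 T"
      using H T by (intro incr_cov_nonneg) (auto simp: time_triangle_def)
    then show ?thesis by simp
  qed auto
  have s: "sqrt (2 * pi) > 0" by simp
  have "expectation (\<lambda>\<omega>. dslt_approx B T \<epsilon> \<omega> * ?Z \<omega>) = expectation (\<lambda>\<omega>. (\<integral>x. g x \<omega> \<partial>L) * ?Z \<omega>)"
    by (intro Bochner_Integration.integral_cong refl eq)
  also have "\<dots> = (\<integral>x. - (1 / sqrt (2 * pi)) * ?Q x \<partial>L)" unfolding swap(2) val ..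
  also have "\<dots> = - (1 / sqrt (2 * pi)) * (\<integral>x. ?Q x \<partial>L)" by (rule integral_mult_right_zero)
  finally have E: "- sqrt (2 * pi) * expectation (\<lambda>\<omega>. dslt_approx B T \<epsilon> \<omega> * ?Z \<omega>) = (\<integral>x. ?Q x \<partial>L)"
    using s by simp
  show "0 \<le> - sqrt (2 * pi) * expectation (\<lambda>\<omega>. dslt_approx B T \<epsilon> \<omega> * ?Z \<omega>)"
    unfolding E by (rule Bochner_Integration.integral_nonneg) (rule Q0)
  have "integrable L (\<lambda>x. - sqrt (2 * pi) * (- (1 / sqrt (2 * pi)) * ?Q x))"
    using swap(1) unfolding val by (rule integrable_mult_right)
  then have "integrable L ?Q" by simp
  then have "ennreal (\<integral>x. ?Q x \<partial>L) = (\<integral>\<^sup>+x. ennreal (?Q x) \<partial>L)"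
    using Q0 by (intro nn_integral_eq_integral[symmetric]) auto
  also have "\<dots> = (\<integral>\<^sup>+t. \<integral>\<^sup>+s. ennreal (?Q (t, s)) \<partial>lborel \<partial>lborel)"
    by (rule lborel.nn_integral_fst[symmetric]) measurable
  also have "\<dots> = (\<integral>\<^sup>+t. \<integral>\<^sup>+s. ennreal ((\<epsilon> + (t - s) powr (2*H)) powr (- (3/2)) * incr_cov H s t 0 T) * indicator (time_triangle T) (t, s) \<partial>lborel \<partial>lborel)"
    by (intro nn_integral_cong) (auto simp: indicator_def)
  finally show "ennreal (- sqrt (2 * pi) * expectation (\<lambda>\<omega>. dslt_approx B T \<epsilon> \<omega> * ?Z \<omega>)) =
    (\<integral>\<^sup>+t. \<integral>\<^sup>+s. ennreal ((\<epsilon> + (t - s) powr (2*H)) powr (- (3/2)) * incr_cov H s t 0 T) * indicator (time_triangle T) (t, s) \<partial>lborel \<partial>lborel)"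
    unfolding E .
qed

end


section \<open>Convergence in \<open>L2\<close> and the limiting variance\<close>

lemma Beta_2_eq:
  assumes "0 < x"
  shows "Beta 2 x = 1 / (x * (x + 1 :: real))"
proof -
  have "x \<notin> \<int>\<^sub>\<le>\<^sub>0" "x + 1 \<notin> \<int>\<^sub>\<le>\<^sub>0" using assms by (auto elim!: nonpos_Ints_cases)
  then have "Gamma (x + 1 + 1) = (x + 1) * (x * Gamma x)" 
    using Gamma_plus1[of "x + 1"] Gamma_plus1[of x] by simp
  moreover have "Gamma (2::real) = 1" using Gamma_fact[of 1, where 'a = real] by simp
  moreover have "Gamma x \<noteq> 0" using Gamma_real_pos[OF assms] by linarith
  ultimately show ?thesis
    using assms by (simp add: Beta_def add.commute[of 2] add.assoc)
qed

theorem theorem4p1: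
  fixes M :: "'a measure" and B :: "real \<Rightarrow> 'a \<Rightarrow> real" and H T :: real
  assumes "T > 0" and "2 / 3 < H" and "H < 1"
    and "fractional_brownian_motion H M B"
    and "measurable_process M B"
  shows "converges_in_law M
           (\<lambda>\<epsilon> \<omega>. \<epsilon> powr (3 / 2 - 1 / H) * dslt_approx B T \<epsilon> \<omega>)
           (centered_normal
              (T powr (2 * H) * (2 * H - 1) / (4 * H * pi)
                * (Beta (1 / H) ((3 * H - 2) / (2 * H)))\<^sup>2 * Beta 2 (2 * H - 1)))
           (at_right 0)"
proof -
  note T = assms(1) and H = assms(2,3) and B = assms(4) and BM = assms(5)
  interpret prob_space M
    using B by (simp add: fractional_brownian_motion_def centered_gaussian_process_def)
  \<comment> \<open>This is \<open>power_kernel_integral (2*H) 1 (3/2) 1\<close> as a real number,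
    so that \<open>c\<close> is the constant of the limit variable.\<close>
  define J where "J = Beta (1/H) (3/2 - 1/H) / (2*H)"
  define a where "a = 3/2 - 1/H"
  define c where "c = J / sqrt (2 * pi)"
  define Y where "Y \<omega> = B T \<omega> - B 0 \<omega>" for \<omega>
  define \<alpha> where "\<alpha> = dslt_approx B T"
  have a: "0 < a" using H by (simp add: a_def field_simps)
  have J: "0 \<le> J"
    using H by (simp add: J_def Beta_def Gamma_real_pos less_imp_le field_simps)
  have c: "0 \<le> c" "c\<^sup>2 = J\<^sup>2 / (2 * pi)" using J by (auto simp: c_def power_divide)

  have "gaussian_pair M (\<lambda>\<omega>. B T \<omega> - B 0 \<omega>) (\<lambda>\<omega>. B T \<omega> - B 0 \<omega>)"
    using T by (intro gaussian_pair_increments[OF B]) auto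
  then have pair: "gaussian_pair M Y Y" by (simp add: Y_def[abs_def])
  note [measurable] = gaussian_pair_measurable(1)[OF pair]
  have iY: "integrable M (\<lambda>\<omega>. (Y \<omega>)\<^sup>2)" by (rule gaussian_pair_integrable(1)[OF pair])
  have EY: "expectation (\<lambda>\<omega>. (Y \<omega>)\<^sup>2) = T powr (2*H)"
    using fbm_increments[OF B, of 0 T 0 T] T by (simp add: Y_def power2_eq_square incr_cov_self)
  have law: "distr M borel (\<lambda>\<omega>. - c * Y \<omega>) = centered_normal (c\<^sup>2 * T powr (2*H))"
  proof -
    have "\<exists>\<gamma>\<ge>0. distr M borel (\<lambda>\<omega>. - c * Y \<omega> + 0 * Y \<omega>) = centered_normal \<gamma>"
      using pair unfolding gaussian_pair_def by blast
    then obtain \<gamma> where \<gamma>: "0 \<le> \<gamma>" "distr M borel (\<lambda>\<omega>. - c * Y \<omega>) = centered_normal \<gamma>" by auto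
    have "\<gamma> = expectation (\<lambda>\<omega>. (- c * Y \<omega>)\<^sup>2)"
      using centered_normal_rv(2)[OF _ \<gamma>] by simp
    also have "\<dots> = c\<^sup>2 * T powr (2*H)" by (simp add: power_mult_distrib EY)
    finally show ?thesis using \<gamma> by simp
  qed

  have sq: "(\<epsilon> powr a * \<alpha> \<epsilon> \<omega> - (- c * Y \<omega>))\<^sup>2 =
      (\<epsilon> powr a)\<^sup>2 * (\<alpha> \<epsilon> \<omega>)\<^sup>2 + 2 * c * \<epsilon> powr a * (\<alpha> \<epsilon> \<omega> * Y \<omega>) + c\<^sup>2 * (Y \<omega>)\<^sup>2" for \<epsilon> \<omega>
    by (simp add: power2_eq_square algebra_simps)
  let ?err = "\<lambda>\<epsilon>. expectation (\<lambda>\<omega>. (\<epsilon> powr a * \<alpha> \<epsilon> \<omega> - (- c * Y \<omega>))\<^sup>2)"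
  have i1: "integrable M (\<lambda>\<omega>. (\<alpha> \<epsilon> \<omega>)\<^sup>2)" and i2: "integrable M (\<lambda>\<omega>. \<alpha> \<epsilon> \<omega> * Y \<omega>)" if "0 < \<epsilon>" for \<epsilon>
    using dslt_approx_second_moment(1)[OF T H B BM that] dslt_approx_cross_moment(1)[OF T H B BM that]
    by (simp_all add: \<alpha>_def Y_def)
  have int: "integrable M (\<lambda>\<omega>. (\<epsilon> powr a * \<alpha> \<epsilon> \<omega> - (- c * Y \<omega>))\<^sup>2)" if "0 < \<epsilon>" for \<epsilon>
    unfolding sq using i1[OF that] i2[OF that] iY by simp
  have E: "?err \<epsilon> =
      (\<epsilon> powr a)\<^sup>2 * expectation (\<lambda>\<omega>. (\<alpha> \<epsilon> \<omega>)\<^sup>2) + 2 * c * \<epsilon> powr a * expectation (\<lambda>\<omega>. \<alpha> \<epsilon> \<omega> * Y \<omega>) + c\<^sup>2 * T powr (2*H)"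
    if "0 < \<epsilon>" for \<epsilon>
    unfolding sq using i1[OF that] i2[OF that] iY by (simp add: EY)

  obtain A0 B0 where AB: "0 \<le> A0" "0 \<le> B0" and upper: "\<And>\<epsilon>. 0 < \<epsilon> \<Longrightarrow>
    kernel_integral H T \<epsilon> \<le>
    ennreal (T powr (2*H) * J\<^sup>2 * \<epsilon> powr (2/H - 3) + A0 * \<epsilon> powr (1/H - 1/2 - 3*H/2) + B0 * \<epsilon> powr (1/H - 3/2))"
    using kernel_integral_le[OF H T] unfolding J_def by blast
  \<comment> \<open>The power of \<epsilon> that the correction on disjoint pairs retains after
    normalization; positive because \<open>2/3 < H < 1\<close>.\<close>
  define p where "p = 5/2 - 1/H - 3*H/2"
  have p: "0 < p"
  proof -
    have "p = (3*H - 2) * (1 - H) / (2*H)" using H by (simp add: p_def field_simps)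
    then show ?thesis using H by simp
  qed
  have second: "(\<epsilon> powr a)\<^sup>2 * expectation (\<lambda>\<omega>. (\<alpha> \<epsilon> \<omega>)\<^sup>2) \<le>
      (T powr (2*H) * J\<^sup>2 + A0 * \<epsilon> powr p + B0 * \<epsilon> powr a) / (2 * pi)" if \<epsilon>: "0 < \<epsilon>" for \<epsilon>
  proof -
    let ?R = "T powr (2*H) * J\<^sup>2 * \<epsilon> powr (2/H - 3) + A0 * \<epsilon> powr (1/H - 1/2 - 3*H/2) + B0 * \<epsilon> powr (1/H - 3/2)"
    have R: "0 \<le> ?R" using AB by simp
    have "ennreal (expectation (\<lambda>\<omega>. (\<alpha> \<epsilon> \<omega>)\<^sup>2)) \<le> ennreal (1 / (2 * pi)) * ennreal ?R"
      unfolding \<alpha>_def using dslt_approx_second_moment(2)[OF T H B BM \<epsilon>] upper[OF \<epsilon>]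
      by (rule order_trans[OF _ mult_left_mono]) auto
    also have "\<dots> = ennreal (1 / (2 * pi) * ?R)" using R by (intro ennreal_mult[symmetric]) auto
    finally have "expectation (\<lambda>\<omega>. (\<alpha> \<epsilon> \<omega>)\<^sup>2) \<le> 1 / (2 * pi) * ?R" using R by (subst (asm) ennreal_le_iff) auto
    then have "(\<epsilon> powr a)\<^sup>2 * expectation (\<lambda>\<omega>. (\<alpha> \<epsilon> \<omega>)\<^sup>2) \<le> (\<epsilon> powr a)\<^sup>2 * (1 / (2 * pi) * ?R)"
      by (intro mult_left_mono) auto
    also have "\<dots> = (T powr (2*H) * J\<^sup>2 * ((\<epsilon> powr a)\<^sup>2 * \<epsilon> powr (2/H - 3)) +
        A0 * ((\<epsilon> powr a)\<^sup>2 * \<epsilon> powr (1/H - 1/2 - 3*H/2)) + B0 * ((\<epsilon> powr a)\<^sup>2 * \<epsilon> powr (1/H - 3/2))) / (2 * pi)"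
      by (simp add: algebra_simps add_divide_distrib)
    also have "(\<epsilon> powr a)\<^sup>2 * \<epsilon> powr (2/H - 3) = 1"
      using \<epsilon> by (simp add: power2_eq_square powr_add[symmetric] a_def)
    also have "(\<epsilon> powr a)\<^sup>2 * \<epsilon> powr (1/H - 1/2 - 3*H/2) = \<epsilon> powr p"
    proof -
      have "a + a + (1/H - 1/2 - 3*H/2) = p" by (simp add: a_def p_def)
      then show ?thesis by (simp only: power2_eq_square powr_add[symmetric])
    qed
    also have "(\<epsilon> powr a)\<^sup>2 * \<epsilon> powr (1/H - 3/2) = \<epsilon> powr a"
    proof -
      have "a + a + (1/H - 3/2) = a" by (simp add: a_def)
      then show ?thesis by (simp only: power2_eq_square powr_add[symmetric])
    qed
    finally show ?thesis by simp
  qed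

  \<comment> \<open>Bound for the mass at lengths beyond \<open>\<eta>\<close>, lost by the cut-off
    in the cross moment.\<close>
  define K where "K \<eta> = \<eta> powr (2 - 3*H) / (3*H - 2)" for \<eta>
  have cross: "2 * c * \<epsilon> powr a * expectation (\<lambda>\<omega>. \<alpha> \<epsilon> \<omega> * Y \<omega>) \<le>
      - (J / pi * (T - \<eta>) powr (2*H) * (J - K \<eta> * \<epsilon> powr a))"
    if \<epsilon>: "0 < \<epsilon>" and \<eta>: "0 < \<eta>" "\<eta> < T" for \<epsilon> \<eta>
  proof -
    let ?E = "expectation (\<lambda>\<omega>. \<alpha> \<epsilon> \<omega> * Y \<omega>)"
    have "ennreal ((T - \<eta>) powr (2*H) * (\<epsilon> powr (1/H - 3/2) * J - K \<eta>)) \<le> ennreal (- sqrt (2 * pi) * ?E)"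
      using cross_integral_ge[OF H \<epsilon> \<eta>] dslt_approx_cross_moment(2)[OF T H B BM \<epsilon>]
      by (simp add: \<alpha>_def Y_def J_def K_def)
    moreover have "0 \<le> - sqrt (2 * pi) * ?E"
      using dslt_approx_cross_moment(3)[OF T H B BM \<epsilon>] by (simp add: \<alpha>_def Y_def)
    ultimately have "(T - \<eta>) powr (2*H) * (\<epsilon> powr (1/H - 3/2) * J - K \<eta>) \<le> - sqrt (2 * pi) * ?E"
      by (subst (asm) ennreal_le_iff)
    then have le: "(J / pi * \<epsilon> powr a) * ((T - \<eta>) powr (2*H) * (\<epsilon> powr (1/H - 3/2) * J - K \<eta>)) \<le> (J / pi * \<epsilon> powr a) * (- sqrt (2 * pi) * ?E)"
      using J by (intro mult_left_mono) auto
    have e1: "(J / pi * \<epsilon> powr a) * ((T - \<eta>) powr (2*H) * (\<epsilon> powr (1/H - 3/2) * J - K \<eta>)) =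
       J / pi * (T - \<eta>) powr (2*H) * (J * (\<epsilon> powr a * \<epsilon> powr (1/H - 3/2)) - K \<eta> * \<epsilon> powr a)"
      by (simp add: algebra_simps)
    have e2: "\<epsilon> powr a * \<epsilon> powr (1/H - 3/2) = 1"
      using \<epsilon> by (simp add: powr_add[symmetric] a_def)
    have e3: "(J / pi * \<epsilon> powr a) * (- sqrt (2 * pi) * ?E) = - (2 * c * \<epsilon> powr a * ?E)"
    proof -
      have "J / pi * sqrt (2 * pi) = 2 * c"
        by (simp add: c_def field_simps)
      then have "(J / pi * sqrt (2 * pi)) * (\<epsilon> powr a * ?E) = 2 * c * (\<epsilon> powr a * ?E)" by simp
      then show ?thesis by (simp only: mult_ac mult_minus_left mult_minus_right)
    qed
    show ?thesis
      using le unfolding e1 e2 e3 mult_1_right by (rule iffD1[OF le_minus_iff])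
  qed

  \<comment> \<open>Apart from the cut-off, the limits of the three contributions are 1, -2 and 1
    times \<open>c\<^sup>2 * T powr (2*H)\<close> and cancel; \<open>T - \<eta>\<close> in the
    middle one leaves a remainder that vanishes with \<open>\<eta>\<close>.\<close>
  define U where "U \<eta> \<epsilon> = (T powr (2*H) * J\<^sup>2 + A0 * \<epsilon> powr p + B0 * \<epsilon> powr a) / (2 * pi)
     - J / pi * (T - \<eta>) powr (2*H) * (J - K \<eta> * \<epsilon> powr a) + c\<^sup>2 * T powr (2*H)" for \<eta> \<epsilon>
  have EU: "?err \<epsilon> \<le> U \<eta> \<epsilon>"
    if "0 < \<epsilon>" "0 < \<eta>" "\<eta> < T" for \<epsilon> \<eta>
    unfolding E[OF that(1)] U_def using second[OF that(1)] cross[OF that] by simp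

  have lim0: "((\<lambda>\<epsilon>. ?err \<epsilon>) \<longlongrightarrow> 0) (at_right 0)"
  proof (rule order_tendstoI)
    fix e :: real assume "e < 0"
    then have "e < ?err \<epsilon>" for \<epsilon>
      by (rule less_le_trans) simp
    then show "\<forall>\<^sub>F \<epsilon> in at_right 0. e < ?err \<epsilon>" by simp
  next
    fix e :: real assume e: "0 < e"
    have powr0: "((\<lambda>\<epsilon>. \<epsilon> powr r) \<longlongrightarrow> 0) (at_right 0)" if "0 < r" for r :: real
      using that by real_asymp
    have lim: "((\<lambda>\<epsilon>. U \<eta> \<epsilon>) \<longlongrightarrow> J\<^sup>2 / pi * (T powr (2*H) - (T - \<eta>) powr (2*H))) (at_right 0)" for \<eta>
    proof -
      have "((\<lambda>\<epsilon>. U \<eta> \<epsilon>) \<longlongrightarrow> (T powr (2*H) * J\<^sup>2 + A0 * 0 + B0 * 0) / (2 * pi)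
         - J / pi * (T - \<eta>) powr (2*H) * (J - K \<eta> * 0) + c\<^sup>2 * T powr (2*H)) (at_right 0)"
        unfolding U_def by (intro tendsto_intros powr0 a p) auto
      also have "(T powr (2*H) * J\<^sup>2 + A0 * 0 + B0 * 0) / (2 * pi)
         - J / pi * (T - \<eta>) powr (2*H) * (J - K \<eta> * 0) + c\<^sup>2 * T powr (2*H) =
        J\<^sup>2 / pi * (T powr (2*H) - (T - \<eta>) powr (2*H))"
        unfolding c(2) by (simp add: power2_eq_square field_simps)
      finally show ?thesis .
    qed
    \<comment> \<open>The cut-off must be fixed before \<epsilon> tends to 0, since
      \<open>K \<eta>\<close> blows up as \<open>\<eta>\<close> tends to 0.\<close>
    have "((\<lambda>\<eta>. J\<^sup>2 / pi * (T powr (2*H) - (T - \<eta>) powr (2*H))) \<longlongrightarrow>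
        J\<^sup>2 / pi * (T powr (2*H) - (T - 0) powr (2*H))) (at_right 0)"
      using T by (intro tendsto_intros) auto
    then have "\<forall>\<^sub>F \<eta> in at_right 0. J\<^sup>2 / pi * (T powr (2*H) - (T - \<eta>) powr (2*H)) < e"
      using e by (intro order_tendstoD) auto
    moreover have "\<forall>\<^sub>F \<eta> in at_right 0. \<eta> \<in> {0<..<T}"
      using T by (rule eventually_at_right_real)
    ultimately have "\<forall>\<^sub>F \<eta> in at_right 0. J\<^sup>2 / pi * (T powr (2*H) - (T - \<eta>) powr (2*H)) < e \<and> \<eta> \<in> {0<..<T}"
      by (rule eventually_conj)
    then obtain \<eta> where \<eta>: "J\<^sup>2 / pi * (T powr (2*H) - (T - \<eta>) powr (2*H)) < e" "0 < \<eta>" "\<eta> < T"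
      using eventually_happens'[OF trivial_limit_at_right_real] by fastforce
    have "\<forall>\<^sub>F \<epsilon> in at_right 0. U \<eta> \<epsilon> < e"
      by (rule order_tendstoD(2)[OF lim \<eta>(1)])
    moreover have "\<forall>\<^sub>F \<epsilon> in at_right (0::real). 0 < \<epsilon>" by (rule eventually_at_right_less)
    ultimately show "\<forall>\<^sub>F \<epsilon> in at_right 0. ?err \<epsilon> < e"
      by eventually_elim (rule le_less_trans[OF EU[OF _ \<eta>(2,3)]])
  qed
  have pos: "\<forall>\<^sub>F \<epsilon> in at_right (0::real). 0 < \<epsilon>" by (rule eventually_at_right_less)
  then have meas: "\<forall>\<^sub>F \<epsilon> in at_right 0. (\<lambda>\<omega>. \<epsilon> powr a * \<alpha> \<epsilon> \<omega>) \<in> borel_measurable M"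
    by eventually_elim (use dslt_approx_measurable[OF T H B BM] in \<open>simp add: \<alpha>_def\<close>)
  from pos have int_ev: "\<forall>\<^sub>F \<epsilon> in at_right 0. integrable M (\<lambda>\<omega>. (\<epsilon> powr a * \<alpha> \<epsilon> \<omega> - (- c * Y \<omega>))\<^sup>2)"
    by eventually_elim (rule int)
  have "converges_in_law M (\<lambda>\<epsilon> \<omega>. \<epsilon> powr a * \<alpha> \<epsilon> \<omega>) (distr M borel (\<lambda>\<omega>. - c * Y \<omega>)) (at_right 0)"
    by (rule converges_in_law_of_L2[OF meas _ int_ev lim0]) measurable
  then have "converges_in_law M (\<lambda>\<epsilon> \<omega>. \<epsilon> powr (3 / 2 - 1 / H) * dslt_approx B T \<epsilon> \<omega>) (centered_normal (c\<^sup>2 * T powr (2*H))) (at_right 0)"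
    unfolding law a_def \<alpha>_def .
  also have "c\<^sup>2 * T powr (2*H) = T powr (2 * H) * (2 * H - 1) / (4 * H * pi)
      * (Beta (1 / H) ((3 * H - 2) / (2 * H)))\<^sup>2 * Beta 2 (2 * H - 1)"
  proof -
    have "(3 * H - 2) / (2 * H) = 3/2 - 1/H" using H by (simp add: field_simps)
    moreover have "Beta 2 (2 * H - 1) = 1 / ((2 * H - 1) * (2 * H))"
      using Beta_2_eq[of "2 * H - 1"] H by simp
    ultimately show ?thesis
      unfolding c(2) J_def using H by (simp add: power_divide power2_eq_square) (simp only: mult_ac)
  qed
  finally show ?thesis .
qed

end
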